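(* Let $M$ be a compact piecewise-linear $d$-dimensional manifold (not necessarily orientable, with or without boundary), and let $Q$ be a quadrangulation of $M$. Let $L:V(Q)\to V(C^d)=\{0,1\}^d$ be a labelling such that $f_L(\partial Q)\subseteq\partial C^d$ and $\deg_2(L,\partial Q)\neq 0$. Then $Q$ contains at least one centrally labelled cell.
   Context: $C^k=[0,1]^k$ is the unit $k$-cube; $V(C^k)=\{0,1\}^k$. A quadrangulation $Q$ of $M$ is a collection of cells of dimensions $0,\dots,d$ such that (1) each $k$-cell is homeomorphic to $C^k$ (faces corresponding to faces of $C^k$), (2) every face of a cell of $Q$ is in $Q$, (3) any nonempty intersection of two cells is a face of each, (4) the union of the cells is $M$. $V(Q)$ is the vertex set of $Q$. A map $C^n\to\mathbb{R}^d$ is multilinear if each coordinate is a polynomial of degree at most 1 in each variable $x_1,\dots,x_n$ separately. $f_L:M\to C^d$ is the piecewise multilinear map which on each $n$-cell $\sigma$ (identified with $C^n$) is the unique multilinear map agreeing with $L$ at the vertices of $\sigma$. When $f_L(\partial Q)\subseteq\partial C^d$, $\deg_2(L,\partial Q)\in\{0,1\}$ denotes the degree modulo 2 of $f_L|_{\partial Q}:\partial Q\to\partial C^d$ (taken to be $0$ if $\partial Q=\emptyset$). A cell $\sigma\in Q$ is centrally labelled if some point $x$ in the relative interior of $\sigma$ satisfies $f_L(x)=(1/2,\dots,1/2)$. *)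

theory Defs
  imports "HOL-Analysis.Analysis"
begin

section \<open>Cubes\<close>

text \<open>Cubes of all dimensions are needed at once, so \<open>\<real>\<^sup>k\<close> is modelled as in
  \<^const>\<open>Euclidean_space\<close>: sequences vanishing from index \<open>k\<close> on, with the product topology.\<close>

definition cube :: "nat \<Rightarrow> (nat \<Rightarrow> real) set" where
  "cube k = {x. (\<forall>i<k. 0 \<le> x i \<and> x i \<le> 1) \<and> (\<forall>i\<ge>k. x i = 0)}"

definition cube_vertices :: "nat \<Rightarrow> (nat \<Rightarrow> real) set" where
  "cube_vertices k = {x. (\<forall>i<k. x i = 0 \<or> x i = 1) \<and> (\<forall>i\<ge>k. x i = 0)}"

definition open_cube :: "nat \<Rightarrow> (nat \<Rightarrow> real) set" where
  "open_cube k = {x. (\<forall>i<k. 0 < x i \<and> x i < 1) \<and> (\<forall>i\<ge>k. x i = 0)}"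

definition cube_boundary :: "nat \<Rightarrow> (nat \<Rightarrow> real) set" where
  "cube_boundary k = {x \<in> cube k. \<exists>i<k. x i = 0 \<or> x i = 1}"

definition cube_center :: "nat \<Rightarrow> nat \<Rightarrow> real" where
  "cube_center k = (\<lambda>i. if i < k then 1/2 else 0)"

text \<open>The nonempty faces of \<open>cube k\<close> (including the cube itself): the coordinates in \<open>I\<close> are
  frozen to the values \<open>e i\<close>.\<close>

definition cube_faces :: "nat \<Rightarrow> (nat \<Rightarrow> real) set set" where
  "cube_faces k = {{x \<in> cube k. \<forall>i\<in>I. x i = e i} | I e.
                     I \<subseteq> {..<k} \<and> (\<forall>i\<in>I. e i = 0 \<or> e i = 1)}"


section \<open>Compact piecewise-linear manifolds\<close>

text \<open>A PL map on a compact polyhedron: affine on each member of a finite cover by polytopes.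
  For such \<open>X\<close> continuity is automatic, since polytopes are closed.\<close>

definition pl_map_on ::
    "'a::euclidean_space set \<Rightarrow> ('a \<Rightarrow> 'b::euclidean_space) \<Rightarrow> bool" where
  "pl_map_on X h \<longleftrightarrow>
     (\<exists>\<P>. finite \<P> \<and> \<Union>\<P> = X \<and>
          (\<forall>P\<in>\<P>. polytope P \<and> (\<exists>g c. linear g \<and> (\<forall>x\<in>P. h x = g x + c))))"

definition compact_polyhedron :: "'a::euclidean_space set \<Rightarrow> bool" where
  "compact_polyhedron X \<longleftrightarrow> (\<exists>\<P>. finite \<P> \<and> \<Union>\<P> = X \<and> (\<forall>P\<in>\<P>. polytope P))"

text \<open>\<open>N\<close> is a neighbourhood of \<open>x\<close> in \<open>M\<close> that \<open>h\<close> maps PL homeomorphically onto a \<open>d\<close>-simplex;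
  the inverse of a PL homeomorphism of compact polyhedra is again PL.\<close>

definition pl_ball_nbhd ::
    "nat \<Rightarrow> 'a::euclidean_space set \<Rightarrow> 'a \<Rightarrow> 'a set \<Rightarrow> 'a set \<Rightarrow> ('a \<Rightarrow> 'a) \<Rightarrow> bool" where
  "pl_ball_nbhd d M x N S h \<longleftrightarrow>
     N \<subseteq> M \<and> (\<exists>U. openin (top_of_set M) U \<and> x \<in> U \<and> U \<subseteq> N) \<and>
     int d simplex S \<and> pl_map_on N h \<and> (\<exists>h'. homeomorphism N S h h')"

text \<open>Manifolds with (possibly empty) boundary: every point has a neighbourhood that is a PL
  \<open>d\<close>-ball. Points of the boundary are those lying on the sphere bounding such a ball.\<close>

definition compact_pl_manifold :: "nat \<Rightarrow> 'a::euclidean_space set \<Rightarrow> bool" where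
  "compact_pl_manifold d M \<longleftrightarrow>
     compact_polyhedron M \<and> (\<forall>x\<in>M. \<exists>N S h. pl_ball_nbhd d M x N S h)"

definition manifold_boundary :: "nat \<Rightarrow> 'a::euclidean_space set \<Rightarrow> 'a set" where
  "manifold_boundary d M =
     {x \<in> M. \<exists>N S h. pl_ball_nbhd d M x N S h \<and> h x \<in> rel_frontier S}"


section \<open>Quadrangulations\<close>

text \<open>A cell \<open>\<sigma>\<close> comes with its dimension \<open>cdim Q \<sigma>\<close> and its identification
  \<open>chart Q \<sigma>\<close> of \<open>cube (cdim Q \<sigma>)\<close> with \<open>\<sigma>\<close>.\<close>

record 'a cell_system =
  cells :: "'a set set"
  cdim :: "'a set \<Rightarrow> nat"
  chart :: "'a set \<Rightarrow> (nat \<Rightarrow> real) \<Rightarrow> 'a"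

definition faces :: "'a cell_system \<Rightarrow> 'a set \<Rightarrow> 'a set set" where
  "faces Q \<sigma> = (\<lambda>F. chart Q \<sigma> ` F) ` cube_faces (cdim Q \<sigma>)"

definition rel_interior_cell :: "'a cell_system \<Rightarrow> 'a set \<Rightarrow> 'a set" where
  "rel_interior_cell Q \<sigma> = chart Q \<sigma> ` open_cube (cdim Q \<sigma>)"

definition vertices :: "'a cell_system \<Rightarrow> 'a set" where
  "vertices Q = {v. {v} \<in> cells Q}"

text \<open>The last clause says that faces of cells correspond to faces of cubes compatibly with the
  identifications: if \<open>\<tau>\<close> is contained in \<open>\<sigma>\<close> (so is a face of it), then the change of coordinates
  from \<open>\<tau>\<close> to \<open>\<sigma>\<close> is affine, hence an affine isomorphism from a cube onto a face of a cube. This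
  is what makes ``multilinear on each cell'' consistent between a cell and its faces.\<close>

definition quadrangulation ::
    "nat \<Rightarrow> 'a::topological_space set \<Rightarrow> 'a cell_system \<Rightarrow> bool" where
  "quadrangulation d M Q \<longleftrightarrow>
     finite (cells Q) \<and>
     (\<forall>\<sigma>\<in>cells Q. cdim Q \<sigma> \<le> d \<and>
        (\<exists>\<psi>. homeomorphism (cube (cdim Q \<sigma>)) \<sigma> (chart Q \<sigma>) \<psi>)) \<and>
     (\<forall>\<sigma>\<in>cells Q. faces Q \<sigma> \<subseteq> cells Q) \<and>
     (\<forall>\<sigma>\<in>cells Q. \<forall>\<tau>\<in>cells Q. \<sigma> \<inter> \<tau> \<noteq> {} \<longrightarrow> \<sigma> \<inter> \<tau> \<in> faces Q \<sigma> \<and> \<sigma> \<inter> \<tau> \<in> faces Q \<tau>) \<and>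
     \<Union>(cells Q) = M \<and>
     (\<forall>\<sigma>\<in>cells Q. \<forall>\<tau>\<in>cells Q. \<tau> \<subseteq> \<sigma> \<longrightarrow>
        (\<forall>i<cdim Q \<sigma>. \<exists>a b. \<forall>u\<in>cube (cdim Q \<tau>).
           inv_into (cube (cdim Q \<sigma>)) (chart Q \<sigma>) (chart Q \<tau> u) i
             = b + (\<Sum>m<cdim Q \<tau>. a m * u m)))"


section \<open>The piecewise multilinear map of a labelling\<close>

text \<open>Maps \<open>cube n \<rightarrow> \<real>\<^sup>d\<close> whose coordinates are polynomials of degree at most 1 in each variable
  separately, i.e. linear combinations of the square-free monomials.\<close>

definition multilinear :: "nat \<Rightarrow> nat \<Rightarrow> ((nat \<Rightarrow> real) \<Rightarrow> (nat \<Rightarrow> real)) \<Rightarrow> bool" where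
  "multilinear n d g \<longleftrightarrow>
     (\<forall>i<d. \<exists>a :: nat set \<Rightarrow> real. \<forall>x\<in>cube n. g x i = (\<Sum>S\<in>Pow {..<n}. a S * (\<Prod>j\<in>S. x j))) \<and>
     (\<forall>i\<ge>d. \<forall>x\<in>cube n. g x i = 0)"

definition multilinear_extension ::
    "nat \<Rightarrow> 'a cell_system \<Rightarrow> ('a \<Rightarrow> nat \<Rightarrow> real) \<Rightarrow> ('a \<Rightarrow> nat \<Rightarrow> real) \<Rightarrow> bool" where
  "multilinear_extension d Q L f \<longleftrightarrow>
     (\<forall>\<sigma>\<in>cells Q. multilinear (cdim Q \<sigma>) d (f \<circ> chart Q \<sigma>) \<and>
        (\<forall>v\<in>cube_vertices (cdim Q \<sigma>). f (chart Q \<sigma> v) = L (chart Q \<sigma> v)))"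

text \<open>For a quadrangulation of \<open>M\<close> such an extension exists, and its values on \<open>M\<close> are unique
  (a multilinear map on a cube is determined by its values at the vertices).\<close>

definition f_L :: "nat \<Rightarrow> 'a cell_system \<Rightarrow> ('a \<Rightarrow> nat \<Rightarrow> real) \<Rightarrow> 'a \<Rightarrow> nat \<Rightarrow> real" where
  "f_L d Q L = (SOME f. multilinear_extension d Q L f)"

definition centrally_labelled ::
    "nat \<Rightarrow> 'a cell_system \<Rightarrow> ('a \<Rightarrow> nat \<Rightarrow> real) \<Rightarrow> 'a set \<Rightarrow> bool" where
  "centrally_labelled d Q L \<sigma> \<longleftrightarrow>
     (\<exists>x\<in>rel_interior_cell Q \<sigma>. f_L d Q L x = cube_center d)"


section \<open>Degree modulo 2\<close>

text \<open>The degree modulo 2 of a map \<open>f : X \<rightarrow> Y\<close> of closed manifolds of equal dimension is the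
  parity of the number of preimages of a generic point of \<open>Y\<close>, where generic points are those at
  whose preimages \<open>f\<close> is a local homeomorphism. Every preimage of such a point has local degree 1
  modulo 2, so the parity does not depend on the point as long as \<open>f\<close> has a degree
  (\<open>Y\<close> connected, or \<open>Y\<close> the 0-sphere and \<open>X\<close> bounding). Piecewise smooth maps, in particular
  piecewise multilinear ones, have generic points by Sard's theorem. If \<open>X\<close> is empty, the degree
  is 0.\<close>

definition generic_value ::
    "('a::topological_space \<Rightarrow> 'b::topological_space) \<Rightarrow> 'a set \<Rightarrow> 'b set \<Rightarrow> 'b \<Rightarrow> bool" where
  "generic_value f X Y y \<longleftrightarrow> y \<in> Y \<and>
     (\<forall>x\<in>X. f x = y \<longrightarrow>
        (\<exists>U V g. openin (top_of_set X) U \<and> x \<in> U \<and> openin (top_of_set Y) V \<and>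
                 homeomorphism U V f g))"

definition deg2 ::
    "('a::topological_space \<Rightarrow> 'b::topological_space) \<Rightarrow> 'a set \<Rightarrow> 'b set \<Rightarrow> nat" where
  "deg2 f X Y = (if \<exists>y. generic_value f X Y y \<and> odd (card {x \<in> X. f x = y}) then 1 else 0)"

end

theory Submission
  imports Defs "HOL-Homology.Homology"
begin

text \<open>
  If no cell is centrally labelled, then \<open>f_L\<close> misses the centre of \<open>C\<^sup>d\<close>, and radial projection turns
  it into a map \<open>F\<close> from \<open>M\<close> to \<open>S = \<partial>C\<^sup>d\<close> that agrees with \<open>f_L\<close> on \<open>\<partial>M\<close>. The number of preimages in
  \<open>\<partial>M\<close> of a generic value is unchanged under small perturbations of the value, and the images of the
  cells of dimension below \<open>d - 1\<close> are nowhere dense in \<open>S\<close>; so choose a generic value \<open>y\<close> that avoids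
  them. Then each \<open>(d - 1)\<close>-cell \<open>\<tau>\<close> has a local degree modulo 2 at \<open>y\<close>, read off from
  \<open>H\<^bsub>d-1\<^esub>(S, S - y) \<cong> \<int>\<close>. For a fixed \<open>d\<close>-cell the local degrees of its facets add up to zero modulo 2,
  because \<open>F\<close> extends over the cell. Summing over all \<open>d\<close>-cells, every \<open>(d - 1)\<close>-cell is counted once
  for each \<open>d\<close>-cell containing it; by invariance of domain this is twice in the interior of \<open>M\<close> and
  once in \<open>\<partial>M\<close>. Hence the local degrees of the boundary cells add up to zero modulo 2. As \<open>f_L\<close> is a
  local homeomorphism at the preimages of \<open>y\<close>, the local degree of a boundary cell is its number of
  preimages modulo 2, so the degree of \<open>f_L\<close> on \<open>\<partial>M\<close> vanishes.
\<close>

section \<open>Relative homology and finitely many closed sets\<close>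

text \<open>Preimages can be counted only on \<open>\<partial>M\<close>, where the value is generic;
  elsewhere the fibres of \<open>F\<close> may be infinite. Local degrees take the place of the
  count there, since they ask for continuity only. Homology is integral and no orientation is fixed,
  so a local degree is known up to sign; only its parity is ever used. To compare local degrees
  across cells, they are all taken relative to the complement of a compact core, the cube shrunk by
  a margin \<open>\<epsilon>\<close>. Such a margin exists because a value avoiding the small cells
  has its preimages in the \<open>(d - 1)\<close>-cells inside the open cubes, where they form
  compact sets. Cores are compatible with passing from a cell to its facets, because affine
  transition maps merely permute and reflect coordinates. Moreover the complement of a core in the
  sphere is contractible, by a cone condition shared with single points, so one fundamental class
  restricts to a generator at every core and at every point.\<close>

abbreviation HG :: "int \<Rightarrow> 'a::topological_space set \<Rightarrow> 'a set \<Rightarrow> 'a chain set monoid" where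
  "HG p A B \<equiv> relative_homology_group p (top_of_set A) B"

abbreviation HI :: "int \<Rightarrow> 'a::topological_space set \<Rightarrow> 'a set \<Rightarrow> 'b::topological_space set \<Rightarrow> 'b set
    \<Rightarrow> ('a \<Rightarrow> 'b) \<Rightarrow> 'a chain set \<Rightarrow> 'b chain set" where
  "HI p A B C D f \<equiv> hom_induced p (top_of_set A) B (top_of_set C) D f"

lemma HI_compose:
  assumes "continuous_on A f" "f ` A \<subseteq> C" "f ` B \<subseteq> D" "continuous_on C g" "g ` C \<subseteq> E" "g ` D \<subseteq> F"
  shows "HI p C D E F g (HI p A B C D f x) = HI p A B E F (g \<circ> f) x"
  by (rule hom_induced_compose') (use assms in \<open>auto simp: continuous_map_in_subtopology\<close>)

lemma HI_incl_compose:
  assumes "A \<subseteq> C" "B \<subseteq> D" "continuous_on C g" "g ` C \<subseteq> E" "g ` D \<subseteq> F"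
  shows "HI p C D E F g (HI p A B C D id x) = HI p A B E F g x"
  using assms by (subst HI_compose) auto

lemma HI_hom: "HI p A B C D f \<in> hom (HG p A B) (HG p C D)"
  by (simp add: hom_induced_hom)

lemma HI_group_hom: "group_hom (HG p A B) (HG p C D) (HI p A B C D f)"
  by (simp add: group_hom_def group_hom_axioms_def hom_induced_hom)

text \<open>The closed set \<open>Z\<close> witnesses that the closure of the excised part
  \<open>A - N\<close> lies in the interior of \<open>B\<close>. \<open>N\<close> is not assumed
  open, so that it may be a closed facet of the boundary of a cube.\<close>

lemma excision_iso:
  assumes "N \<subseteq> A" "openin (top_of_set A) B" "closedin (top_of_set A) Z" "A - N \<subseteq> Z" "Z \<subseteq> B"
  shows "HI p N (N \<inter> B) A B id \<in> iso (HG p N (N \<inter> B)) (HG p A B)"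
proof -
  have "B \<subseteq> A"
    using assms(2) openin_imp_subset by blast
  then have eq: "A - (A - N) = N" "B - (A - N) = N \<inter> B" "A \<inter> N = N"
    using assms by auto
  have "(top_of_set A) closure_of (A - N) \<subseteq> (top_of_set A) interior_of B"
    using assms closure_of_minimal[of "A - N" Z "top_of_set A"] by (simp add: interior_of_openin)
  from homology_excision_axiom[OF this \<open>B \<subseteq> A\<close>, of p] show ?thesis
    by (simp add: eq subtopology_subtopology)
qed

lemma iso_obtain_preimage:
  assumes "h \<in> iso G H" "y \<in> carrier H"
  obtains x where "x \<in> carrier G" "h x = y"
  using assms by (metis (no_types, lifting) Group.iso_def bij_betw_def imageE mem_Collect_eq)

text \<open>By excision, the two open sets split the homology of \<open>A\<close> relative to \<open>O1 \<inter> O2\<close> into the parts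
  supported near the complements of \<open>O1\<close> and of \<open>O2\<close>.\<close>

lemma relative_homology_split2:
  assumes "openin (top_of_set A) O1" "openin (top_of_set A) O2" "O1 \<union> O2 = A"
    and e: "e \<in> carrier (HG p A (O1 \<inter> O2))"
  shows "\<exists>a\<in>carrier (HG p O2 (O1 \<inter> O2)). \<exists>b\<in>carrier (HG p O1 (O1 \<inter> O2)).
      e = HI p O2 (O1 \<inter> O2) A (O1 \<inter> O2) id a \<otimes>\<^bsub>HG p A (O1 \<inter> O2)\<^esub> HI p O1 (O1 \<inter> O2) A (O1 \<inter> O2) id b \<and>
      HI p O2 (O1 \<inter> O2) A O1 id a = HI p A (O1 \<inter> O2) A O1 id e \<and>
      HI p O1 (O1 \<inter> O2) A O2 id b = HI p A (O1 \<inter> O2) A O2 id e"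
proof -
  let ?O = "O1 \<inter> O2" and ?X = "top_of_set A"
  have sub: "O1 \<subseteq> A" "O2 \<subseteq> A" using assms by auto
  have U: "A - O2 \<subseteq> O1" "A - O1 \<subseteq> O2" using assms(3) by auto
  have cl: "closedin ?X (A - O1)" "closedin ?X (A - O2)"
    using assms(1,2) by (auto intro!: closedin_diff)
  have s1: "subtopology ?X O1 = top_of_set O1" "subtopology ?X O2 = top_of_set O2"
    using sub by (simp_all add: subtopology_subtopology Int_absorb1)
  have h: "HI p O2 ?O A O1 id \<in> iso (HG p O2 ?O) (HG p A O1)"
    using excision_iso[OF sub(2) assms(1) cl(2) order_refl U(1), of p] by (simp only: Int_commute)
  have k: "HI p O1 ?O A O2 id \<in> iso (HG p O1 ?O) (HG p A O2)"
    using excision_iso[OF sub(1) assms(2) cl(1) order_refl U(2), of p] .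
  have ex1: "exact_seq ([HG p A O2, HG p A ?O, HG p O2 ?O], [HI p A ?O A O2 id, HI p O2 ?O A ?O id])"
    using homology_exactness_triple_3[of ?O O2 p ?X] s1 by simp
  have ex2: "exact_seq ([HG p A O1, HG p A ?O, HG p O1 ?O], [HI p A ?O A O1 id, HI p O1 ?O A ?O id])"
    using homology_exactness_triple_3[of ?O O1 p ?X] s1 by simp
  have c1: "HI p A ?O A O1 id (HI p O2 ?O A ?O id x) = HI p O2 ?O A O1 id x" for x
    by (rule HI_incl_compose) (use sub in auto)
  have c2: "HI p A ?O A O2 id (HI p O1 ?O A ?O id x) = HI p O1 ?O A O2 id x" for x
    by (rule HI_incl_compose) (use sub in auto)
  \<comment> \<open>Two exact triples with a common middle group whose crosswise composites
    \<open>h\<close> and \<open>k\<close> are excision isomorphisms exhibit the middle group as a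
    direct product.\<close>
  have *: "(\<lambda>(x, y). HI p O2 ?O A ?O id x \<otimes>\<^bsub>HG p A ?O\<^esub> HI p O1 ?O A ?O id y)
      \<in> iso (HG p O2 ?O \<times>\<times> HG p O1 ?O) (HG p A ?O)"
    using exact_sequence_sum_lemma[OF _ h k ex1 ex2 c1 c2] by simp
  then obtain a b where ab: "a \<in> carrier (HG p O2 ?O)" "b \<in> carrier (HG p O1 ?O)"
      "e = HI p O2 ?O A ?O id a \<otimes>\<^bsub>HG p A ?O\<^esub> HI p O1 ?O A ?O id b"
  proof -
    obtain z where "z \<in> carrier (HG p O2 ?O \<times>\<times> HG p O1 ?O)"
      "(\<lambda>(x, y). HI p O2 ?O A ?O id x \<otimes>\<^bsub>HG p A ?O\<^esub> HI p O1 ?O A ?O id y) z = e"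
      using iso_obtain_preimage[OF * e] by blast
    then show thesis
      using that by (cases z) (auto simp: DirProd_def)
  qed
  let ?ia = "HI p O2 ?O A ?O id a" and ?jb = "HI p O1 ?O A ?O id b"
  have car: "?ia \<in> carrier (HG p A ?O)" "?jb \<in> carrier (HG p A ?O)"
    by (simp_all add: hom_induced_carrier)
  \<comment> \<open>Exactness kills \<open>b\<close> relative to \<open>O1\<close> and
    \<open>a\<close> relative to \<open>O2\<close>; hence each restriction of \<open>e\<close> sees
    only one of the two parts.\<close>
  have z1: "HI p A ?O A O1 id ?jb = \<one>\<^bsub>HG p A O1\<^esub>" 
    using ex2 ab(2) unfolding exact_seq_cons_iff by (auto simp: kernel_def)
  have z2: "HI p A ?O A O2 id ?ia = \<one>\<^bsub>HG p A O2\<^esub>" 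
    using ex1 ab(1) unfolding exact_seq_cons_iff by (auto simp: kernel_def)
  interpret g1: group_hom "HG p A ?O" "HG p A O1" "HI p A ?O A O1 id" by (rule HI_group_hom)
  interpret g2: group_hom "HG p A ?O" "HG p A O2" "HI p A ?O A O2 id" by (rule HI_group_hom)
  have "HI p A ?O A O1 id e = HI p O2 ?O A O1 id a"
    using z1 c1[of a] car ab by (simp add: hom_induced_carrier)
  moreover have "HI p A ?O A O2 id e = HI p O1 ?O A O2 id b"
    using z2 c2[of b] car ab by (simp add: hom_induced_carrier)
  ultimately show ?thesis
    using ab by metis
qed

text \<open>Additivity over the sets \<open>K i\<close>. The induction splits off one of them, with
  \<open>K i\<close> and the union of the others as the two closed sets; the rest then lives on
  \<open>A - K i\<close>, which is why \<open>A\<close> and \<open>e\<close> vary. The equation for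
  \<open>a i\<close> pins the local class down through its image in the homology at
  \<open>K i\<close>, and this is how it is later recognized as a generator. The homomorphism
  \<open>\<kappa>\<close> turns the group operation into a sum of integers.\<close>

lemma relative_homology_split:
  assumes "finite I"
    and "\<And>i. i \<in> I \<Longrightarrow> closedin (top_of_set A) (K i)"
    and "\<And>i. i \<in> I \<Longrightarrow> openin (top_of_set A) (N i)"
    and "\<And>i. i \<in> I \<Longrightarrow> K i \<subseteq> N i"
    and "\<And>i j. i \<in> I \<Longrightarrow> j \<in> I \<Longrightarrow> i \<noteq> j \<Longrightarrow> N i \<inter> K j = {}"
    and "e \<in> carrier (HG p A (A - \<Union>(K ` I)))"
    and "continuous_on A g" "g ` A \<subseteq> C" "g ` (A - \<Union>(K ` I)) \<subseteq> D"
    and chi: "\<kappa> \<in> hom (HG p C D) integer_group"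
  shows "\<exists>a. (\<forall>i\<in>I. a i \<in> carrier (HG p (N i) (N i - K i)) \<and>
           HI p (N i) (N i - K i) A (A - K i) id (a i) = HI p A (A - \<Union>(K ` I)) A (A - K i) id e) \<and>
         \<kappa> (HI p A (A - \<Union>(K ` I)) C D g e) = (\<Sum>i\<in>I. \<kappa> (HI p (N i) (N i - K i) C D g (a i)))"
  using assms(1-9)
proof (induction I arbitrary: A e rule: finite_induct)
  case empty
  have "trivial_group (HG p A A)"
    using trivial_relative_homology_group_topspace[of p "top_of_set A"] by simp
  then have e: "e = \<one>\<^bsub>HG p A A\<^esub>"
    using empty by (simp add: trivial_group_def)
  interpret gh: group_hom "HG p A A" "HG p C D" "HI p A A C D g" by (rule HI_group_hom)
  interpret ch: group_hom "HG p C D" integer_group \<kappa>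
    using chi by (simp add: group_hom_def group_hom_axioms_def)
  show ?case using e ch.hom_one by auto
next
  case (insert i I)
  define K' where "K' = \<Union>(K ` I)"
  have clK': "closedin (top_of_set A) K'"
    unfolding K'_def using insert.prems(1) insert.hyps(1) by (auto intro: closedin_Union)
  have KiA: "K i \<subseteq> A" using insert.prems(1)[of i] closedin_imp_subset by auto
  have K'A: "K' \<subseteq> A" using clK' closedin_imp_subset by auto
  have disj: "N i \<inter> K' = {}" "K i \<inter> K' = {}"
    unfolding K'_def using insert.prems(3,4) insert.hyps(2) by blast+
  have NiA: "N i \<subseteq> A" using insert.prems(2)[of i] openin_imp_subset by auto
  let ?O1 = "A - K i" and ?O2 = "A - K'"
  have O: "openin (top_of_set A) ?O1" "openin (top_of_set A) ?O2"
    using insert.prems(1) clK' by (auto simp: openin_diff)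
  have U: "?O1 \<union> ?O2 = A" using disj by auto
  have Ieq: "?O1 \<inter> ?O2 = A - \<Union>(K ` insert i I)" unfolding K'_def by auto
  obtain a b where ab: "a \<in> carrier (HG p ?O2 (?O1 \<inter> ?O2))" "b \<in> carrier (HG p ?O1 (?O1 \<inter> ?O2))"
    and e: "e = HI p ?O2 (?O1 \<inter> ?O2) A (?O1 \<inter> ?O2) id a \<otimes>\<^bsub>HG p A (?O1 \<inter> ?O2)\<^esub>
        HI p ?O1 (?O1 \<inter> ?O2) A (?O1 \<inter> ?O2) id b"
    and e1: "HI p ?O2 (?O1 \<inter> ?O2) A ?O1 id a = HI p A (?O1 \<inter> ?O2) A ?O1 id e"
    and e2: "HI p ?O1 (?O1 \<inter> ?O2) A ?O2 id b = HI p A (?O1 \<inter> ?O2) A ?O2 id e"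
    using relative_homology_split2[OF O U, of e p] insert.prems(5) unfolding Ieq[symmetric] by blast
  \<comment> \<open>\<open>N i\<close> is a neighbourhood of \<open>K i\<close> that misses
    \<open>K'\<close>, so everything outside it can be excised from \<open>A - K'\<close>.\<close>
  have exc: "HI p (N i) (N i \<inter> (?O1 \<inter> ?O2)) ?O2 (?O1 \<inter> ?O2) id \<in>
      iso (HG p (N i) (N i \<inter> (?O1 \<inter> ?O2))) (HG p ?O2 (?O1 \<inter> ?O2))"
  proof (rule excision_iso[where Z = "?O2 - N i"])
    show "openin (top_of_set ?O2) (?O1 \<inter> ?O2)"
      using O(1) by (metis Int_commute U Un_upper2 openin_subtopology_Int subtopology_subtopology inf.absorb2)
    show "closedin (top_of_set ?O2) (?O2 - N i)"
      using insert.prems(2)[of i] NiA disj(1)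
      by (metis Diff_subset Int_Diff_disjoint closedin_diff closedin_subtopology_refl insertI1 openin_subset_trans subset_UNIV topspace_euclidean Diff_eq_empty_iff Diff_triv Int_commute Diff_mono order_refl)
  qed (use NiA disj insert.prems(3)[of i] in auto)
  have Nieq: "N i \<inter> (?O1 \<inter> ?O2) = N i - K i"
    using NiA disj by auto
  obtain ai where ai: "ai \<in> carrier (HG p (N i) (N i - K i))"
      "HI p (N i) (N i - K i) ?O2 (?O1 \<inter> ?O2) id ai = a"
    using iso_obtain_preimage[OF exc ab(1)] unfolding Nieq by blast
  have IHp: "\<And>j. j \<in> I \<Longrightarrow> closedin (top_of_set ?O1) (K j)"
       "\<And>j. j \<in> I \<Longrightarrow> openin (top_of_set ?O1) (N j)"
  proof -
    fix j assume j: "j \<in> I"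
    have ij: "N j \<inter> K i = {}" "K j \<inter> K i = {}" using insert.prems(3,4) j insert.hyps(2) by blast+
    show "closedin (top_of_set ?O1) (K j)"
      using insert.prems(1)[of j] j ij closedin_subset_trans[of A "K j" ?O1]
      by (metis Diff_subset Diff_triv Diff_mono closedin_imp_subset insertCI order_refl)
    show "openin (top_of_set ?O1) (N j)"
      using insert.prems(2)[of j] j ij openin_subset_trans[of A "N j" ?O1]
      by (metis Diff_subset Diff_triv Diff_mono openin_imp_subset insertCI order_refl)
  qed
  have O12: "?O1 \<inter> ?O2 = ?O1 - \<Union>(K ` I)" unfolding K'_def by auto
  have "\<exists>a. (\<forall>j\<in>I. a j \<in> carrier (HG p (N j) (N j - K j)) \<and>
           HI p (N j) (N j - K j) ?O1 (?O1 - K j) id (a j) = HI p ?O1 (?O1 - \<Union>(K ` I)) ?O1 (?O1 - K j) id b) \<and>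
         \<kappa> (HI p ?O1 (?O1 - \<Union>(K ` I)) C D g b) = (\<Sum>i\<in>I. \<kappa> (HI p (N i) (N i - K i) C D g (a i)))"
  proof (rule insert.IH)
    show "b \<in> carrier (HG p ?O1 (?O1 - \<Union>(K ` I)))"
      using ab O12 by simp
    show "continuous_on ?O1 g" using insert.prems(6) continuous_on_subset by blast
    show "g ` (?O1 - \<Union> (K ` I)) \<subseteq> D" using insert.prems(8) by auto
  qed (use IHp insert.prems in auto)
  then obtain aa where aa: "\<And>j. j \<in> I \<Longrightarrow> aa j \<in> carrier (HG p (N j) (N j - K j))"
     "\<And>j. j \<in> I \<Longrightarrow> HI p (N j) (N j - K j) ?O1 (?O1 - K j) id (aa j) = HI p ?O1 (?O1 \<inter> ?O2) ?O1 (?O1 - K j) id b"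
     "\<kappa> (HI p ?O1 (?O1 \<inter> ?O2) C D g b) = (\<Sum>i\<in>I. \<kappa> (HI p (N i) (N i - K i) C D g (aa i)))"
    unfolding O12 by blast
  have g1: "g ` ?O1 \<subseteq> C" "g ` ?O2 \<subseteq> C" "g ` (?O1 \<inter> ?O2) \<subseteq> D" "continuous_on ?O2 g" "continuous_on ?O1 g"
    using insert.prems(6-8) Ieq by (auto intro: continuous_on_subset)
  interpret gh: group_hom "HG p A (?O1 \<inter> ?O2)" "HG p C D" "HI p A (?O1 \<inter> ?O2) C D g" by (rule HI_group_hom)
  interpret ch: group_hom "HG p C D" integer_group \<kappa>
    using chi by (simp add: group_hom_def group_hom_axioms_def)
  have sum: "\<kappa> (HI p A (?O1 \<inter> ?O2) C D g e) = \<kappa> (HI p (N i) (N i - K i) C D g ai) + (\<Sum>i\<in>I. \<kappa> (HI p (N i) (N i - K i) C D g (aa i)))"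
  proof -
    have "HI p A (?O1 \<inter> ?O2) C D g e = HI p ?O2 (?O1 \<inter> ?O2) C D g a \<otimes>\<^bsub>HG p C D\<^esub> HI p ?O1 (?O1 \<inter> ?O2) C D g b"
      unfolding e using insert.prems(6-7) g1
      by (simp add: hom_induced_carrier HI_incl_compose)
    moreover have "HI p ?O2 (?O1 \<inter> ?O2) C D g a = HI p (N i) (N i - K i) C D g ai"
      unfolding ai(2)[symmetric] using NiA disj g1 by (intro HI_incl_compose) auto
    ultimately show ?thesis
      using aa(3) by (simp add: hom_induced_carrier)
  qed
  have rel1: "HI p (N i) (N i - K i) A (A - K i) id ai = HI p A (?O1 \<inter> ?O2) A (A - K i) id e"
    unfolding e1[symmetric] ai(2)[symmetric]
    by (subst HI_incl_compose) (use NiA disj in auto)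
  have rel2: "HI p (N j) (N j - K j) A (A - K j) id (aa j) = HI p A (?O1 \<inter> ?O2) A (A - K j) id e" if j: "j \<in> I" for j
  proof -
    have NjO: "N j \<subseteq> ?O1" using IHp(2)[OF j] openin_imp_subset by auto
    have KjK: "K j \<subseteq> K'" unfolding K'_def using j by auto
    have "HI p (N j) (N j - K j) A (A - K j) id (aa j)
        = HI p ?O1 (?O1 - K j) A (A - K j) id (HI p (N j) (N j - K j) ?O1 (?O1 - K j) id (aa j))"
      by (subst HI_incl_compose) (use NjO in auto)
    also have "\<dots> = HI p ?O1 (?O1 - K j) A (A - K j) id (HI p ?O1 (?O1 \<inter> ?O2) ?O1 (?O1 - K j) id b)"
      using aa(2)[OF j] by simp
    also have "\<dots> = HI p ?O1 (?O1 \<inter> ?O2) A (A - K j) id b"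
      by (subst HI_incl_compose) (use KjK in auto)
    \<comment> \<open>\<open>b\<close> and \<open>e\<close> are known to agree only relative to the
      complement of \<open>K'\<close>; since \<open>K j \<subseteq> K'\<close>, this suffices at
      \<open>K j\<close>.\<close>
    also have "\<dots> = HI p A ?O2 A (A - K j) id (HI p ?O1 (?O1 \<inter> ?O2) A ?O2 id b)"
      by (subst HI_incl_compose) (use KjK in auto)
    also have "\<dots> = HI p A (?O1 \<inter> ?O2) A (A - K j) id e"
      unfolding e2 by (subst HI_incl_compose) (use KjK in auto)
    finally show ?thesis .
  qed
  let ?a = "aa(i := ai)"
  have [simp]: "?a i = ai" "\<And>j. j \<in> I \<Longrightarrow> ?a j = aa j"
    using insert.hyps(2) by auto
  have "(\<Sum>j\<in>I. \<kappa> (HI p (N j) (N j - K j) C D g (?a j))) = (\<Sum>j\<in>I. \<kappa> (HI p (N j) (N j - K j) C D g (aa j)))"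
    by (intro sum.cong) (simp_all del: fun_upd_apply)
  then have s: "\<kappa> (HI p A (?O1 \<inter> ?O2) C D g e) = (\<Sum>j\<in>insert i I. \<kappa> (HI p (N j) (N j - K j) C D g (?a j)))"
    unfolding sum sum.insert[OF insert.hyps] by (simp del: fun_upd_apply)
  have r: "?a j \<in> carrier (HG p (N j) (N j - K j)) \<and>
      HI p (N j) (N j - K j) A (A - K j) id (?a j) = HI p A (?O1 \<inter> ?O2) A (A - K j) id e"
    if "j \<in> insert i I" for j
  proof (cases "j = i")
    case True
    then show ?thesis using ai(1) rel1 by (simp del: fun_upd_apply)
  next
    case False
    then have "j \<in> I" using that by simp
    then show ?thesis using aa(1) rel2 by (simp del: fun_upd_apply)
  qed
  show ?case
    using r s unfolding Ieq by (intro exI[of _ ?a] conjI ballI) blast+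
qed


section \<open>The boundary of a cube as a sphere\<close>

lemma cube_eq_PiE: "cube n = PiE UNIV (\<lambda>i. if i < n then {0..1} else {0})"
proof (rule Set.set_eqI)
  fix x :: "nat \<Rightarrow> real"
  show "x \<in> cube n \<longleftrightarrow> x \<in> PiE UNIV (\<lambda>i. if i < n then {0..1} else {0})"
    unfolding cube_def PiE_UNIV_domain Pi_iff mem_Collect_eq
    by (metis UNIV_I atLeastAtMost_iff linorder_not_less singleton_iff)
qed

lemma compact_cube: "compact (cube n)"
proof -
  have "compactin (product_topology (\<lambda>i::nat. euclidean) UNIV) (PiE UNIV (\<lambda>i. if i < n then {0..1::real} else {0}))"
    by (subst compactin_PiE) auto
  then show ?thesis
    by (simp add: cube_eq_PiE euclidean_product_topology)
qed

lemma continuous_on_proj: "continuous_on A (\<lambda>x::'i \<Rightarrow> real. x i)"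
  by (rule continuous_on_product_then_coordinatewise) (rule continuous_on_id)

lemma closed_coord_eq: "closed {x::'i \<Rightarrow> real. x i = c}"
proof -
  have "{x::'i \<Rightarrow> real. x i = c} = (\<lambda>x. x i) -` {c} \<inter> UNIV" by auto
  then show ?thesis
    using continuous_closed_vimage[of "{c}"] continuous_on_proj[of UNIV i]
    by (metis closed_singleton continuous_on_closed_vimage closed_UNIV)
qed

lemma open_coord_less: "open {x::'i \<Rightarrow> real. x i < c}" "open {x::'i \<Rightarrow> real. c < x i}"
  by (intro open_Collect_less continuous_on_proj continuous_on_const)+

lemma closed_coord_le: "closed {x::'i \<Rightarrow> real. x i \<le> c}" "closed {x::'i \<Rightarrow> real. c \<le> x i}"
  by (intro closed_Collect_le continuous_on_proj continuous_on_const)+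

lemma cube_boundary_eq_Union: "cube_boundary n = (\<Union>i<n. \<Union>e\<in>{0,1}. cube n \<inter> {x. x i = e})"
  by (auto simp: cube_boundary_def)

lemma compact_cube_boundary: "compact (cube_boundary n)"
  unfolding cube_boundary_eq_Union
  by (intro compact_UN finite_lessThan) (auto intro!: compact_Int_closed compact_cube closed_coord_eq)

lemma cube_boundary_subset: "cube_boundary n \<subseteq> cube n"
  by (auto simp: cube_boundary_def)

lemma open_cube_eq: "open_cube n = cube n - cube_boundary n"
  by (auto simp: open_cube_def cube_boundary_def cube_def less_le)

lemma open_cube_subset: "open_cube n \<subseteq> cube n"
  by (auto simp: open_cube_eq)

lemma openin_open_cube: "openin (top_of_set (cube n)) (open_cube n)"
  unfolding open_cube_eq
  using compact_cube_boundary[of n] cube_boundary_subset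
  by (metis closed_subset compact_imp_closed openin_diff openin_subtopology_self)

lemma contractible_cube: "contractible_space (top_of_set (cube n))"
proof -
  have "homotopic_with (\<lambda>h. True) (top_of_set (cube n)) (top_of_set (cube n)) id (\<lambda>x i. 0)"
  proof (subst homotopic_with, simp, intro exI conjI ballI)
    let ?h = "\<lambda>(t::real, x::nat \<Rightarrow> real). (\<lambda>i. (1 - t) * x i)"
    show "continuous_map (prod_topology (top_of_set {0..1}) (top_of_set (cube n))) (top_of_set (cube n)) ?h"
    proof -
      have "continuous_on ({0..1} \<times> cube n) ?h"
        unfolding case_prod_unfold
        by (intro continuous_intros continuous_on_product_then_coordinatewise)
      moreover have "?h \<in> ({0..1} \<times> cube n) \<rightarrow> cube n"
        by (auto simp: cube_def mult_le_one)
      ultimately show ?thesis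
        by (simp add: continuous_map_in_subtopology)
    qed
  qed auto
  then show ?thesis
    unfolding contractible_space_def by blast
qed

text \<open>The sup-distance from the centre; the radial projection below is only meaningful where it
  does not vanish.\<close>

fun cube_radius :: "nat \<Rightarrow> (nat \<Rightarrow> real) \<Rightarrow> real" where
  "cube_radius 0 x = 0"
| "cube_radius (Suc n) x = max (cube_radius n x) \<bar>x n - 1/2\<bar>"

definition radial :: "nat \<Rightarrow> (nat \<Rightarrow> real) \<Rightarrow> nat \<Rightarrow> real" where
  "radial n x = (\<lambda>i. if i < n then 1/2 + (x i - 1/2) / (2 * cube_radius n x) else 0)"

lemma cube_radius_nonneg: "0 \<le> cube_radius n x"
  by (induction n) auto

lemma cube_radius_ge: "i < n \<Longrightarrow> \<bar>x i - 1/2\<bar> \<le> cube_radius n x"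
  by (induction n) (auto simp: less_Suc_eq)

lemma cube_radius_attained: "0 < n \<Longrightarrow> \<exists>i<n. cube_radius n x = \<bar>x i - 1/2\<bar>"
proof (induction n)
  case (Suc n)
  show ?case
  proof (cases "cube_radius n x \<le> \<bar>x n - 1/2\<bar>")
    case True then show ?thesis by (intro exI[of _ n]) auto
  next
    case False
    then have "n > 0" by (cases n) auto
    then show ?thesis using Suc.IH False by (auto simp: less_Suc_eq max_def)
  qed
qed simp

lemma cube_radius_unique:
  assumes "j < n" "\<bar>x j - 1/2\<bar> = r" "\<And>i. i < n \<Longrightarrow> \<bar>x i - 1/2\<bar> \<le> r"
  shows "cube_radius n x = r"
  using cube_radius_ge[of j n x] cube_radius_attained[of n x] assms by fastforce

lemma cube_radius_eq_0: "cube_radius n x = 0 \<Longrightarrow> i < n \<Longrightarrow> x i = 1/2"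
  using cube_radius_ge[of i n x] by simp

lemma cube_radius_cong: "(\<And>i. i < n \<Longrightarrow> \<bar>x i - 1/2\<bar> = \<bar>y i - 1/2\<bar>) \<Longrightarrow> cube_radius n x = cube_radius n y"
  by (induction n) auto

lemma cube_radius_scale:
  assumes "0 \<le> s" "\<And>i. i < n \<Longrightarrow> y i - 1/2 = s * (x i - 1/2)"
  shows "cube_radius n y = s * cube_radius n x"
  using assms(2)
proof (induction n)
  case (Suc n)
  have "\<bar>y n - 1/2\<bar> = s * \<bar>x n - 1/2\<bar>"
    using Suc.prems[of n] assms(1) by (simp add: abs_mult)
  then show ?case
    using Suc assms(1) by (simp add: max_mult_distrib_left)
qed simp

lemma continuous_on_cube_radius: 
  assumes "\<And>i. continuous_on A (\<lambda>x. f x i)"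
  shows "continuous_on A (\<lambda>x. cube_radius n (f x))"
proof (induction n)
  case (Suc n)
  then show ?case
    using assms[of n] by (auto intro!: continuous_intros)
qed auto

text \<open>The boundary is the sphere of radius \<open>1/2\<close> in the sup-norm around the
  centre. For \<open>n = 0\<close> it is empty although the radius is defined, hence the conjunct
  \<open>0 < n\<close>.\<close>

lemma cube_boundary_iff:
  "x \<in> cube_boundary n \<longleftrightarrow> 0 < n \<and> cube_radius n x = 1/2 \<and> (\<forall>i\<ge>n. x i = 0)"
proof
  assume x: "x \<in> cube_boundary n"
  then obtain j where j: "j < n" "x j = 0 \<or> x j = 1" and xc: "x \<in> cube n"
    by (auto simp: cube_boundary_def)
  have "cube_radius n x = 1/2"
  proof (rule cube_radius_unique[OF j(1)])
    fix i assume "i < n"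
    then have "0 \<le> x i" "x i \<le> 1" using xc by (auto simp: cube_def)
    then show "\<bar>x i - 1/2\<bar> \<le> 1/2" by linarith
  qed (use j in auto)
  then show "0 < n \<and> cube_radius n x = 1/2 \<and> (\<forall>i\<ge>n. x i = 0)"
    using j xc by (auto simp: cube_def)
next
  assume r: "0 < n \<and> cube_radius n x = 1/2 \<and> (\<forall>i\<ge>n. x i = 0)"
  have *: "\<bar>x i - 1/2\<bar> \<le> 1/2" if "i < n" for i
    using cube_radius_ge[OF that, of x] r by simp
  obtain j where "j < n" "\<bar>x j - 1/2\<bar> = 1/2"
    using cube_radius_attained[of n x] r by auto
  then show "x \<in> cube_boundary n"
    using r * by (force simp: cube_boundary_def cube_def abs_le_iff abs_if field_simps split: if_splits)
qed

lemma radial_in_boundary: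
  assumes "0 < cube_radius n x"
  shows "radial n x \<in> cube_boundary n"
proof -
  have n: "0 < n" using assms by (cases n) auto
  have "cube_radius n (radial n x) = 1 / (2 * cube_radius n x) * cube_radius n x"
    by (rule cube_radius_scale) (use assms in \<open>auto simp: radial_def\<close>)
  then show ?thesis
    using n assms by (simp add: cube_boundary_iff radial_def)
qed

lemma radial_id: "x \<in> cube_boundary n \<Longrightarrow> radial n x = x"
  by (intro ext) (auto simp: cube_boundary_iff radial_def field_simps)

lemma radial_scale:
  assumes "0 < s" "\<And>i. i < n \<Longrightarrow> y i - 1/2 = s * (x i - 1/2)"
  shows "radial n y = radial n x"
  using cube_radius_scale[of s n y x] assms by (auto simp: radial_def)

lemma continuous_on_radial:
  assumes "\<And>i. continuous_on A (\<lambda>x. f x i)" "\<And>x. x \<in> A \<Longrightarrow> 0 < cube_radius n (f x)"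
  shows "continuous_on A (\<lambda>x. radial n (f x))"
proof (rule continuous_on_coordinatewise_then_product)
  fix i
  show "continuous_on A (\<lambda>x. radial n (f x) i)"
  proof (cases "i < n")
    case True
    have "continuous_on A (\<lambda>x. 1/2 + (f x i - 1/2) / (2 * cube_radius n (f x)))"
      using assms(2) by (intro continuous_intros assms(1) continuous_on_cube_radius) force
    then show ?thesis by (simp add: radial_def True)
  qed (simp add: radial_def)
qed

text \<open>After moving the centre to the origin, both sides are unit spheres up to scale, for the
  sup-norm and for the Euclidean norm. Normalizing in one norm undoes normalizing in the other
  because both keep the ray through the point.\<close>

lemma homeomorphic_cube_boundary_nsphere:
  "top_of_set (cube_boundary (Suc n)) homeomorphic_space nsphere n"
proof -
  let ?d = "Suc n"
  define l2 where "l2 x = sqrt (\<Sum>i\<le>n. (x i - 1/2)\<^sup>2)" for x :: "nat \<Rightarrow> real"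
  define f where "f x = (\<lambda>i. if i < ?d then (x i - 1/2) / l2 x else 0)" for x :: "nat \<Rightarrow> real"
  define g where "g w = radial ?d (\<lambda>i. w i + 1/2)" for w :: "nat \<Rightarrow> real"
  define Sp where "Sp = {x::nat \<Rightarrow> real. (\<Sum>i\<le>n. (x i)\<^sup>2) = 1 \<and> (\<forall>i>n. x i = 0)}"
  have ns: "nsphere n = top_of_set Sp"
    by (simp add: nsphere Sp_def euclidean_product_topology)
  have l2pos: "l2 x > 0" if x: "x \<in> cube_boundary ?d" for x
  proof -
    obtain j where j: "j < ?d" "x j = 0 \<or> x j = 1" using x unfolding cube_boundary_def by blast
    then have "0 < (x j - 1/2)\<^sup>2" "j \<in> {..n}" by auto
    then have "0 < (\<Sum>i\<le>n. (x i - 1/2)\<^sup>2)"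
      by (intro sum_pos2[of _ j]) auto
    then show ?thesis by (simp add: l2_def)
  qed
  have rpos: "0 < cube_radius ?d (\<lambda>i. w i + 1/2)" if "w \<in> Sp" for w
  proof (rule ccontr)
    assume "\<not> ?thesis"
    then have "cube_radius ?d (\<lambda>i. w i + 1/2) = 0" using cube_radius_nonneg[of ?d] by (smt (verit))
    then have "w i = 0" if "i \<le> n" for i using cube_radius_eq_0[of ?d "\<lambda>i. w i + 1/2" i] that by simp
    then have "(\<Sum>i\<le>n. (w i)\<^sup>2) = 0" by simp
    then show False using \<open>w \<in> Sp\<close> by (simp add: Sp_def)
  qed
  have fim: "f x \<in> Sp" if "x \<in> cube_boundary ?d" for x
  proof -
    have "(\<Sum>i\<le>n. (f x i)\<^sup>2) = (\<Sum>i\<le>n. (x i - 1/2)\<^sup>2) / (l2 x)\<^sup>2"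
      by (simp add: f_def power_divide sum_divide_distrib)
    also have "(l2 x)\<^sup>2 = (\<Sum>i\<le>n. (x i - 1/2)\<^sup>2)"
      unfolding l2_def by (intro real_sqrt_pow2 sum_nonneg) auto
    finally have "(\<Sum>i\<le>n. (f x i)\<^sup>2) = 1"
      using l2pos[OF that] unfolding l2_def by simp
    then show ?thesis by (simp add: Sp_def f_def)
  qed
  have gim: "g w \<in> cube_boundary ?d" if "w \<in> Sp" for w
    unfolding g_def by (rule radial_in_boundary[OF rpos[OF that]])
  have gf: "g (f x) = x" if x: "x \<in> cube_boundary ?d" for x
  proof -
    have "radial ?d (\<lambda>i. f x i + 1/2) = radial ?d x"
      by (rule radial_scale[of "1 / l2 x"]) (use l2pos[OF x] in \<open>auto simp: f_def\<close>)
    then show ?thesis by (simp add: g_def radial_id[OF x])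
  qed
  have fg: "f (g w) = w" if w: "w \<in> Sp" for w
  proof -
    define s where "s = 1 / (2 * cube_radius ?d (\<lambda>i. w i + 1/2))"
    have s: "s > 0" using rpos[OF w] by (simp add: s_def)
    have gw: "g w i - 1/2 = s * w i" if "i \<le> n" for i
      using that by (simp add: g_def radial_def s_def)
    have "l2 (g w) = sqrt (\<Sum>i\<le>n. s\<^sup>2 * (w i)\<^sup>2)"
      unfolding l2_def by (intro arg_cong[where f = sqrt] sum.cong) (auto simp: gw power_mult_distrib)
    also have "\<dots> = s"
      using w s by (simp add: sum_distrib_left[symmetric] Sp_def)
    finally have l: "l2 (g w) = s" .
    show ?thesis
    proof
      fix i show "f (g w) i = w i"
        using w s gw[of i] by (cases "i \<le> n") (auto simp: f_def l Sp_def)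
    qed
  qed
  have cf: "continuous_on (cube_boundary ?d) f"
  proof (rule continuous_on_coordinatewise_then_product)
    fix i
    have c: "continuous_on (cube_boundary ?d) l2"
      unfolding l2_def by (intro continuous_intros continuous_on_proj)
    have "continuous_on (cube_boundary ?d) (\<lambda>x. (x i - 1/2) / l2 x)"
      by (intro continuous_intros continuous_on_proj c) (use l2pos in force)
    then show "continuous_on (cube_boundary ?d) (\<lambda>x. f x i)"
      by (cases "i < ?d") (simp_all add: f_def)
  qed
  have cg: "continuous_on Sp g"
    unfolding g_def using rpos by (intro continuous_on_radial continuous_intros continuous_on_proj)
  have "homeomorphic_maps (top_of_set (cube_boundary ?d)) (nsphere n) f g"
    unfolding ns homeomorphic_maps_def continuous_map_in_subtopology
    using cf cg fim gim gf fg by auto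
  then show ?thesis
    unfolding homeomorphic_space_def by blast
qed

text \<open>Reduced homology also covers \<open>n = 0\<close>, where the boundary consists of two
  points and the unreduced group in degree 0 is not cyclic.\<close>

lemma reduced_homology_cube_boundary:
  "reduced_homology_group (int n) (top_of_set (cube_boundary (Suc n))) \<cong> integer_group"
  using homeomorphic_space_imp_isomorphic_reduced_homology_groups[OF homeomorphic_cube_boundary_nsphere[of n], of "int n"]
    reduced_homology_group_nsphere(1)[of n] iso_trans by blast

text \<open>The cone from the centre over \<open>K\<close> is closed under adding nonnegative multiples of \<open>y\<close>, so pushing
  the boundary of the cube away from \<open>y\<close> towards the antipode of \<open>y\<close> never enters \<open>K\<close>.\<close>

definition conic_at :: "nat \<Rightarrow> (nat \<Rightarrow> real) set \<Rightarrow> (nat \<Rightarrow> real) \<Rightarrow> bool" where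
  "conic_at d K y \<longleftrightarrow> K \<subseteq> cube_boundary d \<and> y \<in> K \<and>
     (\<forall>x\<in>cube_boundary d. \<forall>k\<in>K. \<forall>a b. 0 \<le> a \<longrightarrow> 0 \<le> b \<longrightarrow>
        (\<forall>i<d. x i - 1/2 = a * (k i - 1/2) + b * (y i - 1/2)) \<longrightarrow> x \<in> K) \<and>
     (\<lambda>i. if i < d then 1 - y i else 0) \<notin> K"

lemma contractible_boundary_minus_conic:
  assumes "conic_at d K y"
  shows "contractible_space (top_of_set (cube_boundary d - K))"
    and "cube_boundary d - K \<noteq> {}"
proof -
  have KS: "K \<subseteq> cube_boundary d" and yK: "y \<in> K"
    and cone: "\<And>x k a b. x \<in> cube_boundary d \<Longrightarrow> k \<in> K \<Longrightarrow> 0 \<le> a \<Longrightarrow> 0 \<le> b \<Longrightarrow>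
        (\<And>i. i < d \<Longrightarrow> x i - 1/2 = a * (k i - 1/2) + b * (y i - 1/2)) \<Longrightarrow> x \<in> K"
    and anti: "(\<lambda>i. if i < d then 1 - y i else 0) \<notin> K"
    using assms unfolding conic_at_def by blast+
  define z where "z = (\<lambda>i. if i < d then 1 - y i else 0)"
  have yS: "y \<in> cube_boundary d" using KS yK by auto
  have zS: "z \<in> cube_boundary d"
  proof -
    have "cube_radius d z = cube_radius d y"
      by (rule cube_radius_cong) (auto simp: z_def)
    then show ?thesis using yS by (auto simp: cube_boundary_iff z_def)
  qed
  then show ne: "cube_boundary d - K \<noteq> {}" using anti z_def by auto
  define h where "h t x = (\<lambda>i. (1 - t) * x i + t * z i)" for t :: real and x :: "nat \<Rightarrow> real"
  have hc: "h t x i - 1/2 = (1 - t) * (x i - 1/2) - t * (y i - 1/2)" if "i < d" for t x i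
    using that by (simp add: h_def z_def field_simps)
  \<comment> \<open>If the segment from \<open>x\<close> to the antipode of \<open>y\<close> met the
    centre at a time \<open>t < 1\<close>, then \<open>x\<close> would lie on the ray of
    \<open>y\<close>, hence in the cone and in \<open>K\<close>. At \<open>t = 1\<close> it would
    make \<open>y\<close> itself the centre.\<close>
  have rpos: "0 < cube_radius d (h t x)" if t: "0 \<le> t" "t \<le> 1" and x: "x \<in> cube_boundary d - K" for t x
  proof (rule ccontr)
    assume "\<not> ?thesis"
    then have "cube_radius d (h t x) = 0" using cube_radius_nonneg[of d "h t x"] by linarith
    then have z: "(1 - t) * (x i - 1/2) = t * (y i - 1/2)" if "i < d" for i
      using cube_radius_eq_0[of d "h t x" i] hc[OF that, of t x] that by simp
    show False
    proof (cases "t = 1")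
      case True
      then have "y i = 1/2" if "i < d" for i using z[OF that] by simp
      then show False using yS by (force simp: cube_boundary_def)
    next
      case False
      have "x \<in> K"
      proof (rule cone[of x y 0 "t / (1 - t)"])
        fix i assume "i < d"
        from z[OF this] False show "x i - 1/2 = 0 * (y i - 1/2) + t / (1 - t) * (y i - 1/2)"
          by (simp add: field_simps)
      qed (use x yK t False in auto)
      then show False using x by auto
    qed
  qed
  have im: "radial d (h t x) \<in> cube_boundary d - K" if t: "0 \<le> t" "t \<le> 1" and x: "x \<in> cube_boundary d - K" for t x
  proof -
    define s where "s = 2 * cube_radius d (h t x)"
    have s: "s > 0" using rpos[OF t x] by (simp add: s_def)
    have r: "h t x i - 1/2 = s * (radial d (h t x) i - 1/2)" if "i < d" for i
      using s that by (simp add: radial_def s_def)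
    have "radial d (h t x) \<notin> K"
    proof
      assume k: "radial d (h t x) \<in> K"
      show False
      proof (cases "t = 1")
        case True
        have "z \<in> K"
        proof (rule cone[OF zS k, of s 0])
          fix i assume "i < d"
          then show "z i - 1/2 = s * (radial d (h t x) i - 1/2) + 0 * (y i - 1/2)"
            using r[of i] True by (simp add: h_def)
        qed (use s in auto)
        then show False using anti z_def by simp
      next
        case False
        then have t1: "1 - t > 0" using t by simp
        have "x \<in> K"
        \<comment> \<open>Solving the homotopy for \<open>x\<close> gives a nonnegative combination
          of the point of \<open>K\<close> that was reached and of \<open>y\<close>, so
          \<open>x\<close> would have been in \<open>K\<close> from the start.\<close>
        proof (rule cone[OF _ k, of x "s / (1 - t)" "t / (1 - t)"])
          fix i assume i: "i < d"
          have "(1 - t) * (x i - 1/2) = s * (radial d (h t x) i - 1/2) + t * (y i - 1/2)"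
            using r[OF i] hc[OF i, of t x] by simp
          then have "x i - 1/2 = (s * (radial d (h t x) i - 1/2) + t * (y i - 1/2)) / (1 - t)"
            using t1 by (metis nonzero_mult_div_cancel_left less_irrefl)
          then show "x i - 1/2 = s / (1 - t) * (radial d (h t x) i - 1/2) + t / (1 - t) * (y i - 1/2)"
            by (simp only: add_divide_distrib times_divide_eq_left)
        qed (use x s t t1 in auto)
        then show False using x by auto
      qed
    qed
    then show ?thesis using radial_in_boundary[OF rpos[OF t x]] by auto
  qed
  let ?A = "cube_boundary d - K"
  have "homotopic_with (\<lambda>h. True) (top_of_set ?A) (top_of_set ?A) id (\<lambda>x. z)"
  proof (subst homotopic_with, simp, intro exI conjI ballI)
    let ?h = "\<lambda>(t::real, x::nat \<Rightarrow> real). radial d (h t x)"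
    show "continuous_map (prod_topology (top_of_set {0..1}) (top_of_set ?A)) (top_of_set ?A) ?h"
    proof -
      have "continuous_on ({0..1} \<times> ?A) ?h"
        unfolding case_prod_unfold h_def
      proof (rule continuous_on_radial)
        fix i show "continuous_on ({0..1} \<times> ?A) (\<lambda>x. (1 - fst x) * snd x i + fst x * z i)"
          by (intro continuous_intros continuous_on_product_then_coordinatewise)
      next
        fix p :: "real \<times> (nat \<Rightarrow> real)" assume "p \<in> {0..1} \<times> ?A"
        then show "0 < cube_radius d (\<lambda>i. (1 - fst p) * snd p i + fst p * z i)"
          using rpos[of "fst p" "snd p"] unfolding h_def by auto
      qed
      moreover have "?h \<in> ({0..1} \<times> ?A) \<rightarrow> ?A"
        using im by auto
      ultimately show ?thesis
        by (simp add: continuous_map_in_subtopology)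
    qed
    show "(case (0, x) of (t, x) \<Rightarrow> radial d (h t x)) = id x" if "x \<in> topspace (top_of_set ?A)" for x
      using that by (simp add: h_def radial_id)
    show "(case (1, x) of (t, x) \<Rightarrow> radial d (h t x)) = z" if "x \<in> topspace (top_of_set ?A)" for x
      using zS by (simp add: h_def radial_id)
  qed auto
  then show "contractible_space (top_of_set ?A)"
    unfolding contractible_space_def by blast
qed

text \<open>The cone over a point is a ray, and a ray meets the sphere only once because the radius
  is homogeneous. With this instance points and cores of facets share one contractibility
  argument.\<close>

lemma conic_at_point:
  assumes "y \<in> cube_boundary d"
  shows "conic_at d {y} y"
proof -
  have d: "0 < d" and ry: "cube_radius d y = 1/2" and y0: "\<And>i. i \<ge> d \<Longrightarrow> y i = 0"
    using assms by (auto simp: cube_boundary_iff)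
  have "x = y" if x: "x \<in> cube_boundary d" and ab: "0 \<le> a" "0 \<le> b"
    and e: "\<And>i. i < d \<Longrightarrow> x i - 1/2 = a * (y i - 1/2) + b * (y i - 1/2)" for x a b
  proof -
    have "cube_radius d x = (a + b) * cube_radius d y"
      by (rule cube_radius_scale) (use ab e in \<open>auto simp: distrib_right\<close>)
    then have "a + b = 1" using x ry by (simp add: cube_boundary_iff)
    then have "x i = y i" if "i < d" for i
      using e[OF that] by (metis add_diff_cancel_right' diff_add_cancel distrib_right mult_1)
    moreover have "x i = y i" if "i \<ge> d" for i using x y0 that by (simp add: cube_boundary_iff)
    ultimately show ?thesis by (metis ext not_le)
  qed
  moreover have "(\<lambda>i. if i < d then 1 - y i else 0) \<noteq> y"
  proof
    assume e: "(\<lambda>i. if i < d then 1 - y i else 0) = y"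
    obtain j where "j < d" "y j = 0 \<or> y j = 1" using assms by (auto simp: cube_boundary_def)
    then show False using fun_cong[OF e, of j] by auto
  qed
  ultimately show ?thesis
    using assms by (auto simp: conic_at_def)
qed

section \<open>Compact cores of facets\<close>

definition mid_facet :: "nat \<Rightarrow> real \<Rightarrow> nat \<Rightarrow> real \<Rightarrow> (nat \<Rightarrow> real) set" where
  "mid_facet d \<epsilon> j e = {x. x j = e \<and> (\<forall>i<d. i \<noteq> j \<longrightarrow> \<epsilon> \<le> x i \<and> x i \<le> 1 - \<epsilon>) \<and> (\<forall>i\<ge>d. x i = 0)}"

lemma mid_facet_subset_boundary:
  assumes j: "j < d" and e: "e = 0 \<or> e = 1" and eps: "0 < \<epsilon>" "\<epsilon> \<le> 1/2"
  shows "mid_facet d \<epsilon> j e \<subseteq> cube_boundary d"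
proof
  fix x assume x: "x \<in> mid_facet d \<epsilon> j e"
  have "0 \<le> x i \<and> x i \<le> 1" if "i < d" for i
    using x e eps that unfolding mid_facet_def by (cases "i = j") force+
  then show "x \<in> cube_boundary d"
    using x j e unfolding mid_facet_def cube_boundary_def cube_def by blast
qed

text \<open>The apex is the centre of the facet. In a combination lying on the sphere, the margin
  keeps all coordinates other than \<open>j\<close> strictly inside the cube, so coordinate
  \<open>j\<close> attains the norm. This forces \<open>a + b = 1\<close>, hence
  \<open>x j = e\<close>; and \<open>a \<le> 1\<close> preserves the margin.\<close>

lemma conic_at_mid_facet:
  assumes j: "j < d" and e: "e = 0 \<or> e = 1" and eps: "0 < \<epsilon>" "\<epsilon> \<le> 1/2"
  shows "conic_at d (mid_facet d \<epsilon> j e) (\<lambda>i. if i = j then e else if i < d then 1/2 else 0)"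
proof -
  let ?y = "\<lambda>i. if i = j then e else if i < d then 1/2 else 0"
  have sub: "mid_facet d \<epsilon> j e \<subseteq> cube_boundary d"
    using assms by (rule mid_facet_subset_boundary)
  have yin: "?y \<in> mid_facet d \<epsilon> j e"
    using j eps by (auto simp: mid_facet_def)
  have cone: "x \<in> mid_facet d \<epsilon> j e"
    if x: "x \<in> cube_boundary d" and k: "k \<in> mid_facet d \<epsilon> j e" and ab: "0 \<le> a" "0 \<le> b"
      and eq: "\<forall>i<d. x i - 1/2 = a * (k i - 1/2) + b * (?y i - 1/2)" for x k a b
  proof -
    have kj: "k j = e" and ki: "\<And>i. i < d \<Longrightarrow> i \<noteq> j \<Longrightarrow> \<bar>k i - 1/2\<bar> \<le> 1/2 - \<epsilon>"
      using k by (auto simp: mid_facet_def abs_le_iff)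
    have xj: "x j - 1/2 = (a + b) * (e - 1/2)"
      using eq j kj by (auto simp: distrib_right)
    have e2: "\<bar>e - 1/2\<bar> = 1/2" using e by auto
    have rx: "cube_radius d x = 1/2" using x by (simp add: cube_boundary_iff)
    have le1: "a + b \<le> 1"
      using cube_radius_ge[OF j, of x] rx xj e2 ab by (simp add: abs_mult)
    have xi: "\<bar>x i - 1/2\<bar> \<le> a * (1/2 - \<epsilon>)" if "i < d" "i \<noteq> j" for i
    proof -
      have "x i - 1/2 = a * (k i - 1/2)" using eq that by auto
      then have "\<bar>x i - 1/2\<bar> = a * \<bar>k i - 1/2\<bar>" using ab by (simp add: abs_mult)
      then show ?thesis using ki[OF that] ab by (simp add: mult_left_mono)
    qed
    have a1: "a \<le> 1" using le1 ab by simp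
    have small: "a * (1/2 - \<epsilon>) \<le> 1/2 - \<epsilon>" using a1 eps by (intro mult_left_le_one_le) (use ab in auto)
    obtain m where m: "m < d" "\<bar>x m - 1/2\<bar> = 1/2"
      using cube_radius_attained[of d x] j rx by auto
    have "m = j" using xi[of m] m small eps by fastforce
    then have "(a + b) * \<bar>e - 1/2\<bar> = 1/2" using m xj ab by (simp add: abs_mult)
    then have ab1: "a + b = 1" using e2 by simp
    show ?thesis
      unfolding mid_facet_def
    proof (safe)
      show "x j = e" using xj ab1 by simp
    next
      fix i assume "i < d" "i \<noteq> j"
      then have "\<bar>x i - 1/2\<bar> \<le> 1/2 - \<epsilon>" using xi[of i] small by linarith
      then show "\<epsilon> \<le> x i" "x i \<le> 1 - \<epsilon>" by (auto simp: abs_le_iff)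
    next
      fix i assume "i \<ge> d" then show "x i = 0" using x by (simp add: cube_boundary_iff)
    qed
  qed
  have anti: "(\<lambda>i. if i < d then 1 - ?y i else 0) \<notin> mid_facet d \<epsilon> j e"
    using j e by (auto simp: mid_facet_def)
  show ?thesis
    unfolding conic_at_def
    by (intro conjI ballI allI impI sub yin anti) (rule cone)
qed


section \<open>Local degrees modulo 2\<close>

definition cyclic_generator :: "('g, 'm) monoid_scheme \<Rightarrow> 'g \<Rightarrow> bool" where
  "cyclic_generator G a \<longleftrightarrow> a \<in> carrier G \<and> (\<forall>b\<in>carrier G. \<exists>m::int. b = a [^]\<^bsub>G\<^esub> m)"

lemma iso_image: "h \<in> iso G H \<Longrightarrow> h ` carrier G = carrier H"
  by (simp add: iso_def bij_betw_def)

lemma cyclic_generator_iso: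
  assumes "h \<in> iso G H" "group G" "group H" "cyclic_generator G a"
  shows "cyclic_generator H (h a)"
proof -
  interpret gh: group_hom G H h
    using assms by (simp add: group_hom_def group_hom_axioms_def iso_def)
  have "\<exists>m::int. b = h a [^]\<^bsub>H\<^esub> m" if b: "b \<in> carrier H" for b
  proof -
    obtain c where c: "c \<in> carrier G" "h c = b" using iso_obtain_preimage[OF assms(1) b] .
    then obtain m :: int where "c = a [^]\<^bsub>G\<^esub> m" using assms(4) by (auto simp: cyclic_generator_def)
    then show ?thesis
      using c assms(4) by (metis cyclic_generator_def gh.hom_int_pow)
  qed
  then show ?thesis using assms(4) by (simp add: cyclic_generator_def)
qed

lemma cyclic_generator_iso_rev:
  assumes h: "h \<in> iso G H" and "group G" "group H" and a: "a \<in> carrier G" and gen: "cyclic_generator H (h a)"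
  shows "cyclic_generator G a"
proof -
  interpret gh: group_hom G H h
    using assms by (simp add: group_hom_def group_hom_axioms_def iso_def)
  have "\<exists>m::int. b = a [^]\<^bsub>G\<^esub> m" if b: "b \<in> carrier G" for b
  proof -
    obtain m :: int where "h b = h a [^]\<^bsub>H\<^esub> m" using gen gh.hom_closed[OF b] unfolding cyclic_generator_def by blast
    then have "h b = h (a [^]\<^bsub>G\<^esub> m)" using a by (simp add: gh.hom_int_pow)
    moreover have "inj_on h (carrier G)" using h by (simp add: iso_def bij_betw_def)
    ultimately have "b = a [^]\<^bsub>G\<^esub> m" using a b by (meson gh.G.int_pow_closed inj_on_def)
    then show ?thesis ..
  qed
  then show ?thesis using a by (simp add: cyclic_generator_def)
qed

lemma int_pow_integer_group: "a [^]\<^bsub>integer_group\<^esub> (m::int) = m * a"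
proof -
  interpret group integer_group by simp
  have "a [^]\<^bsub>integer_group\<^esub> k = int k * a" for k :: nat
    by (induction k) (auto simp: nat_pow_Suc algebra_simps)
  then show ?thesis by (simp add: int_pow_def2)
qed

text \<open>Every value of \<open>h\<close> is an integer multiple of \<open>h a\<close>. The
  left-hand side mentions no generator, so the parity does not depend on which one is taken.\<close>

lemma odd_hom_cyclic_generator:
  assumes "h \<in> hom G integer_group" "group G" "cyclic_generator G a"
  shows "(\<exists>b\<in>carrier G. odd (h b)) \<longleftrightarrow> odd (h a)"
proof -
  interpret gh: group_hom G integer_group h
    using assms by (simp add: group_hom_def group_hom_axioms_def)
  have "\<exists>m. h b = m * h a" if "b \<in> carrier G" for b
    using assms(3) that unfolding cyclic_generator_def
    by (metis gh.hom_int_pow int_pow_integer_group)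
  then show ?thesis
    using assms(3) unfolding cyclic_generator_def by (metis even_mult_iff)
qed

lemma odd_iso_cyclic_generator:
  assumes "h \<in> iso G integer_group" "group G" "cyclic_generator G a"
  shows "odd (h a)"
proof -
  obtain b where "b \<in> carrier G" "h b = 1"
    using iso_obtain_preimage[OF assms(1), of 1] by (auto simp: integer_group_def)
  then have "\<exists>b\<in>carrier G. odd (h b)" by (intro bexI[of _ b]) auto
  then show ?thesis
    using odd_hom_cyclic_generator[OF iso_imp_homomorphism[OF assms(1)] assms(2,3)] by blast
qed

text \<open>\<open>w\<close> generates the reduced homology of the sphere. As the complement of a
  conic set is contractible and nonempty, passing to the relative group is an isomorphism. The point
  is the order of the quantifiers: a single \<open>w\<close> works for all cores and all points,
  which ties the local classes together.\<close>

lemma fundamental_class_exists: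
  "\<exists>w\<in>carrier (reduced_homology_group (int n) (top_of_set (cube_boundary (Suc n)))).
     \<forall>K y. conic_at (Suc n) K y \<longrightarrow>
       cyclic_generator (HG (int n) (cube_boundary (Suc n)) (cube_boundary (Suc n) - K))
         (HI (int n) (cube_boundary (Suc n)) {} (cube_boundary (Suc n)) (cube_boundary (Suc n) - K) id w)"
proof -
  let ?S = "cube_boundary (Suc n)"
  let ?R = "reduced_homology_group (int n) (top_of_set ?S)"
  obtain h where h: "h \<in> iso ?R integer_group"
    using reduced_homology_cube_boundary[of n] by (auto simp: is_iso_def)
  obtain w where w: "w \<in> carrier ?R" "h w = 1"
    using iso_obtain_preimage[OF h, of 1] by (auto simp: integer_group_def)
  have g1: "cyclic_generator integer_group (1::int)"
    by (auto simp: cyclic_generator_def int_pow_integer_group)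
  have gw: "cyclic_generator ?R w"
    by (rule cyclic_generator_iso_rev[OF h]) (use w g1 in auto)
  show ?thesis
  proof (intro bexI[OF _ w(1)] allI impI)
    fix K y assume K: "conic_at (Suc n) K y"
    have "HI (int n) ?S {} ?S (?S - K) id \<in> iso ?R (HG (int n) ?S (?S - K))"
    proof (rule iso_reduced_homology_by_contractible)
      show "contractible_space (subtopology (top_of_set ?S) (?S - K))"
        using contractible_boundary_minus_conic(1)[OF K] by (simp add: subtopology_subtopology Int_absorb1)
      show "topspace (top_of_set ?S) \<inter> (?S - K) \<noteq> {}"
        using contractible_boundary_minus_conic(2)[OF K] by auto
    qed
    then show "cyclic_generator (HG (int n) ?S (?S - K)) (HI (int n) ?S {} ?S (?S - K) id w)"
      by (rule cyclic_generator_iso) (use gw in auto)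
  qed
qed

text \<open>The choice amounts to a local orientation at \<open>y\<close>. The other choice only
  changes signs.\<close>

definition local_iso :: "nat \<Rightarrow> (nat \<Rightarrow> real) \<Rightarrow> (nat \<Rightarrow> real) chain set \<Rightarrow> int" where
  "local_iso n y = (SOME h. h \<in> iso (HG (int n) (cube_boundary (Suc n)) (cube_boundary (Suc n) - {y})) integer_group)"

lemma local_iso:
  assumes "y \<in> cube_boundary (Suc n)"
  shows "local_iso n y \<in> iso (HG (int n) (cube_boundary (Suc n)) (cube_boundary (Suc n) - {y})) integer_group"
proof -
  let ?S = "cube_boundary (Suc n)"
  note K = conic_at_point[OF assms]
  have "reduced_homology_group (int n) (top_of_set ?S) \<cong> HG (int n) ?S (?S - {y})"
  proof (rule isomorphic_reduced_homology_by_contractible)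
    show "contractible_space (subtopology (top_of_set ?S) (?S - {y}))"
      using contractible_boundary_minus_conic(1)[OF K] by (simp add: subtopology_subtopology Int_absorb1)
    show "topspace (top_of_set ?S) \<inter> (?S - {y}) \<noteq> {}"
      using contractible_boundary_minus_conic(2)[OF K] by auto
  qed
  then have "HG (int n) ?S (?S - {y}) \<cong> integer_group"
    using reduced_homology_cube_boundary[of n] by (meson group.iso_sym group_reduced_homology_group iso_trans)
  then show ?thesis
    unfolding local_iso_def is_iso_def by (metis (no_types, lifting) ex_in_conv someI_ex)
qed

definition mid_cube :: "nat \<Rightarrow> real \<Rightarrow> (nat \<Rightarrow> real) set" where
  "mid_cube n \<epsilon> = {x. (\<forall>i<n. \<epsilon> \<le> x i \<and> x i \<le> 1 - \<epsilon>) \<and> (\<forall>i\<ge>n. x i = 0)}"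

lemma all_ge_Suc: "(\<forall>i\<ge>n. P i) \<longleftrightarrow> P n \<and> (\<forall>i\<ge>Suc n. P i)"
  by (metis Suc_leD le_antisym not_less_eq_eq)

text \<open>Since sequences vanish beyond the dimension, the \<open>n\<close>-cube is literally the
  facet \<open>x n = 0\<close> of the next cube. Thus the local groups of a single cell come from
  the facts on facets.\<close>

lemma mid_cube_eq_mid_facet: "mid_cube n \<epsilon> = mid_facet (Suc n) \<epsilon> n 0"
  unfolding mid_cube_def mid_facet_def all_ge_Suc[of n] by (auto simp: less_Suc_eq)

text \<open>The source group below is infinite cyclic, so this says that a generator is sent to an odd
  number; phrased with an existential quantifier, it needs no choice of orientation.\<close>

definition odd_degree :: "nat \<Rightarrow> real \<Rightarrow> (nat \<Rightarrow> real) \<Rightarrow> ((nat \<Rightarrow> real) \<Rightarrow> nat \<Rightarrow> real) \<Rightarrow> bool" where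
  "odd_degree n \<epsilon> y g \<longleftrightarrow>
     (\<exists>a\<in>carrier (HG (int n) (cube n) (cube n - mid_cube n \<epsilon>)).
        odd (local_iso n y (HI (int n) (cube n) (cube n - mid_cube n \<epsilon>)
          (cube_boundary (Suc n)) (cube_boundary (Suc n) - {y}) g a)))"

section \<open>Excision of facets from the boundary sphere\<close>

definition cube_facet :: "nat \<Rightarrow> nat \<Rightarrow> real \<Rightarrow> (nat \<Rightarrow> real) set" where
  "cube_facet d j e = {x \<in> cube d. x j = e}"

definition open_facet :: "nat \<Rightarrow> nat \<Rightarrow> real \<Rightarrow> (nat \<Rightarrow> real) set" where
  "open_facet d j e = {x \<in> cube_facet d j e. \<forall>i<d. i \<noteq> j \<longrightarrow> 0 < x i \<and> x i < 1}"

lemma cube_eq_cube_facet: "cube n = cube_facet (Suc n) n 0"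
  unfolding cube_def cube_facet_def all_ge_Suc[of n] by (auto simp: less_Suc_eq)

lemma cube_facet_subset_boundary: "j < d \<Longrightarrow> e = 0 \<or> e = 1 \<Longrightarrow> cube_facet d j e \<subseteq> cube_boundary d"
  unfolding cube_facet_def cube_boundary_def by blast

lemma open_facet_subset: "open_facet d j e \<subseteq> cube_facet d j e"
  by (auto simp: open_facet_def)

lemma mid_facet_subset_open_facet:
  assumes "j < d" "e = 0 \<or> e = 1" "0 < \<epsilon>" "\<epsilon> \<le> 1/2"
  shows "mid_facet d \<epsilon> j e \<subseteq> open_facet d j e"
proof
  fix x assume x: "x \<in> mid_facet d \<epsilon> j e"
  then have "x \<in> cube d" using mid_facet_subset_boundary[OF assms] cube_boundary_subset by blast
  moreover have "0 < x i \<and> x i < 1" if "i < d" "i \<noteq> j" for i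
    using x that assms unfolding mid_facet_def by force
  ultimately show "x \<in> open_facet d j e"
    using x by (simp add: open_facet_def cube_facet_def mid_facet_def)
qed

lemma openin_open_facet:
  assumes "j < d" "e = 0 \<or> e = 1"
  shows "openin (top_of_set (cube_boundary d)) (open_facet d j e)"
proof -
  \<comment> \<open>The interval of radius \<open>1/2\<close> around \<open>e\<close> excludes the
    opposite facet, and the strict bounds on the other coordinates exclude all remaining
    ones.\<close>
  let ?O = "({x. x j < e + 1/2} \<inter> {x. e - 1/2 < x j}) \<inter> (\<Inter>i\<in>{..<d}-{j}. {x. 0 < x i} \<inter> {x::nat \<Rightarrow> real. x i < 1})"
  have "open ?O"
    by (intro open_Int open_INT ballI open_coord_less) auto
  moreover have "open_facet d j e = cube_boundary d \<inter> ?O"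
  proof
    show "open_facet d j e \<subseteq> cube_boundary d \<inter> ?O"
      using cube_facet_subset_boundary[OF assms] by (auto simp: open_facet_def cube_facet_def)
    show "cube_boundary d \<inter> ?O \<subseteq> open_facet d j e"
    proof
      fix x assume x: "x \<in> cube_boundary d \<inter> ?O"
      then obtain i where i: "i < d" "x i = 0 \<or> x i = 1" by (auto simp: cube_boundary_def)
      have "i = j" using x i by (metis (no_types, lifting) DiffI INT_E IntE lessThan_iff mem_Collect_eq order_less_irrefl singletonD)
      then have "x j = e" using x i assms by auto
      then show "x \<in> open_facet d j e"
        using x by (auto simp: open_facet_def cube_facet_def cube_boundary_def)
    qed
  qed
  ultimately show ?thesis using openin_open_Int[of ?O "cube_boundary d"] by simp
qed

lemma closed_mid_facet: "closed (mid_facet d \<epsilon> j e)"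
proof -
  have "mid_facet d \<epsilon> j e = {x. x j = e} \<inter> (\<Inter>i\<in>{..<d}-{j}. {x. \<epsilon> \<le> x i} \<inter> {x. x i \<le> 1 - \<epsilon>})
      \<inter> (\<Inter>i\<in>{d..}. {x. x i = 0})"
    by (auto simp: mid_facet_def)
  then show ?thesis
    by (simp only:) (intro closed_Int closed_INT ballI closed_coord_eq closed_coord_le)
qed

text \<open>The part of the sphere outside the relative interior of the facet is closed and disjoint
  from \<open>K\<close>, so the rest of the sphere can be cut away although the facet is not open in
  it.\<close>

lemma facet_excision:
  assumes "j < d" "e = 0 \<or> e = 1" "closed K" "K \<subseteq> open_facet d j e"
  shows "HI p (cube_facet d j e) (cube_facet d j e - K) (cube_boundary d) (cube_boundary d - K) id \<in>
    iso (HG p (cube_facet d j e) (cube_facet d j e - K)) (HG p (cube_boundary d) (cube_boundary d - K))"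
proof -
  let ?S = "cube_boundary d"
  note sub = cube_facet_subset_boundary[OF assms(1,2)]
  have KS: "K \<subseteq> ?S" using assms(4) open_facet_subset sub by blast
  have "HI p (cube_facet d j e) (cube_facet d j e \<inter> (?S - K)) ?S (?S - K) id \<in>
    iso (HG p (cube_facet d j e) (cube_facet d j e \<inter> (?S - K))) (HG p ?S (?S - K))"
  proof (rule excision_iso[where Z = "?S - open_facet d j e"])
    show "openin (top_of_set ?S) (?S - K)"
      using assms(3) KS by (simp add: closed_subset openin_diff)
    show "closedin (top_of_set ?S) (?S - open_facet d j e)"
      using openin_open_facet[OF assms(1,2)] by (simp add: closedin_diff)
  qed (use sub assms(4) open_facet_subset in blast)+
  moreover have "cube_facet d j e \<inter> (?S - K) = cube_facet d j e - K" using sub by blast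
  ultimately show ?thesis by simp
qed

lemma open_excision:
  assumes "openin (top_of_set A) N" "closedin (top_of_set A) K" "K \<subseteq> N"
  shows "HI p N (N - K) A (A - K) id \<in> iso (HG p N (N - K)) (HG p A (A - K))"
proof -
  have NA: "N \<subseteq> A" using assms(1) openin_imp_subset by blast
  have "HI p N (N \<inter> (A - K)) A (A - K) id \<in> iso (HG p N (N \<inter> (A - K))) (HG p A (A - K))"
    by (rule excision_iso[where Z = "A - N"]) (use assms NA in \<open>auto intro: openin_diff closedin_diff\<close>)
  moreover have "N \<inter> (A - K) = N - K" using NA by blast
  ultimately show ?thesis by simp
qed

lemma homeomorphism_relative_homology_iso:
  assumes "homeomorphism A C f g" "B \<subseteq> A" "f ` B = D"
  shows "HI p A B C D f \<in> iso (HG p A B) (HG p C D)"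
proof (rule homeomorphic_map_relative_homology_iso)
  show "homeomorphic_map (top_of_set A) (top_of_set C) f"
    using assms(1) by (metis homeomorphic_map_maps homeomorphic_maps_iff_homeomorphism)
qed (use assms in auto)

text \<open>As \<open>G\<close> is defined on the whole cube, it kills the fundamental class of the
  boundary sphere. Splitting that class along the cores writes zero as a sum with one integer for
  each facet, whose parity is the local degree of that facet. Hypothesis \<open>no\<close> keeps the
  preimages of \<open>y\<close> inside the cores, and \<open>al_mid\<close> makes each
  parametrization of a facet respect them.\<close>

lemma even_odd_degree_facets:
  assumes G: "continuous_on (cube (Suc n)) G" "G ` cube (Suc n) \<subseteq> cube_boundary (Suc n)"
    and y: "y \<in> cube_boundary (Suc n)" and eps: "0 < \<epsilon>" "\<epsilon> \<le> 1/2"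
    and al: "\<And>j e. j < Suc n \<Longrightarrow> e = 0 \<or> e = 1 \<Longrightarrow> \<exists>\<beta>. homeomorphism (cube n) (cube_facet (Suc n) j e) (\<alpha> j e) \<beta>"
    and al_mid: "\<And>j e. j < Suc n \<Longrightarrow> e = 0 \<or> e = 1 \<Longrightarrow> \<alpha> j e ` mid_cube n \<epsilon> = mid_facet (Suc n) \<epsilon> j e"
    and no: "\<And>x. x \<in> cube_boundary (Suc n) \<Longrightarrow> G x = y \<Longrightarrow>
       \<exists>j<Suc n. \<exists>e. (e = 0 \<or> e = 1) \<and> x \<in> mid_facet (Suc n) \<epsilon> j e"
  shows "even (card {(j, e). j < Suc n \<and> (e = 0 \<or> e = 1) \<and> odd_degree n \<epsilon> y (G \<circ> \<alpha> j e)})"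
proof -
  let ?d = "Suc n" and ?S = "cube_boundary (Suc n)" and ?p = "int n"
  let ?T = "?S - {y}"
  let ?I = "{..<?d} \<times> {0, 1::real}"
  let ?K = "\<lambda>(j, e). mid_facet ?d \<epsilon> j e" and ?N = "\<lambda>(j, e). open_facet ?d j e"
  let ?k = "local_iso n y"
  have kiso: "?k \<in> iso (HG ?p ?S ?T) integer_group" by (rule local_iso[OF y])
  then have khom: "?k \<in> hom (HG ?p ?S ?T) integer_group" by (simp add: iso_def)
  obtain w where w: "w \<in> carrier (reduced_homology_group ?p (top_of_set ?S))"
    and gen: "\<And>K z. conic_at ?d K z \<Longrightarrow> cyclic_generator (HG ?p ?S (?S - K)) (HI ?p ?S {} ?S (?S - K) id w)"
    using fundamental_class_exists[of n] by blast
  let ?U = "\<Union>(?K ` ?I)"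
  \<comment> \<open>Relative to the complement of all cores, the fundamental class becomes a sum of
    classes supported near the individual cores.\<close>
  define e0 where "e0 = HI ?p ?S {} ?S (?S - ?U) id w"
  have G': "continuous_on ?S G" "G ` ?S \<subseteq> ?S" "G ` (?S - ?U) \<subseteq> ?T"
  proof -
    show "continuous_on ?S G"
      using G(1) cube_boundary_subset by (rule continuous_on_subset)
    show im: "G ` ?S \<subseteq> ?S"
      using G(2) cube_boundary_subset by blast
    have "G x \<noteq> y" if "x \<in> ?S - ?U" for x
      using no[of x] that by force
    then show "G ` (?S - ?U) \<subseteq> ?T" using im by blast
  qed
  have "\<exists>a. (\<forall>i\<in>?I. a i \<in> carrier (HG ?p (?N i) (?N i - ?K i)) \<and>
           HI ?p (?N i) (?N i - ?K i) ?S (?S - ?K i) id (a i) = HI ?p ?S (?S - ?U) ?S (?S - ?K i) id e0) \<and>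
         ?k (HI ?p ?S (?S - ?U) ?S ?T G e0) = (\<Sum>i\<in>?I. ?k (HI ?p (?N i) (?N i - ?K i) ?S ?T G (a i)))"
  proof (rule relative_homology_split[OF _ _ _ _ _ _ G' khom])
    fix i assume "i \<in> ?I"
    then obtain j e where i: "i = (j, e)" "j < ?d" "e = 0 \<or> e = 1" by auto
    show "closedin (top_of_set ?S) (?K i)"
      using i mid_facet_subset_boundary[OF i(2,3) eps] by (simp add: closed_mid_facet closed_subset)
    show "openin (top_of_set ?S) (?N i)" using i openin_open_facet by simp
    show "?K i \<subseteq> ?N i" using i mid_facet_subset_open_facet[OF i(2,3) eps] by simp
    fix i' assume "i' \<in> ?I" "i \<noteq> i'"
    then obtain j' e' where i': "i' = (j', e')" "j' < ?d" "e' = 0 \<or> e' = 1" by auto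
    have "x \<notin> ?K i'" if "x \<in> ?N i" for x
    proof
      assume "x \<in> ?K i'"
      then have "x j = e" "x j' = e'" "j' \<noteq> j \<Longrightarrow> 0 < x j' \<and> x j' < 1"
        using that i i' by (auto simp: open_facet_def cube_facet_def mid_facet_def)
      then show False using i i' \<open>i \<noteq> i'\<close> by (cases "j = j'") auto
    qed
    then show "?N i \<inter> ?K i' = {}" by blast
  next
    show "e0 \<in> carrier (HG ?p ?S (?S - ?U))" by (simp add: e0_def hom_induced_carrier)
  qed simp
  then obtain a where a: "\<And>i. i \<in> ?I \<Longrightarrow> a i \<in> carrier (HG ?p (?N i) (?N i - ?K i))"
    and ae: "\<And>i. i \<in> ?I \<Longrightarrow> HI ?p (?N i) (?N i - ?K i) ?S (?S - ?K i) id (a i) = HI ?p ?S (?S - ?U) ?S (?S - ?K i) id e0"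
    and sum: "?k (HI ?p ?S (?S - ?U) ?S ?T G e0) = (\<Sum>i\<in>?I. ?k (HI ?p (?N i) (?N i - ?K i) ?S ?T G (a i)))"
    by blast
  have zero: "?k (HI ?p ?S (?S - ?U) ?S ?T G e0) = 0"
  proof -
    have "HI ?p ?S (?S - ?U) ?S ?T G e0 = HI ?p ?S {} ?S ?T G w"
      unfolding e0_def by (rule HI_incl_compose) (use G' in auto)
    also have "\<dots> = HI ?p ?S {} ?S ?T id (HI ?p ?S {} ?S {} G w)"
      by (subst HI_compose) (use G' in auto)
    also have "HI ?p ?S {} ?S {} G w = HI ?p (cube ?d) {} ?S {} G (HI ?p ?S {} (cube ?d) {} id w)"
      by (subst HI_incl_compose) (use G cube_boundary_subset in auto)
    \<comment> \<open>Here \<open>w\<close> has to be a reduced class: for \<open>n = 0\<close> the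
      unreduced homology of the contractible cube does not vanish.\<close>
    also have "HI ?p ?S {} (cube ?d) {} id w = \<one>\<^bsub>homology_group ?p (top_of_set (cube ?d))\<^esub>"
    proof -
      have "HI ?p ?S {} (cube ?d) {} id w \<in> carrier (reduced_homology_group ?p (top_of_set (cube ?d)))"
        using w by (rule hom_induced_reduced)
      then show ?thesis
        using trivial_reduced_homology_group_contractible_space[OF contractible_cube, of ?p ?d]
        by (simp add: trivial_group_def one_reduced_homology_group)
    qed
    finally have "HI ?p ?S (?S - ?U) ?S ?T G e0 = \<one>\<^bsub>HG ?p ?S ?T\<^esub>"
      by (simp only: group_hom.hom_one[OF HI_group_hom])
    then show ?thesis using hom_one[OF khom] by simp
  qed
  have odd_iff: "odd_degree n \<epsilon> y (G \<circ> \<alpha> j e) \<longleftrightarrow> odd (?k (HI ?p (?N (j, e)) (?N (j, e) - ?K (j, e)) ?S ?T G (a (j, e))))"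
    if je: "j < ?d" "e = 0 \<or> e = 1" for j e
  proof -
    let ?F = "cube_facet ?d j e" and ?Kj = "mid_facet ?d \<epsilon> j e" and ?Nj = "open_facet ?d j e"
    let ?Ca = "HG ?p (cube n) (cube n - mid_cube n \<epsilon>)"
    have i: "(j, e) \<in> ?I" using je by auto
    obtain \<beta> where hom: "homeomorphism (cube n) ?F (\<alpha> j e) \<beta>" using al[OF je] by blast
    note KN = mid_facet_subset_open_facet[OF je eps]
    note NF = open_facet_subset[of ?d j e]
    note FS = cube_facet_subset_boundary[OF je]
    have KU: "?Kj \<subseteq> ?U" using i by force
    have F1: "HI ?p ?F (?F - ?Kj) ?S (?S - ?Kj) id \<in> iso (HG ?p ?F (?F - ?Kj)) (HG ?p ?S (?S - ?Kj))"
      by (rule facet_excision[OF je closed_mid_facet KN])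
    \<comment> \<open>Relative to the complement of its core, \<open>b0\<close> has the same image
      in the sphere as \<open>w\<close>, which is a generator. By excision \<open>b0\<close>
      generates the group of the facet, and \<open>odd_degree\<close> can be tested on it
      alone.\<close>
    define b0 where "b0 = HI ?p ?Nj (?Nj - ?Kj) ?F (?F - ?Kj) id (a (j, e))"
    have b0: "b0 \<in> carrier (HG ?p ?F (?F - ?Kj))" by (simp add: b0_def hom_induced_carrier)
    have "HI ?p ?F (?F - ?Kj) ?S (?S - ?Kj) id b0 = HI ?p ?Nj (?Nj - ?Kj) ?S (?S - ?Kj) id (a (j, e))"
      unfolding b0_def by (rule HI_incl_compose) (use NF FS in auto)
    also have "\<dots> = HI ?p ?S (?S - ?U) ?S (?S - ?Kj) id e0" using ae[OF i] by simp
    also have "\<dots> = HI ?p ?S {} ?S (?S - ?Kj) id w"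
      unfolding e0_def by (rule HI_incl_compose) (use KU in auto)
    finally have gb0: "cyclic_generator (HG ?p ?F (?F - ?Kj)) b0"
      using cyclic_generator_iso_rev[OF F1 _ _ b0] gen[OF conic_at_mid_facet[OF je eps]] by simp
    have GF: "continuous_on ?F G" "G ` ?F \<subseteq> ?S" "G ` (?F - ?Kj) \<subseteq> ?T"
    proof -
      show "continuous_on ?F G" using G'(1) FS by (rule continuous_on_subset)
      show im: "G ` ?F \<subseteq> ?S" using G'(2) FS by blast
      have "G x \<noteq> y" if x: "x \<in> ?F - ?Kj" for x
      proof
        assume "G x = y"
        then obtain j' e' where j': "j' < ?d" "e' = 0 \<or> e' = 1" "x \<in> mid_facet ?d \<epsilon> j' e'"
          using no[of x] x FS by blast
        \<comment> \<open>Being on the facet \<open>x j = e\<close>, the point could lie in a core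
          of direction \<open>j\<close> only if that core were \<open>?Kj\<close>; a core of another
          direction has \<open>x j\<close> strictly between 0 and 1.\<close>
        have "j' \<noteq> j"
          using j' x je by (auto simp: cube_facet_def mid_facet_def)
        then have "0 < x j \<and> x j < 1" 
          using mid_facet_subset_open_facet[OF j'(1,2) eps] j' je(1) by (auto simp: open_facet_def)
        then show False using x je by (auto simp: cube_facet_def)
      qed
      then show "G ` (?F - ?Kj) \<subseteq> ?T" using im by blast
    qed
    have *: "(\<exists>b\<in>carrier (HG ?p ?F (?F - ?Kj)). odd (?k (HI ?p ?F (?F - ?Kj) ?S ?T G b)))
        \<longleftrightarrow> odd (?k (HI ?p ?F (?F - ?Kj) ?S ?T G b0))"
      using odd_hom_cyclic_generator[OF Group.hom_compose[OF HI_hom khom] _ gb0, of G] by simp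
    have b0G: "HI ?p ?F (?F - ?Kj) ?S ?T G b0 = HI ?p ?Nj (?Nj - ?Kj) ?S ?T G (a (j, e))"
      unfolding b0_def by (rule HI_incl_compose) (use NF GF in auto)
    have alim: "\<alpha> j e ` (cube n - mid_cube n \<epsilon>) = ?F - ?Kj"
    proof -
      have inj: "inj_on (\<alpha> j e) (cube n)" and im: "\<alpha> j e ` cube n = ?F"
        using hom unfolding homeomorphism_def by (metis inj_on_inverseI, blast)
      have "mid_cube n \<epsilon> \<subseteq> cube n"
        unfolding mid_cube_eq_mid_facet cube_eq_cube_facet[of n]
        using mid_facet_subset_open_facet[of n "Suc n" 0 \<epsilon>] open_facet_subset eps by blast
      then show ?thesis
        using inj_on_image_set_diff[OF inj, of "cube n" "mid_cube n \<epsilon>"] im al_mid[OF je] by auto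
    qed
    have aiso: "HI ?p (cube n) (cube n - mid_cube n \<epsilon>) ?F (?F - ?Kj) (\<alpha> j e) \<in> iso ?Ca (HG ?p ?F (?F - ?Kj))"
      by (rule homeomorphism_relative_homology_iso[OF hom _ alim]) auto
    have comp: "HI ?p (cube n) (cube n - mid_cube n \<epsilon>) ?S ?T (G \<circ> \<alpha> j e) c =
       HI ?p ?F (?F - ?Kj) ?S ?T G (HI ?p (cube n) (cube n - mid_cube n \<epsilon>) ?F (?F - ?Kj) (\<alpha> j e) c)" for c
      by (rule HI_compose[symmetric]) (use hom alim GF in \<open>auto simp: homeomorphism_def\<close>)
    have "odd_degree n \<epsilon> y (G \<circ> \<alpha> j e) \<longleftrightarrow> (\<exists>b\<in>carrier (HG ?p ?F (?F - ?Kj)). odd (?k (HI ?p ?F (?F - ?Kj) ?S ?T G b)))"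
      unfolding odd_degree_def comp iso_image[OF aiso, symmetric] by (simp only: bex_simps)
    then show ?thesis using * b0G by simp
  qed
  have fin: "finite ?I" by simp
  have "even (\<Sum>i\<in>?I. ?k (HI ?p (?N i) (?N i - ?K i) ?S ?T G (a i)))"
    unfolding sum[symmetric] zero by simp
  then have "even (card {i\<in>?I. odd (?k (HI ?p (?N i) (?N i - ?K i) ?S ?T G (a i)))})"
    unfolding even_sum_iff[OF fin] .
  moreover have "{i\<in>?I. odd (?k (HI ?p (?N i) (?N i - ?K i) ?S ?T G (a i)))} =
      {(j, e). j < Suc n \<and> (e = 0 \<or> e = 1) \<and> odd_degree n \<epsilon> y (G \<circ> \<alpha> j e)}"
    by (auto simp: odd_iff)
  ultimately show ?thesis by simp
qed

text \<open>A local homeomorphism carries the local generator at a preimage to a generator of the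
  local group at \<open>y\<close>, so each preimage contributes an odd integer. A sum of
  \<open>card P\<close> odd integers has the parity of \<open>card P\<close>.\<close>

lemma odd_degree_iff_odd_card:
  assumes g: "continuous_on (cube n) g" "g ` cube n \<subseteq> cube_boundary (Suc n)"
    and y: "y \<in> cube_boundary (Suc n)" and eps: "0 < \<epsilon>" "\<epsilon> \<le> 1/2"
    and P: "P = {u \<in> cube n. g u = y}" "finite P" "P \<subseteq> mid_cube n \<epsilon>"
    and loc: "\<And>u. u \<in> P \<Longrightarrow> \<exists>U V h. openin (top_of_set (cube n)) U \<and> u \<in> U \<and>
        openin (top_of_set (cube_boundary (Suc n))) V \<and> homeomorphism U V g h"
  shows "odd_degree n \<epsilon> y g \<longleftrightarrow> odd (card P)"
proof -
  let ?d = "Suc n" and ?S = "cube_boundary (Suc n)" and ?p = "int n" and ?A = "cube n" and ?m = "mid_cube n \<epsilon>"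
  let ?T = "?S - {y}" and ?k = "local_iso n y"
  have kiso: "?k \<in> iso (HG ?p ?S ?T) integer_group" by (rule local_iso[OF y])
  then have khom: "?k \<in> hom (HG ?p ?S ?T) integer_group" by (simp add: iso_def)
  obtain w where w: "w \<in> carrier (reduced_homology_group ?p (top_of_set ?S))"
    and gen: "\<And>K z. conic_at ?d K z \<Longrightarrow> cyclic_generator (HG ?p ?S (?S - K)) (HI ?p ?S {} ?S (?S - K) id w)"
    using fundamental_class_exists[of n] by blast
  have mN: "?m \<subseteq> open_facet ?d n 0"
    unfolding mid_cube_eq_mid_facet by (rule mid_facet_subset_open_facet) (use eps in auto)
  have clm: "closed ?m" unfolding mid_cube_eq_mid_facet by (rule closed_mid_facet)
  have exc: "HI ?p ?A (?A - K) ?S (?S - K) id \<in> iso (HG ?p ?A (?A - K)) (HG ?p ?S (?S - K))"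
    if "closed K" "K \<subseteq> ?m" for K
    using facet_excision[of n ?d 0 K ?p] that mN unfolding cube_eq_cube_facet[of n, symmetric] by simp
  have AS: "?A \<subseteq> ?S"
    unfolding cube_eq_cube_facet[of n] by (rule cube_facet_subset_boundary) auto
  have genm: "cyclic_generator (HG ?p ?S (?S - ?m)) (HI ?p ?S {} ?S (?S - ?m) id w)"
    unfolding mid_cube_eq_mid_facet by (rule gen[OF conic_at_mid_facet]) (use eps in auto)
  obtain a0 where a0: "a0 \<in> carrier (HG ?p ?A (?A - ?m))"
    "HI ?p ?A (?A - ?m) ?S (?S - ?m) id a0 = HI ?p ?S {} ?S (?S - ?m) id w"
    using iso_obtain_preimage[OF exc[OF clm order_refl]] hom_induced_carrier by metis
  have gena0: "cyclic_generator (HG ?p ?A (?A - ?m)) a0"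
    using cyclic_generator_iso_rev[OF exc[OF clm order_refl] _ _ a0(1)] a0(2) genm by simp
  have gT: "g ` (?A - ?m) \<subseteq> ?T" "g ` (?A - P) \<subseteq> ?T" using g P by auto
  have od: "odd_degree n \<epsilon> y g \<longleftrightarrow> odd (?k (HI ?p ?A (?A - ?m) ?S ?T g a0))"
    unfolding odd_degree_def
    using odd_hom_cyclic_generator[OF Group.hom_compose[OF HI_hom khom] _ gena0, of g] by simp
  define e where "e = HI ?p ?A (?A - ?m) ?A (?A - P) id a0"
  have ge: "HI ?p ?A (?A - ?m) ?S ?T g a0 = HI ?p ?A (?A - P) ?S ?T g e"
    unfolding e_def by (rule HI_incl_compose[symmetric]) (use g gT P in auto)
  obtain U V h where UV: "\<And>u. u \<in> P \<Longrightarrow> openin (top_of_set ?A) (U u) \<and> u \<in> U u \<and>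
        openin (top_of_set ?S) (V u) \<and> homeomorphism (U u) (V u) g (h u)"
    using loc by metis
  \<comment> \<open>Discarding the other preimages yields the separated neighbourhoods that the
    splitting requires.\<close>
  define N where "N u = U u - (P - {u})" for u
  have N: "openin (top_of_set ?A) (N u)" "u \<in> N u" "N u \<subseteq> U u" if u: "u \<in> P" for u
  proof -
    have "closedin (top_of_set ?A) (P - {u})"
      using P by (intro closed_subset finite_imp_closed) auto
    then show "openin (top_of_set ?A) (N u)" unfolding N_def using UV[OF u] by (simp add: openin_diff)
  qed (use UV[OF that] in \<open>auto simp: N_def\<close>)
  have sing: "\<Union>((\<lambda>u. {u}) ` P) = P" by auto
  have "\<exists>a. (\<forall>u\<in>P. a u \<in> carrier (HG ?p (N u) (N u - {u})) \<and>
           HI ?p (N u) (N u - {u}) ?A (?A - {u}) id (a u) = HI ?p ?A (?A - \<Union>((\<lambda>u. {u}) ` P)) ?A (?A - {u}) id e) \<and>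
         ?k (HI ?p ?A (?A - \<Union>((\<lambda>u. {u}) ` P)) ?S ?T g e) = (\<Sum>u\<in>P. ?k (HI ?p (N u) (N u - {u}) ?S ?T g (a u)))"
  proof (rule relative_homology_split[OF P(2) _ _ _ _ _ g _ khom])
    show "closedin (top_of_set ?A) {u}" if "u \<in> P" for u
      using that P by (intro closed_subset) auto
    show "e \<in> carrier (HG ?p ?A (?A - \<Union>((\<lambda>u. {u}) ` P)))"
      unfolding sing e_def by (rule hom_induced_carrier)
    show "N u \<inter> {u'} = {}" if "u \<in> P" "u' \<in> P" "u \<noteq> u'" for u u'
      using that by (auto simp: N_def)
  qed (use N sing gT in auto)
  then obtain a where a: "\<And>u. u \<in> P \<Longrightarrow> a u \<in> carrier (HG ?p (N u) (N u - {u}))"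
    and ae: "\<And>u. u \<in> P \<Longrightarrow> HI ?p (N u) (N u - {u}) ?A (?A - {u}) id (a u) = HI ?p ?A (?A - P) ?A (?A - {u}) id e"
    and sum: "?k (HI ?p ?A (?A - P) ?S ?T g e) = (\<Sum>u\<in>P. ?k (HI ?p (N u) (N u - {u}) ?S ?T g (a u)))"
    unfolding sing by blast
  have odd: "odd (?k (HI ?p (N u) (N u - {u}) ?S ?T g (a u)))" if u: "u \<in> P" for u
  proof -
    have um: "u \<in> ?m" and uA: "u \<in> ?A" and gu: "g u = y" using u P by auto
    have iN: "HI ?p (N u) (N u - {u}) ?A (?A - {u}) id \<in> iso (HG ?p (N u) (N u - {u})) (HG ?p ?A (?A - {u}))"
      by (rule open_excision) (use N[OF u] uA in \<open>auto intro: closed_subset\<close>)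
    have iA: "HI ?p ?A (?A - {u}) ?S (?S - {u}) id \<in> iso (HG ?p ?A (?A - {u})) (HG ?p ?S (?S - {u}))"
      by (rule exc) (use um in auto)
    \<comment> \<open>The local class at \<open>u\<close> is a restriction of \<open>a0\<close>, and
      \<open>a0\<close> is a lift of the restriction of \<open>w\<close>. Hence the class is a
      generator, as \<open>w\<close> restricts to one at every point.\<close>
    have "HI ?p ?A (?A - {u}) ?S (?S - {u}) id (HI ?p (N u) (N u - {u}) ?A (?A - {u}) id (a u)) =
        HI ?p ?A (?A - P) ?S (?S - {u}) id e"
      unfolding ae[OF u] by (rule HI_incl_compose) (use u AS in auto)
    also have "\<dots> = HI ?p ?A (?A - ?m) ?S (?S - {u}) id a0"
      unfolding e_def by (rule HI_incl_compose) (use u AS P in auto)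
    also have "\<dots> = HI ?p ?S (?S - ?m) ?S (?S - {u}) id (HI ?p ?A (?A - ?m) ?S (?S - ?m) id a0)"
      by (rule HI_incl_compose[symmetric]) (use um AS in auto)
    also have "\<dots> = HI ?p ?S {} ?S (?S - {u}) id w"
      unfolding a0 by (rule HI_incl_compose) (use um in auto)
    finally have "cyclic_generator (HG ?p ?S (?S - {u})) 
        (HI ?p ?A (?A - {u}) ?S (?S - {u}) id (HI ?p (N u) (N u - {u}) ?A (?A - {u}) id (a u)))"
      using gen[OF conic_at_point[of u ?d]] uA AS by auto
    then have "cyclic_generator (HG ?p ?A (?A - {u})) (HI ?p (N u) (N u - {u}) ?A (?A - {u}) id (a u))"
      by (rule cyclic_generator_iso_rev[OF iA, rotated -1]) (auto simp: hom_induced_carrier)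
    then have ga: "cyclic_generator (HG ?p (N u) (N u - {u})) (a u)"
      by (rule cyclic_generator_iso_rev[OF iN, rotated -1]) (use a[OF u] in auto)
    have hom: "homeomorphism (U u) (V u) g (h u)" and Vo: "openin (top_of_set ?S) (V u)"
      and Uo: "openin (top_of_set ?A) (U u)" using UV[OF u] by auto
    let ?W = "g ` N u"
    have No: "openin (top_of_set (U u)) (N u)"
      using N[OF u] Uo by (meson openin_imp_subset openin_subset_trans)
    have "openin (top_of_set (V u)) ?W"
      using homeomorphism_imp_open_map[OF hom No] .
    then have Wo: "openin (top_of_set ?S) ?W" using Vo openin_trans by blast
    have homW: "homeomorphism (N u) ?W g (h u)"
      using homeomorphism_of_subsets[OF hom N(3)[OF u]] homeomorphism_image1[OF hom] N(3)[OF u] by blast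
    have gim: "g ` (N u - {u}) = ?W - {y}"
      using homeomorphism_apply1[OF homW] N(2)[OF u] gu by (auto simp: image_iff) metis
    have "cyclic_generator (HG ?p ?W (?W - {y})) (HI ?p (N u) (N u - {u}) ?W (?W - {y}) g (a u))"
      by (rule cyclic_generator_iso[OF homeomorphism_relative_homology_iso[OF homW _ gim]]) (use ga in auto)
    \<comment> \<open>The image \<open>?W\<close> is open in the sphere, so excision identifies its
      local group at \<open>y\<close> with that of the sphere.\<close>
    then have "cyclic_generator (HG ?p ?S ?T) (HI ?p ?W (?W - {y}) ?S ?T id (HI ?p (N u) (N u - {u}) ?W (?W - {y}) g (a u)))"
      by (rule cyclic_generator_iso[OF open_excision[OF Wo], rotated -1]) 
        (use y gu N(2)[OF u] in \<open>auto intro: closed_subset\<close>)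
    moreover have "HI ?p ?W (?W - {y}) ?S ?T id (HI ?p (N u) (N u - {u}) ?W (?W - {y}) g (a u)) =
        HI ?p (N u) (N u - {u}) ?S ?T g (a u)"
      by (subst HI_compose) (use homW gim openin_imp_subset[OF Wo] in \<open>auto simp: homeomorphism_def\<close>)
    ultimately show ?thesis
      using odd_iso_cyclic_generator[OF kiso] by simp
  qed
  have "even (?k (HI ?p ?A (?A - P) ?S ?T g e)) \<longleftrightarrow> even (card {u\<in>P. odd (?k (HI ?p (N u) (N u - {u}) ?S ?T g (a u)))})"
    unfolding sum by (rule even_sum_iff[OF P(2)])
  also have "{u\<in>P. odd (?k (HI ?p (N u) (N u - {u}) ?S ?T g (a u)))} = P" using odd by auto
  finally show ?thesis unfolding od ge by simp
qed


section \<open>Multilinear interpolation\<close>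

text \<open>Multilinearity without coefficients, as interpolation between opposite faces. In this
  form it survives permutations and reflections of coordinates, and it reduces statements on the
  cube to its vertices.\<close>

definition sep_affine :: "nat \<Rightarrow> ((nat \<Rightarrow> real) \<Rightarrow> real) \<Rightarrow> bool" where
  "sep_affine k h \<longleftrightarrow> (\<forall>u\<in>cube k. \<forall>m<k. h u = (1 - u m) * h (u(m := 0)) + u m * h (u(m := 1)))"

lemma cube_upd: "u \<in> cube k \<Longrightarrow> m < k \<Longrightarrow> 0 \<le> t \<Longrightarrow> t \<le> 1 \<Longrightarrow> u(m := t) \<in> cube k"
  by (auto simp: cube_def)

lemma cube_vertices_subset: "cube_vertices k \<subseteq> cube k"
  by (force simp: cube_vertices_def cube_def)

text \<open>The number of coordinates different from 0 and 1 drops when one of them is replaced by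
  an endpoint.\<close>

lemma cube_vertex_induct [consumes 1, case_names vertex step]:
  assumes "u \<in> cube k"
    and vertex: "\<And>v. v \<in> cube_vertices k \<Longrightarrow> P v"
    and step: "\<And>u m. u \<in> cube k \<Longrightarrow> m < k \<Longrightarrow> P (u(m := 0)) \<Longrightarrow> P (u(m := 1)) \<Longrightarrow> P u"
  shows "P u"
  using assms(1)
proof (induction "card {i. i < k \<and> u i \<noteq> 0 \<and> u i \<noteq> 1}" arbitrary: u rule: less_induct)
  case less
  show ?case
  proof (cases "\<exists>m<k. u m \<noteq> 0 \<and> u m \<noteq> 1")
    case True
    then obtain m where m: "m < k" "u m \<noteq> 0" "u m \<noteq> 1" by blast
    have "P (u(m := t))" if t: "t = 0 \<or> t = 1" for t
    proof (rule less.hyps)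
      show "card {i. i < k \<and> (u(m := t)) i \<noteq> 0 \<and> (u(m := t)) i \<noteq> 1} < card {i. i < k \<and> u i \<noteq> 0 \<and> u i \<noteq> 1}"
        by (rule psubset_card_mono) (use m t in auto)
      show "u(m := t) \<in> cube k" using cube_upd[OF less.prems m(1)] t by auto
    qed
    then show ?thesis using step[OF less.prems m(1)] by simp
  next
    case False
    then have "u \<in> cube_vertices k" using less.prems by (auto simp: cube_def cube_vertices_def)
    then show ?thesis by (rule vertex)
  qed
qed

lemma sep_affine_eqI:
  assumes "sep_affine k h" "sep_affine k h'" "\<And>v. v \<in> cube_vertices k \<Longrightarrow> h v = h' v" "u \<in> cube k"
  shows "h u = h' u"
  using assms(4)
proof (induction rule: cube_vertex_induct)
  case (step u m)
  then show ?case using assms(1,2) unfolding sep_affine_def by (metis (no_types))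
qed (use assms(3) in auto)

lemma sep_affine_bounds:
  assumes "sep_affine k h" "\<And>v. v \<in> cube_vertices k \<Longrightarrow> 0 \<le> h v \<and> h v \<le> 1" "u \<in> cube k"
  shows "0 \<le> h u \<and> h u \<le> 1"
  using assms(3)
proof (induction rule: cube_vertex_induct)
  case (step u m)
  have "h u = (1 - u m) * h (u(m := 0)) + u m * h (u(m := 1))"
    using step assms(1) unfolding sep_affine_def by blast
  moreover have "0 \<le> u m" "u m \<le> 1" using step by (auto simp: cube_def)
  moreover have "(1 - u m) * h (u(m := 0)) + u m * h (u(m := 1)) \<le> 1"
    by (rule convex_bound_le) (use calculation step(3,4) in \<open>simp_all del: fun_upd_apply\<close>)
  ultimately show ?case
    using step(3,4) by (simp del: fun_upd_apply)
qed (use assms(2) in auto)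

section \<open>Square-free polynomials and interpolation at the vertices\<close>

definition mono_sum :: "nat \<Rightarrow> (nat set \<Rightarrow> real) \<Rightarrow> (nat \<Rightarrow> real) \<Rightarrow> real" where
  "mono_sum k a u = (\<Sum>S\<in>Pow {..<k}. a S * (\<Prod>j\<in>S. u j))"

lemma sep_affine_mono_sum: "sep_affine k (mono_sum k a)"
  unfolding sep_affine_def
proof (intro ballI allI impI)
  fix u m assume "u \<in> cube k" "m < k"
  have "(\<Prod>j\<in>S. u j) = (1 - u m) * (\<Prod>j\<in>S. (u(m := 0)) j) + u m * (\<Prod>j\<in>S. (u(m := 1)) j)"
    if "S \<in> Pow {..<k}" for S
  proof -
    have S: "finite S" using that finite_subset by auto
    show ?thesis
    proof (cases "m \<in> S")
      case True
      have "(\<Prod>j\<in>S. (u(m := t)) j) = t * (\<Prod>j\<in>S - {m}. u j)" for t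
        by (subst prod.remove[OF S True]) (auto intro!: prod.cong)
      moreover have "(\<Prod>j\<in>S. u j) = u m * (\<Prod>j\<in>S - {m}. u j)"
        by (rule prod.remove[OF S True])
      ultimately show ?thesis by simp
    next
      case False
      then have "(\<Prod>j\<in>S. (u(m := t)) j) = (\<Prod>j\<in>S. u j)" for t
        by (intro prod.cong) auto
      then show ?thesis by (simp add: algebra_simps)
    qed
  qed
  then have "mono_sum k a u = (\<Sum>S\<in>Pow {..<k}. a S * ((1 - u m) * (\<Prod>j\<in>S. (u(m := 0)) j) + u m * (\<Prod>j\<in>S. (u(m := 1)) j)))"
    unfolding mono_sum_def by (intro sum.cong) auto
  also have "\<dots> = (1 - u m) * mono_sum k a (u(m := 0)) + u m * mono_sum k a (u(m := 1))"
    unfolding mono_sum_def sum_distrib_left sum.distrib[symmetric]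
    by (intro sum.cong) (auto simp: algebra_simps)
  finally show "mono_sum k a u = (1 - u m) * mono_sum k a (u(m := 0)) + u m * mono_sum k a (u(m := 1))" .
qed

lemma mono_sum_Suc:
  "mono_sum (Suc k) a u = mono_sum k a u + u k * mono_sum k (\<lambda>S. a (insert k S)) u"
proof -
  have P: "Pow {..<Suc k} = Pow {..<k} \<union> insert k ` Pow {..<k}"
    by (simp add: lessThan_Suc Pow_insert)
  have inj: "inj_on (insert k) (Pow {..<k})"
    by (rule inj_onI) (auto simp: insert_eq_iff)
  have "mono_sum (Suc k) a u = mono_sum k a u + (\<Sum>S\<in>insert k ` Pow {..<k}. a S * (\<Prod>j\<in>S. u j))"
    unfolding mono_sum_def P by (rule sum.union_disjoint) auto
  also have "(\<Sum>S\<in>insert k ` Pow {..<k}. a S * (\<Prod>j\<in>S. u j)) = (\<Sum>S\<in>Pow {..<k}. a (insert k S) * (\<Prod>j\<in>insert k S. u j))"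
    by (rule sum.reindex[OF inj, unfolded o_def])
  also have "\<dots> = (\<Sum>S\<in>Pow {..<k}. u k * (a (insert k S) * (\<Prod>j\<in>S. u j)))"
  proof (intro sum.cong refl)
    fix S assume "S \<in> Pow {..<k}"
    then have "k \<notin> S" "finite S" using finite_subset by auto
    then show "a (insert k S) * (\<Prod>j\<in>insert k S. u j) = u k * (a (insert k S) * (\<Prod>j\<in>S. u j))" by simp
  qed
  finally show ?thesis by (simp add: mono_sum_def sum_distrib_left)
qed

lemma mono_sum_cong:
  "(\<And>j. j < k \<Longrightarrow> u j = u' j) \<Longrightarrow> (\<And>S. S \<subseteq> {..<k} \<Longrightarrow> a S = a' S) \<Longrightarrow> mono_sum k a u = mono_sum k a' u'"
  unfolding mono_sum_def by (intro sum.cong arg_cong2[where f = "(*)"] prod.cong) auto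

lemma mono_sum_diff: "mono_sum k (\<lambda>S. a S - b S) u = mono_sum k a u - mono_sum k b u"
  by (simp add: mono_sum_def left_diff_distrib sum_subtractf)

lemma mono_sum_interpolation: "\<exists>a. \<forall>v\<in>cube_vertices k. mono_sum k a v = \<phi> v"
proof (induction k arbitrary: \<phi>)
  case 0
  have "cube_vertices 0 = {\<lambda>_. 0}" by (auto simp: cube_vertices_def)
  then show ?case by (intro exI[of _ "\<lambda>_. \<phi> (\<lambda>_. 0)"]) (simp add: mono_sum_def)
next
  case (Suc k)
  obtain a0 a1 where a0: "\<And>v. v \<in> cube_vertices k \<Longrightarrow> mono_sum k a0 v = \<phi> v"
    and a1: "\<And>v. v \<in> cube_vertices k \<Longrightarrow> mono_sum k a1 v = \<phi> (v(k := 1))"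
    using Suc[of \<phi>] Suc[of "\<lambda>v. \<phi> (v(k := 1))"] by blast
  \<comment> \<open>These are the coefficients of \<open>p0 + u k * (p1 - p0)\<close>, where
    \<open>p0\<close> and \<open>p1\<close> interpolate on the faces \<open>u k = 0\<close> and
    \<open>u k = 1\<close>.\<close>
  define a where "a S = (if k \<in> S then a1 (S - {k}) - a0 (S - {k}) else a0 S)" for S
  have "mono_sum (Suc k) a v = \<phi> v" if v: "v \<in> cube_vertices (Suc k)" for v
  proof -
    let ?w = "v(k := 0)"
    have w: "?w \<in> cube_vertices k" using v by (auto simp: cube_vertices_def not_less_eq_eq)
    have "mono_sum k a v = mono_sum k a0 ?w"
      by (rule mono_sum_cong) (auto simp: a_def)
    moreover have "mono_sum k (\<lambda>S. a (insert k S)) v = mono_sum k (\<lambda>S. a1 S - a0 S) ?w"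
    proof (rule mono_sum_cong)
      fix S assume "S \<subseteq> {..<k}"
      then have "S - {k} = S" by auto
      then show "a (insert k S) = a1 S - a0 S" by (simp add: a_def)
    qed simp
    ultimately have e: "mono_sum (Suc k) a v = \<phi> ?w + v k * (\<phi> (?w(k := 1)) - \<phi> ?w)"
      unfolding mono_sum_Suc mono_sum_diff using a0[OF w] a1[OF w] by simp
    have "v k = 0 \<or> v k = 1" using v by (auto simp: cube_vertices_def)
    then show ?thesis
    proof
      assume "v k = 0" then show ?thesis using e fun_upd_triv[of v k] by simp
    next
      assume "v k = 1" then show ?thesis using e fun_upd_triv[of v k] by simp
    qed
  qed
  then show ?case by blast
qed

lemma multilinear_iff: "multilinear n d g \<longleftrightarrow>
     (\<forall>i<d. \<exists>a. \<forall>x\<in>cube n. g x i = mono_sum n a x) \<and> (\<forall>i\<ge>d. \<forall>x\<in>cube n. g x i = 0)"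
  by (simp add: multilinear_def mono_sum_def)

lemma sep_affine_cong: "(\<And>u. u \<in> cube k \<Longrightarrow> h u = h' u) \<Longrightarrow> sep_affine k h \<longleftrightarrow> sep_affine k h'"
  unfolding sep_affine_def by (intro ball_cong all_cong imp_cong refl) (simp add: cube_upd)

lemma multilinear_sep_affine: "multilinear n d g \<Longrightarrow> sep_affine n (\<lambda>u. g u i)"
proof (cases "i < d")
  case True
  assume "multilinear n d g"
  then obtain a where "\<forall>x\<in>cube n. g x i = mono_sum n a x" using True unfolding multilinear_iff by blast
  then show ?thesis using sep_affine_cong[of n "\<lambda>u. g u i" "mono_sum n a"] sep_affine_mono_sum by blast
next
  case False
  assume "multilinear n d g"
  then have "\<And>x. x \<in> cube n \<Longrightarrow> g x i = 0" using False unfolding multilinear_iff by simp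
  then show ?thesis unfolding sep_affine_def by (simp add: cube_upd)
qed

lemma continuous_on_mono_sum: "continuous_on A (mono_sum k a)"
  unfolding mono_sum_def by (intro continuous_intros continuous_on_proj)

lemma multilinear_continuous: "multilinear n d g \<Longrightarrow> continuous_on (cube n) g"
proof (rule continuous_on_coordinatewise_then_product)
  fix i assume g: "multilinear n d g"
  show "continuous_on (cube n) (\<lambda>x. g x i)"
  proof (cases "i < d")
    case True
    then obtain a where "\<forall>x\<in>cube n. g x i = mono_sum n a x" using g unfolding multilinear_iff by blast
    then show ?thesis using continuous_on_mono_sum continuous_on_cong by metis
  next
    case False
    then have "\<forall>x\<in>cube n. g x i = 0" using g unfolding multilinear_iff by simp
    then show ?thesis using continuous_on_const continuous_on_cong by metis
  qed
qed

section \<open>Affine isomorphisms onto faces\<close>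

text \<open>An affine bijection of a cube onto a face of a cube permutes vertices, so up to reflections
  each of its coordinates is one of the variables.\<close>

locale face_map =
  fixes k l :: nat and T :: "(nat \<Rightarrow> real) \<Rightarrow> nat \<Rightarrow> real" and I :: "nat set" and e :: "nat \<Rightarrow> real"
  assumes affine: "\<And>i. i < l \<Longrightarrow> \<exists>a b. \<forall>u\<in>cube k. T u i = b + (\<Sum>m<k. a m * u m)"
    and inj: "inj_on T (cube k)"
    and I: "I \<subseteq> {..<l}" "\<And>i. i \<in> I \<Longrightarrow> e i = 0 \<or> e i = 1"
    and img: "T ` cube k = {x \<in> cube l. \<forall>i\<in>I. x i = e i}"
begin

abbreviation "free \<equiv> {..<l} - I"

lemma T_cube: "u \<in> cube k \<Longrightarrow> T u \<in> cube l"
  using img by blast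

lemma T_fixed: "u \<in> cube k \<Longrightarrow> i \<in> I \<Longrightarrow> T u i = e i"
  using img by blast

lemma T_surj:
  assumes "x \<in> cube l" "\<And>i. i \<in> I \<Longrightarrow> x i = e i"
  obtains u where "u \<in> cube k" "T u = x"
proof -
  have "x \<in> T ` cube k" unfolding img using assms by blast
  then show ?thesis using that by blast
qed

lemma T_midpoint:
  assumes "u \<in> cube k" "v \<in> cube k"
  shows "(\<lambda>j. (u j + v j) / 2) \<in> cube k" "T (\<lambda>j. (u j + v j) / 2) = (\<lambda>i. (T u i + T v i) / 2)"
proof -
  let ?w = "\<lambda>j. (u j + v j) / 2"
  have "0 \<le> ?w i \<and> ?w i \<le> 1" if "i < k" for i
  proof -
    have "0 \<le> u i" "u i \<le> 1" "0 \<le> v i" "v i \<le> 1" using assms that by (auto simp: cube_def)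
    then show ?thesis by simp
  qed
  then show w: "?w \<in> cube k" using assms by (simp add: cube_def)
  show "T ?w = (\<lambda>i. (T u i + T v i) / 2)"
  proof
    fix i show "T ?w i = (T u i + T v i) / 2"
    proof (cases "i < l")
      case True
      obtain a b where ab: "\<forall>u\<in>cube k. T u i = b + (\<Sum>m<k. a m * u m)" using affine[OF True] by blast
      have "(\<Sum>m<k. a m * ((u m + v m) / 2)) = ((\<Sum>m<k. a m * u m) + (\<Sum>m<k. a m * v m)) / 2"
        by (simp add: sum.distrib[symmetric] sum_divide_distrib algebra_simps add_divide_distrib)
      then show ?thesis using ab w assms by simp
    next
      case False
      then show ?thesis using T_cube[OF w] T_cube assms by (auto simp: cube_def)
    qed
  qed
qed

text \<open>A vertex of a cube is not the midpoint of two other points of the cube. A free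
  coordinate of \<open>T v\<close> strictly between 0 and 1 would make \<open>T v\<close> such a
  midpoint within the face, and injectivity pulls the midpoint back to \<open>v\<close>.\<close>

lemma T_vertex:
  assumes v: "v \<in> cube_vertices k"
  shows "T v \<in> cube_vertices l"
proof -
  have vc: "v \<in> cube k" using v cube_vertices_subset by blast
  have Tv: "T v \<in> cube l" by (rule T_cube[OF vc])
  have "T v i = 0 \<or> T v i = 1" if i: "i < l" for i
  proof (cases "i \<in> I")
    case True then show ?thesis using T_fixed[OF vc True] I by auto
  next
    case False
    show ?thesis
    proof (rule ccontr)
      assume n: "\<not> ?thesis"
      \<comment> \<open>The largest displacement of coordinate \<open>i\<close> that stays in the
        cube in both directions; as \<open>i\<close> is free, the displaced points remain in the
        face.\<close>
      define \<delta> where "\<delta> = min (T v i) (1 - T v i)"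
      have b: "0 \<le> T v i" "T v i \<le> 1" using Tv i by (auto simp: cube_def)
      have \<delta>: "\<delta> > 0" "\<delta> \<le> T v i" "\<delta> \<le> 1 - T v i" using n b by (auto simp: \<delta>_def)
      obtain u where u: "u \<in> cube k" "T u = (T v)(i := T v i + \<delta>)"
        by (rule T_surj[of "(T v)(i := T v i + \<delta>)"]) (use cube_upd[OF Tv i] \<delta> b False T_fixed[OF vc] in auto)
      obtain w where w: "w \<in> cube k" "T w = (T v)(i := T v i - \<delta>)"
        by (rule T_surj[of "(T v)(i := T v i - \<delta>)"]) (use cube_upd[OF Tv i] \<delta> b False T_fixed[OF vc] in auto)
      have "T (\<lambda>j. (u j + w j) / 2) = T v"
        unfolding T_midpoint(2)[OF u(1) w(1)] u(2) w(2) by (rule ext) simp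
      then have e: "(\<lambda>j. (u j + w j) / 2) = v"
        using inj T_midpoint(1)[OF u(1) w(1)] vc by (meson inj_onD)
      have "u j = v j" for j
      proof (cases "j < k")
        case True
        have "0 \<le> u j" "u j \<le> 1" "0 \<le> w j" "w j \<le> 1" using u w True by (auto simp: cube_def)
        moreover have "v j = 0 \<or> v j = 1" using v True by (auto simp: cube_vertices_def)
        moreover have "u j + w j = 2 * v j" using fun_cong[OF e, of j] by simp
        ultimately show ?thesis by auto
      next
        case False then show ?thesis using u vc by (auto simp: cube_def)
      qed
      then have "u = v" by auto
      then have "T v = (T v)(i := T v i + \<delta>)" using u(2) by simp
      from fun_cong[OF this, of i] show False using \<delta>(1) by simp
    qed
  qed
  then show ?thesis using Tv by (auto simp: cube_vertices_def cube_def)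
qed

text \<open>The affine form takes only the values 0 and 1 at vertices. It is not constant, because a
  free coordinate varies over the face, and it cannot depend on two variables.\<close>

lemma coordinate:
  assumes i: "i \<in> free"
  shows "\<exists>m<k. (\<forall>u\<in>cube k. T u i = u m) \<or> (\<forall>u\<in>cube k. T u i = 1 - u m)"
proof -
  obtain a b where ab: "\<And>u. u \<in> cube k \<Longrightarrow> T u i = b + (\<Sum>m<k. a m * u m)" using affine i by blast
  have 01: "T v i = 0 \<or> T v i = 1" if "v \<in> cube_vertices k" for v
    using T_vertex[OF that] i by (auto simp: cube_vertices_def)
  have val: "b + (\<Sum>m\<in>A. a m) = 0 \<or> b + (\<Sum>m\<in>A. a m) = 1" if A: "A \<subseteq> {..<k}" for A
  proof -
    let ?v = "\<lambda>m. if m \<in> A then 1 else 0::real"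
    have v: "?v \<in> cube_vertices k" using A by (auto simp: cube_vertices_def)
    have "(\<Sum>m<k. a m * ?v m) = (\<Sum>m\<in>A. a m)"
      using A by (simp add: if_distrib sum.If_cases Int_absorb1 cong: if_cong)
    moreover have "?v \<in> cube k" using v cube_vertices_subset by (rule subsetD[rotated])
    ultimately show ?thesis using 01[OF v] ab[of ?v] by simp
  qed
  \<comment> \<open>With \<open>b\<close> in {0,1}, two nonzero coefficients would both be 1 or both
    be -1, according to \<open>b\<close>; adding both to \<open>b\<close> leaves {0,1}.\<close>
  have one: "m = m'" if m: "m < k" "m' < k" "a m \<noteq> 0" "a m' \<noteq> 0" for m m'
  proof (rule ccontr)
    assume ne: "m \<noteq> m'"
    have "b = 0 \<or> b = 1" "b + a m = 0 \<or> b + a m = 1" "b + a m' = 0 \<or> b + a m' = 1" 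
      "b + (a m + a m') = 0 \<or> b + (a m + a m') = 1"
      using val[of "{}"] val[of "{m}"] val[of "{m'}"] val[of "{m, m'}"] m ne by auto
    then show False using m by auto
  qed
  have "\<exists>m<k. a m \<noteq> 0"
  proof (rule ccontr)
    assume "\<not> ?thesis"
    then have const: "T u i = b" if "u \<in> cube k" for u using ab[OF that] by simp
    have "\<exists>u\<in>cube k. T u i = t" if t: "t = 0 \<or> t = 1" for t
    proof -
      let ?x = "\<lambda>j. if j = i then t else if j \<in> I then e j else 0"
      have "?x \<in> cube l" using t I i by (force simp: cube_def)
      then obtain u where "u \<in> cube k" "T u = ?x" by (rule T_surj) (use i in auto)
      then show ?thesis by (intro bexI[of _ u]) auto
    qed
    then show False using const by (metis zero_neq_one)
  qed
  then obtain m where m: "m < k" "a m \<noteq> 0" by blast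
  have s: "(\<Sum>j<k. a j * u j) = a m * u m" for u
  proof -
    have "(\<Sum>j<k. a j * u j) = (\<Sum>j\<in>{m}. a j * u j)"
      by (rule sum.mono_neutral_right) (use m one in auto)
    then show ?thesis by simp
  qed
  have "b = 0 \<and> a m = 1 \<or> b = 1 \<and> a m = -1"
    using val[of "{}"] val[of "{m}"] m by auto
  then show ?thesis using ab s m(1) by (intro exI[of _ m]) auto
qed

definition \<pi> :: "nat \<Rightarrow> nat" where
  "\<pi> i = (SOME m. m < k \<and> ((\<forall>u\<in>cube k. T u i = u m) \<or> (\<forall>u\<in>cube k. T u i = 1 - u m)))"

lemma \<pi>:
  assumes "i \<in> free"
  shows "\<pi> i < k" "(\<forall>u\<in>cube k. T u i = u (\<pi> i)) \<or> (\<forall>u\<in>cube k. T u i = 1 - u (\<pi> i))"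
proof -
  have "\<pi> i < k \<and> ((\<forall>u\<in>cube k. T u i = u (\<pi> i)) \<or> (\<forall>u\<in>cube k. T u i = 1 - u (\<pi> i)))"
    unfolding \<pi>_def by (rule someI_ex) (use coordinate[OF assms] in blast)
  then show "\<pi> i < k" "(\<forall>u\<in>cube k. T u i = u (\<pi> i)) \<or> (\<forall>u\<in>cube k. T u i = 1 - u (\<pi> i))" by auto
qed

lemma T_coordinate:
  "i \<in> free \<Longrightarrow> u \<in> cube k \<Longrightarrow> T u i = u (\<pi> i) \<or> T u i = 1 - u (\<pi> i)"
  using \<pi>(2) by blast

lemma zero_in_cube: "(\<lambda>_. 0) \<in> cube n"
  by (simp add: cube_def)

text \<open>Two free coordinates can be prescribed independently on the face, so they do not depend
  on the same variable. A variable on which no free coordinate depends could be changed without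
  changing \<open>T u\<close>, against injectivity.\<close>

lemma bij_\<pi>: "bij_betw \<pi> free {..<k}"
  unfolding bij_betw_def
proof
  show "inj_on \<pi> free"
  proof (rule inj_onI, rule ccontr)
    fix i i' assume i: "i \<in> free" "i' \<in> free" "\<pi> i = \<pi> i'" "i \<noteq> i'"
    have "\<exists>u\<in>cube k. T u i = 0 \<and> T u i' = t" if t: "t = 0 \<or> t = 1" for t
    proof -
      let ?x = "\<lambda>j. if j = i' then t else if j \<in> I then e j else 0"
      have "?x \<in> cube l" using t I i by (force simp: cube_def)
      then obtain u where "u \<in> cube k" "T u = ?x" by (rule T_surj) (use i in auto)
      then show ?thesis using i by (intro bexI[of _ u]) auto
    qed
    then obtain u v where "u \<in> cube k" "T u i = 0" "T u i' = 0" "v \<in> cube k" "T v i = 0" "T v i' = 1"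
      by blast
    then have uv: "u \<in> cube k" "T u i = T v i" "T u i' \<noteq> T v i'" "v \<in> cube k" by auto
    have "u (\<pi> i) = v (\<pi> i)"
      using \<pi>(2)[OF i(1)] uv(1,4,2) by (elim disjE) simp_all
    then show False
      using \<pi>(2)[OF i(2)] uv(1,4,3) i(3) by (elim disjE) simp_all
  qed
  have "m \<in> \<pi> ` free" if m: "m < k" for m
  proof (rule ccontr)
    assume n: "m \<notin> \<pi> ` free"
    let ?u = "(\<lambda>_. 0) :: nat \<Rightarrow> real" and ?v = "(\<lambda>_. 0)(m := 1::real)"
    have uv: "?u \<in> cube k" "?v \<in> cube k" using zero_in_cube[of k] cube_upd[OF zero_in_cube[of k] m, of 1] by auto
    have "T ?u i = T ?v i" for i
    proof (cases "i \<in> free")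
      case True
      then have "?u (\<pi> i) = ?v (\<pi> i)" using n by auto
      then show ?thesis using \<pi>(2)[OF True] uv by metis
    next
      case False
      then show ?thesis
      proof (cases "i \<in> I")
        case True then show ?thesis using T_fixed uv by metis
      next
        case False
        then have "i \<ge> l" using \<open>i \<notin> free\<close> by auto
        then show ?thesis using T_cube[OF uv(1)] T_cube[OF uv(2)] by (auto simp: cube_def)
      qed
    qed
    then have "?u = ?v" using inj uv by (metis ext inj_onD)
    from fun_cong[OF this, of m] show False by simp
  qed
  then show "\<pi> ` free = {..<k}" using \<pi>(1) by auto
qed

lemma \<pi>_surj: "m < k \<Longrightarrow> \<exists>i\<in>free. \<pi> i = m"
  using bij_betw_imp_surj_on[OF bij_\<pi>] by (metis imageE lessThan_iff)

lemma dim_eq: "l = k + card I"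
proof -
  have "card free = k" using bij_betw_same_card[OF bij_\<pi>] by simp
  moreover have "card free = l - card I" using I by (simp add: card_Diff_subset finite_subset)
  moreover have "card I \<le> l" using card_mono[OF _ I(1)] by simp
  ultimately show ?thesis by simp
qed

text \<open>Only the coordinate assigned to the variable \<open>m\<close> by \<open>\<pi>\<close>
  reacts to a change of it. So interpolation in \<open>m\<close> becomes interpolation in one
  coordinate, with the two ends exchanged if that coordinate is reflected.\<close>

lemma T_upd:
  assumes u: "u \<in> cube k" and m: "m < k"
  shows "\<exists>i\<in>free. (T u i = u m \<and> (\<forall>t. 0 \<le> t \<and> t \<le> 1 \<longrightarrow> T (u(m := t)) = (T u)(i := t))) \<or>
     (T u i = 1 - u m \<and> (\<forall>t. 0 \<le> t \<and> t \<le> 1 \<longrightarrow> T (u(m := t)) = (T u)(i := 1 - t)))"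
proof -
  obtain i where i: "i \<in> free" "\<pi> i = m" using \<pi>_surj[OF m] by blast
  have other: "T (u(m := t)) j = T u j" if t: "0 \<le> t" "t \<le> 1" and j: "j \<noteq> i" for t j
  proof (cases "j \<in> free")
    case True
    have "\<pi> j \<noteq> m" using i True j bij_\<pi> unfolding bij_betw_def inj_on_def by blast
    then show ?thesis using \<pi>(2)[OF True] u cube_upd[OF u m t] by (metis fun_upd_other)
  next
    case False
    show ?thesis
    proof (cases "j \<in> I")
      case True then show ?thesis using T_fixed u cube_upd[OF u m t] by metis
    next
      case False
      then have "j \<ge> l" using \<open>j \<notin> free\<close> by auto
      then show ?thesis using T_cube[OF u] T_cube[OF cube_upd[OF u m t]] by (auto simp: cube_def)
    qed
  qed
  show ?thesis
  proof (rule bexI[OF _ i(1)])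
    from \<pi>(2)[OF i(1)] show "(T u i = u m \<and> (\<forall>t. 0 \<le> t \<and> t \<le> 1 \<longrightarrow> T (u(m := t)) = (T u)(i := t))) \<or>
     (T u i = 1 - u m \<and> (\<forall>t. 0 \<le> t \<and> t \<le> 1 \<longrightarrow> T (u(m := t)) = (T u)(i := 1 - t)))"
    proof
      assume a: "\<forall>u\<in>cube k. T u i = u (\<pi> i)"
      have "T (u(m := t)) = (T u)(i := t)" if t: "0 \<le> t" "t \<le> 1" for t
        using other[OF t] a cube_upd[OF u m t] i(2) by (intro ext) auto
      then show ?thesis using a u i(2) by auto
    next
      assume a: "\<forall>u\<in>cube k. T u i = 1 - u (\<pi> i)"
      have "T (u(m := t)) = (T u)(i := 1 - t)" if t: "0 \<le> t" "t \<le> 1" for t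
        using other[OF t] a cube_upd[OF u m t] i(2) by (intro ext) auto
      then show ?thesis using a u i(2) by auto
    qed
  qed
qed

lemma sep_affine_comp:
  assumes h: "sep_affine l h"
  shows "sep_affine k (h \<circ> T)"
  unfolding sep_affine_def
proof (intro ballI allI impI)
  fix u m assume u: "u \<in> cube k" and m: "m < k"
  obtain i where i: "i \<in> free" and
    c: "(T u i = u m \<and> (\<forall>t. 0 \<le> t \<and> t \<le> 1 \<longrightarrow> T (u(m := t)) = (T u)(i := t))) \<or>
     (T u i = 1 - u m \<and> (\<forall>t. 0 \<le> t \<and> t \<le> 1 \<longrightarrow> T (u(m := t)) = (T u)(i := 1 - t)))"
    using T_upd[OF u m] by blast
  have e: "h (T u) = (1 - T u i) * h ((T u)(i := 0)) + T u i * h ((T u)(i := 1))"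
    using h T_cube[OF u] i unfolding sep_affine_def by blast
  from c show "(h \<circ> T) u = (1 - u m) * (h \<circ> T) (u(m := 0)) + u m * (h \<circ> T) (u(m := 1))"
    using e by (elim disjE conjE) (simp_all add: algebra_simps)
qed

text \<open>The condition on each coordinate is symmetric under \<open>t\<close> to
  \<open>1 - t\<close>, so the reflections do no harm.\<close>

lemma interior_iff:
  assumes u: "u \<in> cube k"
  shows "u \<in> open_cube k \<longleftrightarrow> (\<forall>i\<in>free. 0 < T u i \<and> T u i < 1)"
proof
  assume "u \<in> open_cube k"
  then have "0 < u (\<pi> i) \<and> u (\<pi> i) < 1" if "i \<in> free" for i
    using \<pi>(1)[OF that] by (auto simp: open_cube_def)
  then have "0 < T u i \<and> T u i < 1" if "i \<in> free" for i
    using T_coordinate[OF that u] that by force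
  then show "\<forall>i\<in>free. 0 < T u i \<and> T u i < 1" by blast
next
  assume a: "\<forall>i\<in>free. 0 < T u i \<and> T u i < 1"
  have "0 < u m \<and> u m < 1" if m: "m < k" for m
  proof -
    obtain i where i: "i \<in> free" "\<pi> i = m" using \<pi>_surj[OF m] by blast
    have "T u i = u m \<or> T u i = 1 - u m" using T_coordinate[OF i(1) u] i(2) by simp
    then show ?thesis using bspec[OF a i(1)] by auto
  qed
  then show "u \<in> open_cube k" using u by (auto simp: open_cube_def cube_def)
qed

text \<open>By the same symmetry the margin of a cell is the margin of the face it occupies in a
  larger cell, so a core is the same set seen from either.\<close>

lemma mid_iff:
  assumes u: "u \<in> cube k"
  shows "u \<in> mid_cube k \<epsilon> \<longleftrightarrow> (\<forall>i\<in>free. \<epsilon> \<le> T u i \<and> T u i \<le> 1 - \<epsilon>)"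
proof
  assume "u \<in> mid_cube k \<epsilon>"
  then have "\<epsilon> \<le> u (\<pi> i) \<and> u (\<pi> i) \<le> 1 - \<epsilon>" if "i \<in> free" for i
    using \<pi>(1)[OF that] by (auto simp: mid_cube_def)
  then have "\<epsilon> \<le> T u i \<and> T u i \<le> 1 - \<epsilon>" if "i \<in> free" for i
    using T_coordinate[OF that u] that by force
  then show "\<forall>i\<in>free. \<epsilon> \<le> T u i \<and> T u i \<le> 1 - \<epsilon>" by blast
next
  assume a: "\<forall>i\<in>free. \<epsilon> \<le> T u i \<and> T u i \<le> 1 - \<epsilon>"
  have "\<epsilon> \<le> u m \<and> u m \<le> 1 - \<epsilon>" if m: "m < k" for m
  proof -
    obtain i where i: "i \<in> free" "\<pi> i = m" using \<pi>_surj[OF m] by blast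
    have "T u i = u m \<or> T u i = 1 - u m" using T_coordinate[OF i(1) u] i(2) by simp
    then show ?thesis using bspec[OF a i(1)] by auto
  qed
  then show "u \<in> mid_cube k \<epsilon>" using u by (auto simp: mid_cube_def cube_def)
qed

end


section \<open>Quadrangulations\<close>

definition face_set :: "nat \<Rightarrow> nat set \<Rightarrow> (nat \<Rightarrow> real) \<Rightarrow> (nat \<Rightarrow> real) set" where
  "face_set l I e = {x \<in> cube l. \<forall>i\<in>I. x i = e i}"

lemma cube_faces_eq: "F \<in> cube_faces l \<longleftrightarrow> (\<exists>I e. I \<subseteq> {..<l} \<and> (\<forall>i\<in>I. e i = 0 \<or> e i = 1) \<and> F = face_set l I e)"
  unfolding cube_faces_def face_set_def by blast

locale quad =
  fixes d :: nat and M :: "'a::euclidean_space set" and Q :: "'a cell_system"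
  assumes quad: "quadrangulation d M Q"
begin

abbreviation "coord \<sigma> \<equiv> inv_into (cube (cdim Q \<sigma>)) (chart Q \<sigma>)"

lemmas quadD = quad[unfolded quadrangulation_def]

lemma finite_cells: "finite (cells Q)"
  using quadD by (elim conjE)

lemma cdim_le: "\<sigma> \<in> cells Q \<Longrightarrow> cdim Q \<sigma> \<le> d"
  using quadD[THEN conjunct2, THEN conjunct1] by blast

lemma face_cell: "\<sigma> \<in> cells Q \<Longrightarrow> faces Q \<sigma> \<subseteq> cells Q"
  using quadD[THEN conjunct2, THEN conjunct2, THEN conjunct1] by blast

lemma inter_cell:
  "\<sigma> \<in> cells Q \<Longrightarrow> \<tau> \<in> cells Q \<Longrightarrow> \<sigma> \<inter> \<tau> \<noteq> {} \<Longrightarrow> \<sigma> \<inter> \<tau> \<in> faces Q \<sigma> \<and> \<sigma> \<inter> \<tau> \<in> faces Q \<tau>"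
  using quadD[THEN conjunct2, THEN conjunct2, THEN conjunct2, THEN conjunct1] by blast

lemma cover: "\<Union>(cells Q) = M"
  using quadD by (elim conjE)

lemma transition_affine:
  "\<sigma> \<in> cells Q \<Longrightarrow> \<tau> \<in> cells Q \<Longrightarrow> \<tau> \<subseteq> \<sigma> \<Longrightarrow> i < cdim Q \<sigma> \<Longrightarrow>
     \<exists>a b. \<forall>u\<in>cube (cdim Q \<tau>). coord \<sigma> (chart Q \<tau> u) i = b + (\<Sum>m<cdim Q \<tau>. a m * u m)"
  using quadD[THEN conjunct2, THEN conjunct2, THEN conjunct2, THEN conjunct2, THEN conjunct2] by blast

text \<open>The definition provides some inverse of the chart; on the cell it coincides with
  \<open>inv_into\<close>, the inverse that the clause on transition maps speaks about.\<close>

lemma chart_homeomorphism: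
  assumes "\<sigma> \<in> cells Q"
  shows "homeomorphism (cube (cdim Q \<sigma>)) \<sigma> (chart Q \<sigma>) (coord \<sigma>)"
proof -
  obtain \<psi> where h: "homeomorphism (cube (cdim Q \<sigma>)) \<sigma> (chart Q \<sigma>) \<psi>"
    using quadD[THEN conjunct2, THEN conjunct1] assms by blast
  have inj: "inj_on (chart Q \<sigma>) (cube (cdim Q \<sigma>))"
    by (rule inj_on_inverseI[of _ \<psi>]) (rule homeomorphism_apply1[OF h])
  have e: "coord \<sigma> x = \<psi> x" if x: "x \<in> \<sigma>" for x
  proof -
    have "\<psi> x \<in> cube (cdim Q \<sigma>)" using homeomorphism_image2[OF h] x by (metis imageI)
    then have "coord \<sigma> (chart Q \<sigma> (\<psi> x)) = \<psi> x" by (rule inv_into_f_f[OF inj])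
    then show ?thesis using homeomorphism_apply2[OF h x] by simp
  qed
  show ?thesis
    using h e continuous_on_cong[of \<sigma> \<sigma> "coord \<sigma>" \<psi>] image_cong[of \<sigma> \<sigma> "coord \<sigma>" \<psi>]
      inv_into_f_f[OF inj]
    unfolding homeomorphism_def by simp
qed

lemma chart_image: "\<sigma> \<in> cells Q \<Longrightarrow> chart Q \<sigma> ` cube (cdim Q \<sigma>) = \<sigma>"
  and coord_image: "\<sigma> \<in> cells Q \<Longrightarrow> coord \<sigma> ` \<sigma> = cube (cdim Q \<sigma>)"
  and coord_chart: "\<sigma> \<in> cells Q \<Longrightarrow> u \<in> cube (cdim Q \<sigma>) \<Longrightarrow> coord \<sigma> (chart Q \<sigma> u) = u"
  and chart_coord: "\<sigma> \<in> cells Q \<Longrightarrow> x \<in> \<sigma> \<Longrightarrow> chart Q \<sigma> (coord \<sigma> x) = x"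
  and continuous_chart: "\<sigma> \<in> cells Q \<Longrightarrow> continuous_on (cube (cdim Q \<sigma>)) (chart Q \<sigma>)"
  and continuous_coord: "\<sigma> \<in> cells Q \<Longrightarrow> continuous_on \<sigma> (coord \<sigma>)"
  using chart_homeomorphism unfolding homeomorphism_def by blast+

lemma chart_in: "\<sigma> \<in> cells Q \<Longrightarrow> u \<in> cube (cdim Q \<sigma>) \<Longrightarrow> chart Q \<sigma> u \<in> \<sigma>"
  using chart_image by blast

lemma coord_in: "\<sigma> \<in> cells Q \<Longrightarrow> x \<in> \<sigma> \<Longrightarrow> coord \<sigma> x \<in> cube (cdim Q \<sigma>)"
  using coord_image by blast

lemma chart_inj: "\<sigma> \<in> cells Q \<Longrightarrow> inj_on (chart Q \<sigma>) (cube (cdim Q \<sigma>))"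
  by (rule inj_on_inverseI[of _ "coord \<sigma>"]) (rule coord_chart)

lemma cell_compact: "\<sigma> \<in> cells Q \<Longrightarrow> compact \<sigma>"
  using compact_continuous_image[OF continuous_chart compact_cube] chart_image by metis

lemma cell_closed: "\<sigma> \<in> cells Q \<Longrightarrow> closed \<sigma>"
  using cell_compact compact_imp_closed by blast

lemma cell_nonempty: "\<sigma> \<in> cells Q \<Longrightarrow> \<sigma> \<noteq> {}"
  using chart_in[of \<sigma> "\<lambda>_. 0"] by (auto simp: cube_def)

lemma compact_M: "compact M"
  unfolding cover[symmetric] using finite_cells cell_compact by (intro compact_Union) auto

lemma faces_iff: "F \<in> faces Q \<sigma> \<longleftrightarrow> (\<exists>I e. I \<subseteq> {..<cdim Q \<sigma>} \<and> (\<forall>i\<in>I. e i = 0 \<or> e i = 1) \<and>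
    F = chart Q \<sigma> ` face_set (cdim Q \<sigma>) I e)"
  unfolding faces_def image_iff Bex_def cube_faces_eq by blast

lemma face_is_cell:
  assumes "\<sigma> \<in> cells Q" "I \<subseteq> {..<cdim Q \<sigma>}" "\<And>i. i \<in> I \<Longrightarrow> e i = 0 \<or> e i = 1"
  shows "chart Q \<sigma> ` face_set (cdim Q \<sigma>) I e \<in> cells Q"
proof -
  have "face_set (cdim Q \<sigma>) I e \<in> cube_faces (cdim Q \<sigma>)"
    unfolding cube_faces_eq using assms by blast
  then show ?thesis using face_cell[OF assms(1)] unfolding faces_def by blast
qed

lemma face_map_transition:
  assumes "\<sigma> \<in> cells Q" "\<tau> \<in> cells Q" and I: "I \<subseteq> {..<cdim Q \<sigma>}" "\<And>i. i \<in> I \<Longrightarrow> e i = 0 \<or> e i = 1"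
    and t: "\<tau> = chart Q \<sigma> ` face_set (cdim Q \<sigma>) I e"
  shows "face_map (cdim Q \<tau>) (cdim Q \<sigma>) (coord \<sigma> \<circ> chart Q \<tau>) I e"
proof
  have sub: "\<tau> \<subseteq> \<sigma>" unfolding t using chart_image[OF assms(1)] by (auto simp: face_set_def)
  show "\<exists>a b. \<forall>u\<in>cube (cdim Q \<tau>). (coord \<sigma> \<circ> chart Q \<tau>) u i = b + (\<Sum>m<cdim Q \<tau>. a m * u m)"
    if "i < cdim Q \<sigma>" for i
    using transition_affine[OF assms(1,2) sub that] by simp
  show "inj_on (coord \<sigma> \<circ> chart Q \<tau>) (cube (cdim Q \<tau>))"
  proof (rule comp_inj_on[OF chart_inj[OF assms(2)]])
    show "inj_on (coord \<sigma>) (chart Q \<tau> ` cube (cdim Q \<tau>))"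
      unfolding chart_image[OF assms(2)]
      by (rule inj_on_inverseI[of _ "chart Q \<sigma>"]) (use sub chart_coord[OF assms(1)] in blast)
  qed
  have "(coord \<sigma> \<circ> chart Q \<tau>) ` cube (cdim Q \<tau>) = coord \<sigma> ` \<tau>"
    unfolding image_comp[symmetric] chart_image[OF assms(2)] ..
  also have "\<dots> = (\<lambda>u. coord \<sigma> (chart Q \<sigma> u)) ` face_set (cdim Q \<sigma>) I e"
    unfolding t image_image ..
  also have "\<dots> = (\<lambda>u. u) ` face_set (cdim Q \<sigma>) I e"
    by (rule image_cong) (auto simp: face_set_def coord_chart[OF assms(1)])
  finally show "(coord \<sigma> \<circ> chart Q \<tau>) ` cube (cdim Q \<tau>) = {x \<in> cube (cdim Q \<sigma>). \<forall>i\<in>I. x i = e i}"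
    by (simp add: face_set_def)
qed (use I in auto)

lemma subcell_is_face:
  assumes "\<sigma> \<in> cells Q" "\<tau> \<in> cells Q" "\<tau> \<subseteq> \<sigma>"
  obtains I e where "I \<subseteq> {..<cdim Q \<sigma>}" "\<And>i. i \<in> I \<Longrightarrow> e i = 0 \<or> e i = 1"
    "\<tau> = chart Q \<sigma> ` face_set (cdim Q \<sigma>) I e" "face_map (cdim Q \<tau>) (cdim Q \<sigma>) (coord \<sigma> \<circ> chart Q \<tau>) I e"
proof -
  have "\<sigma> \<inter> \<tau> = \<tau>" using assms by auto
  then have "\<tau> \<in> faces Q \<sigma>" using inter_cell[OF assms(1,2)] cell_nonempty[OF assms(2)] by simp
  then obtain I e where I: "I \<subseteq> {..<cdim Q \<sigma>}" "\<forall>i\<in>I. e i = 0 \<or> e i = 1"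
    "\<tau> = chart Q \<sigma> ` face_set (cdim Q \<sigma>) I e"
    unfolding faces_iff by (elim exE conjE)
  show ?thesis
    by (rule that[OF I(1) bspec[OF I(2)] I(3) face_map_transition[OF assms(1,2) I(1) bspec[OF I(2)] I(3)]])
qed

lemma subcell_same_dim:
  assumes "\<sigma> \<in> cells Q" "\<tau> \<in> cells Q" "\<tau> \<subseteq> \<sigma>" "cdim Q \<sigma> \<le> cdim Q \<tau>"
  shows "\<tau> = \<sigma>"
proof -
  obtain I e where I: "I \<subseteq> {..<cdim Q \<sigma>}" "\<tau> = chart Q \<sigma> ` face_set (cdim Q \<sigma>) I e"
     "face_map (cdim Q \<tau>) (cdim Q \<sigma>) (coord \<sigma> \<circ> chart Q \<tau>) I e"
    using subcell_is_face[OF assms(1-3)] by metis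
  have "card I = 0" using face_map.dim_eq[OF I(3)] assms(4) by simp
  moreover have "finite I" using I(1) finite_subset by auto
  ultimately have "I = {}" by simp
  then show ?thesis using I(2) chart_image[OF assms(1)] by (simp add: face_set_def)
qed

lemma rel_interior_subset: "\<sigma> \<in> cells Q \<Longrightarrow> rel_interior_cell Q \<sigma> \<subseteq> \<sigma>"
  unfolding rel_interior_cell_def using chart_image open_cube_subset by blast

lemma coord_rel_interior:
  assumes "\<sigma> \<in> cells Q"
  shows "x \<in> rel_interior_cell Q \<sigma> \<longleftrightarrow> x \<in> \<sigma> \<and> coord \<sigma> x \<in> open_cube (cdim Q \<sigma>)"
proof
  assume "x \<in> rel_interior_cell Q \<sigma>"
  then obtain u where u: "u \<in> open_cube (cdim Q \<sigma>)" "x = chart Q \<sigma> u"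
    unfolding rel_interior_cell_def by blast
  then have "u \<in> cube (cdim Q \<sigma>)" using open_cube_subset by blast
  then show "x \<in> \<sigma> \<and> coord \<sigma> x \<in> open_cube (cdim Q \<sigma>)"
    using u coord_chart[OF assms] chart_in[OF assms] by simp
next
  assume "x \<in> \<sigma> \<and> coord \<sigma> x \<in> open_cube (cdim Q \<sigma>)"
  then show "x \<in> rel_interior_cell Q \<sigma>"
    unfolding rel_interior_cell_def using chart_coord[OF assms] by (metis imageI)
qed

text \<open>Freezing exactly those coordinates of the point that equal 0 or 1 gives the smallest
  face through it. The strict drop in dimension is recorded because it later confines a preimage on
  the boundary of a \<open>d\<close>-cell to dimension \<open>d - 1\<close>.\<close>

lemma in_some_rel_interior:
  assumes \<sigma>: "\<sigma> \<in> cells Q" and x: "x \<in> \<sigma>"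
  obtains \<tau> where "\<tau> \<in> cells Q" "\<tau> \<subseteq> \<sigma>" "x \<in> rel_interior_cell Q \<tau>"
    "coord \<sigma> x \<in> open_cube (cdim Q \<sigma>) \<Longrightarrow> \<tau> = \<sigma>" "coord \<sigma> x \<notin> open_cube (cdim Q \<sigma>) \<Longrightarrow> cdim Q \<tau> < cdim Q \<sigma>"
proof -
  let ?u = "coord \<sigma> x" and ?l = "cdim Q \<sigma>"
  have u: "?u \<in> cube ?l" by (rule coord_in[OF \<sigma> x])
  define I where "I = {i. i < ?l \<and> (?u i = 0 \<or> ?u i = 1)}"
  have I: "I \<subseteq> {..<?l}" "\<And>i. i \<in> I \<Longrightarrow> ?u i = 0 \<or> ?u i = 1" by (auto simp: I_def)
  define \<tau> where "\<tau> = chart Q \<sigma> ` face_set ?l I ?u"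
  have \<tau>: "\<tau> \<in> cells Q" unfolding \<tau>_def by (rule face_is_cell[OF \<sigma> I])
  interpret face_map "cdim Q \<tau>" ?l "coord \<sigma> \<circ> chart Q \<tau>" I ?u
    by (rule face_map_transition[OF \<sigma> \<tau> I \<tau>_def])
  have sub: "\<tau> \<subseteq> \<sigma>" unfolding \<tau>_def using chart_image[OF \<sigma>] by (auto simp: face_set_def)
  have xt: "x \<in> \<tau>" unfolding \<tau>_def
    by (rule image_eqI[of _ _ ?u]) (use u chart_coord[OF \<sigma> x] in \<open>auto simp: face_set_def\<close>)
  have "0 < ?u i \<and> ?u i < 1" if "i \<in> {..<?l} - I" for i
  proof -
    have "0 \<le> ?u i \<and> ?u i \<le> 1" using u that by (simp add: cube_def)
    moreover have "?u i \<noteq> 0" "?u i \<noteq> 1" using that by (auto simp: I_def)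
    ultimately show ?thesis by linarith
  qed
  then have "coord \<tau> x \<in> open_cube (cdim Q \<tau>)"
    using interior_iff[OF coord_in[OF \<tau> xt]] chart_coord[OF \<tau> xt] by simp
  then have ri: "x \<in> rel_interior_cell Q \<tau>" using coord_rel_interior[OF \<tau>] xt by blast
  show ?thesis
  proof (rule that[OF \<tau> sub ri])
    assume "?u \<in> open_cube ?l"
    then have "I = {}" by (force simp: I_def open_cube_def)
    then show "\<tau> = \<sigma>" unfolding \<tau>_def using chart_image[OF \<sigma>] by (simp add: face_set_def)
  next
    assume "?u \<notin> open_cube ?l"
    then have "I \<noteq> {}" using u unfolding I_def open_cube_eq cube_boundary_def by blast
    then have "card I > 0" using I(1) finite_subset by (auto simp: card_gt_0_iff)
    then show "cdim Q \<tau> < ?l" using dim_eq by simp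
  qed
qed

text \<open>The intersection is a face of \<open>\<tau>\<close> containing a point with no
  coordinate 0 or 1, so no coordinate is frozen and the face is all of
  \<open>\<tau>\<close>.\<close>

lemma rel_interior_minimal:
  assumes \<tau>: "\<tau> \<in> cells Q" and \<sigma>: "\<sigma> \<in> cells Q" and x: "x \<in> rel_interior_cell Q \<tau>" "x \<in> \<sigma>"
  shows "\<tau> \<subseteq> \<sigma>"
proof -
  have xt: "x \<in> \<tau>" "coord \<tau> x \<in> open_cube (cdim Q \<tau>)" using coord_rel_interior[OF \<tau>] x(1) by auto
  then have "\<tau> \<inter> \<sigma> \<noteq> {}" using x by auto
  then have "\<tau> \<inter> \<sigma> \<in> faces Q \<tau>" using inter_cell[OF \<tau> \<sigma>] by blast
  then obtain I e where I: "I \<subseteq> {..<cdim Q \<tau>}" "\<forall>i\<in>I. e i = 0 \<or> e i = 1"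
    "\<tau> \<inter> \<sigma> = chart Q \<tau> ` face_set (cdim Q \<tau>) I e"
    unfolding faces_iff by (elim exE conjE)
  have "x \<in> chart Q \<tau> ` face_set (cdim Q \<tau>) I e" using I(3) xt x by auto
  then obtain v where v: "v \<in> face_set (cdim Q \<tau>) I e" "x = chart Q \<tau> v" by blast
  then have "v = coord \<tau> x" using coord_chart[OF \<tau>] by (simp add: face_set_def)
  then have "v \<in> open_cube (cdim Q \<tau>)" using xt(2) by simp
  then have "i \<notin> I" for i
    using v(1) I(1,2) by (cases "i < cdim Q \<tau>") (fastforce simp: face_set_def open_cube_def)+
  then have "I = {}" by blast
  then have "\<tau> \<inter> \<sigma> = \<tau>" using I(3) chart_image[OF \<tau>] by (simp add: face_set_def)
  then show ?thesis by blast
qed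

lemma rel_interior_unique:
  assumes "\<tau> \<in> cells Q" "\<sigma> \<in> cells Q" "x \<in> rel_interior_cell Q \<tau>" "x \<in> rel_interior_cell Q \<sigma>"
  shows "\<tau> = \<sigma>"
  using rel_interior_minimal assms rel_interior_subset by (metis subset_antisym subsetD)

lemma vertex_of_cell:
  assumes \<sigma>: "\<sigma> \<in> cells Q" and v: "v \<in> cube_vertices (cdim Q \<sigma>)"
  shows "chart Q \<sigma> v \<in> vertices Q"
proof -
  have "x = v" if "x \<in> face_set (cdim Q \<sigma>) {..<cdim Q \<sigma>} v" for x
  proof
    fix i show "x i = v i"
      using that v by (cases "i < cdim Q \<sigma>") (auto simp: face_set_def cube_def cube_vertices_def)
  qed
  moreover have "v \<in> face_set (cdim Q \<sigma>) {..<cdim Q \<sigma>} v"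
    using v cube_vertices_subset[of "cdim Q \<sigma>"] by (auto simp: face_set_def)
  ultimately have "face_set (cdim Q \<sigma>) {..<cdim Q \<sigma>} v = {v}" by blast
  then have "{chart Q \<sigma> v} \<in> cells Q"
    using face_is_cell[OF \<sigma>, of "{..<cdim Q \<sigma>}" v] v by (simp add: cube_vertices_def)
  then show ?thesis by (simp add: vertices_def)
qed

text \<open>This gives the choice in \<open>f_L\<close> a meaning. Each cell has its own
  interpolant. On a face, the interpolants of the cell and of the face are both separately affine in
  the coordinates of the face and agree at its vertices, so they coincide; two cells that meet do so
  in a common face.\<close>

lemma multilinear_extension_exists:
  assumes L: "\<forall>v\<in>vertices Q. L v \<in> cube_vertices d"
  shows "\<exists>f. multilinear_extension d Q L f"
proof -
  define P where "P \<sigma> i = (SOME a. \<forall>v\<in>cube_vertices (cdim Q \<sigma>). mono_sum (cdim Q \<sigma>) a v = L (chart Q \<sigma> v) i)"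
    for \<sigma> and i :: nat
  have P: "mono_sum (cdim Q \<sigma>) (P \<sigma> i) v = L (chart Q \<sigma> v) i" if "v \<in> cube_vertices (cdim Q \<sigma>)" for \<sigma> i v
    using someI_ex[OF mono_sum_interpolation[of "cdim Q \<sigma>" "\<lambda>v. L (chart Q \<sigma> v) i"]] that
    unfolding P_def by blast
  define g where "g \<sigma> x i = mono_sum (cdim Q \<sigma>) (P \<sigma> i) (coord \<sigma> x)" for \<sigma> x and i :: nat
  have face: "g \<tau> x i = g \<sigma> x i" if c: "\<sigma> \<in> cells Q" "\<tau> \<in> cells Q" "\<tau> \<subseteq> \<sigma>" "x \<in> \<tau>" for \<sigma> \<tau> x i
  proof -
    obtain I e where "face_map (cdim Q \<tau>) (cdim Q \<sigma>) (coord \<sigma> \<circ> chart Q \<tau>) I e"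
      using subcell_is_face[OF c(1-3)] by metis
    then interpret face_map "cdim Q \<tau>" "cdim Q \<sigma>" "coord \<sigma> \<circ> chart Q \<tau>" I e .
    have "mono_sum (cdim Q \<tau>) (P \<tau> i) (coord \<tau> x) = (mono_sum (cdim Q \<sigma>) (P \<sigma> i) \<circ> (coord \<sigma> \<circ> chart Q \<tau>)) (coord \<tau> x)"
    proof (rule sep_affine_eqI[OF sep_affine_mono_sum sep_affine_comp[OF sep_affine_mono_sum] _ coord_in[OF c(2,4)]])
      fix v assume v: "v \<in> cube_vertices (cdim Q \<tau>)"
      then have "chart Q \<tau> v \<in> \<sigma>" using chart_in[OF c(2)] cube_vertices_subset c(3) by blast
      then have "L (chart Q \<sigma> ((coord \<sigma> \<circ> chart Q \<tau>) v)) i = L (chart Q \<tau> v) i"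
        using chart_coord[OF c(1)] by simp
      then show "mono_sum (cdim Q \<tau>) (P \<tau> i) v = (mono_sum (cdim Q \<sigma>) (P \<sigma> i) \<circ> (coord \<sigma> \<circ> chart Q \<tau>)) v"
        using P[OF v] P[OF T_vertex[OF v]] by simp
    qed
    then show ?thesis using chart_coord[OF c(2,4)] by (simp add: g_def)
  qed
  have glue: "g \<tau> x i = g \<sigma> x i" if c: "\<sigma> \<in> cells Q" "\<tau> \<in> cells Q" "x \<in> \<tau>" "x \<in> \<sigma>" for \<sigma> \<tau> x i
  proof -
    have "\<sigma> \<inter> \<tau> \<in> cells Q" using inter_cell[OF c(1,2)] face_cell[OF c(1)] c by blast
    then show ?thesis
      using face[OF c(1), of "\<sigma> \<inter> \<tau>" x i] face[OF c(2), of "\<sigma> \<inter> \<tau>" x i] c by auto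
  qed
  \<comment> \<open>The value 0 from index \<open>d\<close> on agrees with the labels, which are
    vertices of the \<open>d\<close>-cube and vanish there.\<close>
  define f where "f x i = (if i < d then g (SOME \<sigma>. \<sigma> \<in> cells Q \<and> x \<in> \<sigma>) x i else 0)" for x i
  have f: "f (chart Q \<sigma> u) i = (if i < d then mono_sum (cdim Q \<sigma>) (P \<sigma> i) u else 0)"
    if c: "\<sigma> \<in> cells Q" "u \<in> cube (cdim Q \<sigma>)" for \<sigma> u i
  proof -
    let ?x = "chart Q \<sigma> u"
    have "?x \<in> \<sigma>" by (rule chart_in[OF c])
    then have "(SOME \<tau>. \<tau> \<in> cells Q \<and> ?x \<in> \<tau>) \<in> cells Q \<and> ?x \<in> (SOME \<tau>. \<tau> \<in> cells Q \<and> ?x \<in> \<tau>)"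
      using someI[of "\<lambda>\<tau>. \<tau> \<in> cells Q \<and> ?x \<in> \<tau>" \<sigma>] c by blast
    then have "g (SOME \<tau>. \<tau> \<in> cells Q \<and> ?x \<in> \<tau>) ?x i = g \<sigma> ?x i"
      using glue c \<open>?x \<in> \<sigma>\<close> by blast
    then show ?thesis using coord_chart[OF c] by (simp add: f_def g_def)
  qed
  have fL: "f (chart Q \<sigma> v) = L (chart Q \<sigma> v)" if c: "\<sigma> \<in> cells Q" "v \<in> cube_vertices (cdim Q \<sigma>)" for \<sigma> v
  proof
    fix i
    have "v \<in> cube (cdim Q \<sigma>)" using c(2) cube_vertices_subset by blast
    then show "f (chart Q \<sigma> v) i = L (chart Q \<sigma> v) i"
      using f[OF c(1), of v i] P[OF c(2), of i] bspec[OF L vertex_of_cell[OF c]]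
      by (auto simp: cube_vertices_def)
  qed
  have "multilinear (cdim Q \<sigma>) d (f \<circ> chart Q \<sigma>)" if c: "\<sigma> \<in> cells Q" for \<sigma>
    unfolding multilinear_iff using f[OF c] by auto
  then have "multilinear_extension d Q L f"
    unfolding multilinear_extension_def using fL by blast
  then show ?thesis by blast
qed

lemma multilinear_extension_f_L:
  assumes L: "\<forall>v\<in>vertices Q. L v \<in> cube_vertices d"
  shows "multilinear_extension d Q L (f_L d Q L)"
  unfolding f_L_def using multilinear_extension_exists[OF L] by (rule someI_ex)

lemma f_L_multilinear:
  assumes L: "\<forall>v\<in>vertices Q. L v \<in> cube_vertices d" and "\<sigma> \<in> cells Q"
  shows "multilinear (cdim Q \<sigma>) d (f_L d Q L \<circ> chart Q \<sigma>)"
  using multilinear_extension_f_L[OF L] assms(2) unfolding multilinear_extension_def by blast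

lemma continuous_f_L:
  assumes L: "\<forall>v\<in>vertices Q. L v \<in> cube_vertices d"
  shows "continuous_on M (f_L d Q L)"
proof -
  have "continuous_on \<sigma> (f_L d Q L)" if \<sigma>: "\<sigma> \<in> cells Q" for \<sigma>
  proof -
    have "continuous_on \<sigma> ((f_L d Q L \<circ> chart Q \<sigma>) \<circ> coord \<sigma>)"
      using multilinear_continuous[OF f_L_multilinear[OF L \<sigma>]]
      by (intro continuous_on_compose[OF continuous_coord[OF \<sigma>]]) (simp only: coord_image[OF \<sigma>])
    then show ?thesis
      by (rule continuous_on_eq) (simp add: chart_coord[OF \<sigma>])
  qed
  then have "continuous_on (\<Union>\<sigma>\<in>cells Q. \<sigma>) (f_L d Q L)"
    using finite_cells cell_closed by (intro continuous_on_closed_Union) auto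
  then show ?thesis using cover by simp
qed

lemma f_L_in_cube:
  assumes L: "\<forall>v\<in>vertices Q. L v \<in> cube_vertices d" and x: "x \<in> M"
  shows "f_L d Q L x \<in> cube d"
proof -
  obtain \<sigma> where \<sigma>: "\<sigma> \<in> cells Q" "x \<in> \<sigma>" using x cover by blast
  let ?g = "f_L d Q L \<circ> chart Q \<sigma>"
  have u: "coord \<sigma> x \<in> cube (cdim Q \<sigma>)" by (rule coord_in[OF \<sigma>])
  have gx: "?g (coord \<sigma> x) = f_L d Q L x" using chart_coord[OF \<sigma>] by simp
  note ml = f_L_multilinear[OF L \<sigma>(1)]
  have v: "?g v \<in> cube d" if "v \<in> cube_vertices (cdim Q \<sigma>)" for v
  proof -
    have "?g v = L (chart Q \<sigma> v)"
      using multilinear_extension_f_L[OF L] \<sigma>(1) that unfolding multilinear_extension_def by simp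
    then show ?thesis
      using bspec[OF L vertex_of_cell[OF \<sigma>(1) that]] cube_vertices_subset[of d] by auto
  qed
  have "0 \<le> ?g (coord \<sigma> x) i \<and> ?g (coord \<sigma> x) i \<le> 1" if i: "i < d" for i
    by (rule sep_affine_bounds[OF multilinear_sep_affine[OF ml, of i] _ u])
      (use v i in \<open>auto simp: cube_def\<close>)
  moreover have "?g (coord \<sigma> x) i = 0" if "i \<ge> d" for i
    using ml u that unfolding multilinear_iff by blast
  ultimately show ?thesis unfolding gx by (simp add: cube_def)
qed

end


section \<open>Boundary points of manifolds\<close>

abbreviation Eu :: "nat \<Rightarrow> (nat \<Rightarrow> real) set" where
  "Eu n \<equiv> {x. \<forall>i\<ge>n. x i = 0}"

lemma Euclidean_space_eq: "Euclidean_space n = top_of_set (Eu n)"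
  by (simp add: Euclidean_space_def euclidean_product_topology)

lemma cube_subset_Eu: "cube n \<subseteq> Eu n"
  by (auto simp: cube_def)

lemma Eu_invariance_of_domain:
  assumes "openin (top_of_set (Eu n)) U" "continuous_on U f" "f ` U \<subseteq> Eu n" "inj_on f U"
  shows "openin (top_of_set (Eu n)) (f ` U)"
proof -
  have "U \<subseteq> Eu n" using openin_imp_subset[OF assms(1)] .
  then have "subtopology (Euclidean_space n) U = top_of_set U"
    by (simp add: Euclidean_space_eq subtopology_subtopology Int_absorb1)
  then have "continuous_map (subtopology (Euclidean_space n) U) (Euclidean_space n) f"
    using assms(2,3) by (auto simp: Euclidean_space_eq continuous_map_in_subtopology)
  then show ?thesis
    using invariance_of_domain_Euclidean_space[of n U f] assms(1,4) by (simp add: Euclidean_space_eq)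
qed

lemma openin_Eu_open_cube: "openin (top_of_set (Eu n)) (open_cube n)"
proof -
  let ?O = "\<Inter>i<n. {x::nat \<Rightarrow> real. 0 < x i} \<inter> {x. x i < 1}"
  have "open ?O" by (intro open_INT ballI open_Int open_coord_less) auto
  moreover have "open_cube n = Eu n \<inter> ?O" by (auto simp: open_cube_def)
  ultimately show ?thesis using openin_open_Int[of ?O "Eu n"] by simp
qed

lemma openin_Eu_subset_cube:
  assumes A: "openin (top_of_set (Eu n)) A" and "A \<subseteq> cube n"
  shows "A \<inter> cube_boundary n = {}"
proof (rule ccontr)
  assume "A \<inter> cube_boundary n \<noteq> {}"
  then obtain v j where v: "v \<in> A" "j < n" "v j = 0 \<or> v j = 1" by (auto simp: cube_boundary_def)
  \<comment> \<open>The factor \<open>2 * v j - 1\<close> is -1 or 1 and points out of the cube;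
    openness would allow a short step in this direction.\<close>
  define f where "f t = v(j := v j + (2 * v j - 1) * t)" for t :: real
  have vE: "v \<in> Eu n" using v(1) A openin_imp_subset by blast
  have cf: "continuous_on {0..1} f"
  proof (rule continuous_on_coordinatewise_then_product)
    fix i show "continuous_on {0..1} (\<lambda>t. f t i)"
      unfolding f_def by (cases "i = j") (auto intro!: continuous_intros)
  qed
  have "f \<in> {0..1} \<rightarrow> Eu n" using vE v(2) by (auto simp: f_def)
  then have "openin (top_of_set {0..1}) ({0..1} \<inter> f -` A)"
    using continuous_openin_preimage[OF cf _ A] by blast
  moreover have "0 \<in> {0..1::real} \<inter> f -` A" using v(1) by (simp add: f_def)
  ultimately obtain e where e: "e > 0" "\<And>t. t \<in> {0..1} \<Longrightarrow> dist t 0 < e \<Longrightarrow> f t \<in> A"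
    unfolding openin_euclidean_subtopology_iff by blast
  define t where "t = min (e/2) 1"
  have t: "0 < t" "t \<le> 1" "t < e" using e(1) by (auto simp: t_def min_def)
  then have "f t \<in> A" using e(2)[of t] by (simp add: dist_real_def)
  then have "f t \<in> cube n" using assms(2) by blast
  then have "0 \<le> f t j \<and> f t j \<le> 1" using v(2) by (simp add: cube_def)
  then show False using v(3) t by (auto simp: f_def)
qed

lemma simplex_affine_chart:
  fixes S :: "'a::euclidean_space set"
  assumes "int n simplex S"
  obtains z z' where "homeomorphism (affine hull S) (Eu n) z z'"
proof -
  have "aff_dim (affine hull S) = int n"
    using aff_dim_simplex[OF assms] by simp
  then have "top_of_set (affine hull S) homeomorphic_space Euclidean_space n"
    using homeomorphic_affine_Euclidean_space[of "affine hull S" n] affine_affine_hull by blast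
  then show ?thesis
    using that unfolding Euclidean_space_eq homeomorphic_space_iff_homeomorphic homeomorphic_def by blast
qed

lemma homeomorphism_inverse_image:
  assumes "homeomorphism A C f g" "T \<subseteq> A"
  shows "g ` f ` T = T"
proof -
  have "(\<lambda>x. g (f x)) ` T = (\<lambda>x. x) ` T"
    by (rule image_cong) (use homeomorphism_apply1[OF assms(1)] assms(2) in auto)
  then show ?thesis by (simp add: image_image)
qed

lemma pl_ball_nbhdE:
  assumes "pl_ball_nbhd d M x N S h"
  obtains U h' where "N \<subseteq> M" "openin (top_of_set M) U" "x \<in> U" "U \<subseteq> N" "int d simplex S" "homeomorphism N S h h'"
  using assms unfolding pl_ball_nbhd_def by metis

text \<open>Invariance of domain in the affine hull of \<open>S\<close>: the chart \<open>h\<close>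
  maps a piece of \<open>\<theta>\<close> around \<open>x\<close> onto a set open in the hull, which
  therefore lies in the relative interior of \<open>S\<close>. Since
  \<open>manifold_boundary\<close> asks for some chart with \<open>x\<close> on the frontier, it is
  essential that the chart is arbitrary here.\<close>

lemma chart_interior:
  fixes M :: "'a::euclidean_space set"
  assumes pl: "pl_ball_nbhd d M x N S h"
    and G: "openin (top_of_set (Eu d)) G" "continuous_on G \<theta>" "inj_on \<theta> G" "\<theta> ` G \<subseteq> M" and x: "x \<in> \<theta> ` G"
  shows "h x \<in> rel_interior S \<and> (\<exists>W. openin (top_of_set M) W \<and> x \<in> W \<and> W \<subseteq> \<theta> ` G)"
proof -
  obtain U h' where U: "N \<subseteq> M" "openin (top_of_set M) U" "x \<in> U" "U \<subseteq> N" and S: "int d simplex S"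
    and h: "homeomorphism N S h h'"
    using pl by (rule pl_ball_nbhdE)
  obtain z z' where z: "homeomorphism (affine hull S) (Eu d) z z'" using simplex_affine_chart[OF S] .
  \<comment> \<open>Shrinking to \<open>U\<close> puts the image inside the domain of the chart, and
    openness can then be passed from \<open>N\<close> through \<open>U\<close> to
    \<open>M\<close>.\<close>
  define G' where "G' = G \<inter> \<theta> -` U"
  have "openin (top_of_set G) G'"
    unfolding G'_def by (rule continuous_openin_preimage[OF G(2) _ U(2)]) (use G(4) in auto)
  then have G'o: "openin (top_of_set (Eu d)) G'" using G(1) openin_trans by blast
  have G'G: "G' \<subseteq> G" and tG'U: "\<theta> ` G' \<subseteq> U" and xW: "x \<in> \<theta> ` G'" using x U(3) by (auto simp: G'_def)
  have tN: "\<theta> ` G' \<subseteq> N" using tG'U U(4) by blast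
  let ?A = "h ` \<theta> ` G'"
  have AS: "?A \<subseteq> S" using tN homeomorphism_image1[OF h] by blast
  have Aaff: "?A \<subseteq> affine hull S" by (rule subset_trans[OF AS hull_subset])
  have ct: "continuous_on G' \<theta>" by (rule continuous_on_subset[OF G(2) G'G])
  have ch: "continuous_on (\<theta> ` G') h" by (rule continuous_on_subset[OF homeomorphism_cont1[OF h] tN])
  have cz: "continuous_on ?A z" by (rule continuous_on_subset[OF homeomorphism_cont1[OF z] Aaff])
  have hinj: "inj_on h N" by (rule inj_on_inverseI[of _ h']) (rule homeomorphism_apply1[OF h])
  have zinj: "inj_on z (affine hull S)" by (rule inj_on_inverseI[of _ z']) (rule homeomorphism_apply1[OF z])
  have "openin (top_of_set (Eu d)) ((z \<circ> (h \<circ> \<theta>)) ` G')"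
  proof (rule Eu_invariance_of_domain[OF G'o])
    show "continuous_on G' (z \<circ> (h \<circ> \<theta>))"
      using ct ch cz by (intro continuous_on_compose) (simp_all add: image_comp)
    show "(z \<circ> (h \<circ> \<theta>)) ` G' \<subseteq> Eu d"
      unfolding image_comp[symmetric] using image_mono[OF Aaff, of z] homeomorphism_image1[OF z] by simp
    show "inj_on (z \<circ> (h \<circ> \<theta>)) G'"
    proof (intro comp_inj_on)
      show "inj_on \<theta> G'" by (rule inj_on_subset[OF G(3) G'G])
      show "inj_on h (\<theta> ` G')" by (rule inj_on_subset[OF hinj tN])
      show "inj_on z ((h \<circ> \<theta>) ` G')" unfolding image_comp[symmetric] by (rule inj_on_subset[OF zinj Aaff])
    qed
  qed
  then have "openin (top_of_set (affine hull S)) (z' ` (z \<circ> (h \<circ> \<theta>)) ` G')"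
    by (rule homeomorphism_imp_open_map[OF homeomorphism_symD[OF z]])
  moreover have "z' ` (z \<circ> (h \<circ> \<theta>)) ` G' = ?A"
    using homeomorphism_inverse_image[OF z Aaff] by (simp add: image_image)
  ultimately have Ao: "openin (top_of_set (affine hull S)) ?A" by simp
  have "?A \<subseteq> rel_interior S" by (rule rel_interior_maximal[OF AS Ao])
  then have 1: "h x \<in> rel_interior S" using xW by blast
  have "openin (top_of_set S) ?A"
    by (rule openin_subset_trans[OF Ao AS hull_subset])
  then have "openin (top_of_set N) (N \<inter> h -` ?A)"
    by (intro continuous_openin_preimage[OF homeomorphism_cont1[OF h]]) (use homeomorphism_image1[OF h] in auto)
  moreover have "N \<inter> h -` ?A = \<theta> ` G'"
    using tN inj_on_eq_iff[OF hinj] by blast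
  ultimately have "openin (top_of_set N) (\<theta> ` G')" by simp
  then have "openin (top_of_set U) (\<theta> ` G')"
    by (rule openin_subset_trans[OF _ tG'U U(4)])
  then have "openin (top_of_set M) (\<theta> ` G')" using U(2) openin_trans by blast
  then show ?thesis using 1 xW G'G by blast
qed

lemma chart_parametrization:
  fixes M :: "'a::euclidean_space set"
  assumes h: "homeomorphism N S h h'" and S: "int d simplex S" and U: "N \<subseteq> M" "U \<subseteq> N"
    and W: "openin (top_of_set M) W" "W \<subseteq> U" "h ` W \<subseteq> rel_interior S"
  shows "\<exists>G \<theta>. openin (top_of_set (Eu d)) G \<and> continuous_on G \<theta> \<and> inj_on \<theta> G \<and> \<theta> ` G = W"
proof -
  obtain z z' where z: "homeomorphism (affine hull S) (Eu d) z z'" using simplex_affine_chart[OF S] .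
  have WN: "W \<subseteq> N" using W U by blast
  have "openin (top_of_set N) W" by (rule openin_subset_trans[OF W(1) WN U(1)])
  then have "openin (top_of_set S) (h ` W)" by (rule homeomorphism_imp_open_map[OF h])
  then have "openin (top_of_set (rel_interior S)) (h ` W)"
    by (rule openin_subset_trans[OF _ W(3) rel_interior_subset])
  then have o: "openin (top_of_set (affine hull S)) (h ` W)"
    using openin_rel_interior openin_trans by blast
  have hWa: "h ` W \<subseteq> affine hull S" using openin_imp_subset[OF o] .
  have hWS: "h ` W \<subseteq> S" using W(3) rel_interior_subset by blast
  define G where "G = z ` h ` W"
  have Go: "openin (top_of_set (Eu d)) G" unfolding G_def by (rule homeomorphism_imp_open_map[OF z o])
  have GE: "G \<subseteq> Eu d" using openin_imp_subset[OF Go] .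
  have zG: "z' ` G = h ` W"
    unfolding G_def by (rule homeomorphism_inverse_image[OF z hWa])
  have hW: "h' ` h ` W = W"
    by (rule homeomorphism_inverse_image[OF h WN])
  show ?thesis
  proof (intro exI conjI)
    show "openin (top_of_set (Eu d)) G" by (rule Go)
    show "continuous_on G (h' \<circ> z')"
      using continuous_on_subset[OF homeomorphism_cont2[OF z] GE] continuous_on_subset[OF homeomorphism_cont2[OF h] hWS]
      by (intro continuous_on_compose) (simp_all add: zG)
    show "(h' \<circ> z') ` G = W" unfolding image_comp[symmetric] zG hW ..
    have "inj_on z' G" by (rule inj_on_inverseI[of _ z]) (use homeomorphism_apply2[OF z] GE in blast)
    moreover have "inj_on h' (z' ` G)" unfolding zG
      by (rule inj_on_inverseI[of _ h]) (use homeomorphism_apply2[OF h] hWS in blast)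
    ultimately show "inj_on (h' \<circ> z') G" by (rule comp_inj_on)
  qed
qed

lemma rel_interior_part_open:
  fixes M :: "'a::euclidean_space set"
  assumes h: "homeomorphism N S h h'" and U: "N \<subseteq> M" "U \<subseteq> N" "openin (top_of_set M) U" and O: "openin (top_of_set M) O'"
  shows "openin (top_of_set M) (O' \<inter> U \<inter> h -` rel_interior S)"
proof -
  have "openin (top_of_set S) (rel_interior S)"
    by (rule openin_subset_trans[OF openin_rel_interior rel_interior_subset hull_subset])
  then have "openin (top_of_set U) (U \<inter> h -` rel_interior S)"
    using homeomorphism_image1[OF h] U(2)
    by (intro continuous_openin_preimage[OF continuous_on_subset[OF homeomorphism_cont1[OF h] U(2)]]) auto
  then have "openin (top_of_set M) (U \<inter> h -` rel_interior S)"
    using U(3) openin_trans by blast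
  then have "openin (top_of_set M) (O' \<inter> (U \<inter> h -` rel_interior S))" using O by (rule openin_Int[rotated])
  then show ?thesis by (simp add: Int_assoc)
qed

section \<open>Parametrized open sets and the boundary of the manifold\<close>

locale pl_manifold =
  fixes d :: nat and M :: "'a::euclidean_space set"
  assumes manifold: "compact_pl_manifold d M"
begin

abbreviation "bd \<equiv> manifold_boundary d M"

lemma bd_subset: "bd \<subseteq> M"
  by (auto simp: manifold_boundary_def)

lemma chart_exists: "x \<in> M \<Longrightarrow> \<exists>N S h. pl_ball_nbhd d M x N S h"
  using manifold unfolding compact_pl_manifold_def by blast

lemma embedded_open:
  assumes G: "openin (top_of_set (Eu d)) G" "continuous_on G \<theta>" "inj_on \<theta> G" "\<theta> ` G \<subseteq> M"
  shows "openin (top_of_set M) (\<theta> ` G)" "\<theta> ` G \<inter> bd = {}"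
proof -
  have "\<exists>W. openin (top_of_set M) W \<and> x \<in> W \<and> W \<subseteq> \<theta> ` G" if x: "x \<in> \<theta> ` G" for x
    using chart_exists[of x] chart_interior[OF _ G x] G(4) x by blast
  then show "openin (top_of_set M) (\<theta> ` G)" by (subst openin_subopen) blast
  have "x \<notin> bd" if x: "x \<in> \<theta> ` G" for x
  proof
    assume "x \<in> bd"
    then obtain N S h where "pl_ball_nbhd d M x N S h" "h x \<in> rel_frontier S"
      unfolding manifold_boundary_def by blast
    then show False using chart_interior[OF _ G x] by (auto simp: rel_frontier_def)
  qed
  then show "\<theta> ` G \<inter> bd = {}" by blast
qed

lemma interior_parametrization:
  assumes O: "openin (top_of_set M) O'" and x: "x \<in> O'" "x \<notin> bd"
  shows "\<exists>G \<theta>. openin (top_of_set (Eu d)) G \<and> continuous_on G \<theta> \<and> inj_on \<theta> G \<and> x \<in> \<theta> ` G \<and> \<theta> ` G \<subseteq> O'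
    \<and> openin (top_of_set M) (\<theta> ` G)"
proof -
  have xM: "x \<in> M" using O x openin_imp_subset by blast
  obtain N S h where pl: "pl_ball_nbhd d M x N S h" using chart_exists[OF xM] by blast
  obtain U h' where U: "N \<subseteq> M" "openin (top_of_set M) U" "x \<in> U" "U \<subseteq> N" and S: "int d simplex S"
    and h: "homeomorphism N S h h'"
    using pl by (rule pl_ball_nbhdE)
  have "h x \<notin> rel_frontier S" using x pl xM unfolding manifold_boundary_def by blast
  moreover have "h x \<in> S" using homeomorphism_image1[OF h] U by blast
  ultimately have hx: "h x \<in> rel_interior S" using closure_subset by (auto simp: rel_frontier_def)
  let ?W = "O' \<inter> U \<inter> h -` rel_interior S"
  have W: "openin (top_of_set M) ?W" by (rule rel_interior_part_open[OF h U(1,4,2) O])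
  obtain G \<theta> where "openin (top_of_set (Eu d)) G" "continuous_on G \<theta>" "inj_on \<theta> G" "\<theta> ` G = ?W"
    using chart_parametrization[OF h S U(1,4) W] by blast
  then show ?thesis using W hx x U(3) by (intro exI[of _ G] exI[of _ \<theta>]) auto
qed

text \<open>No point of the image is prescribed, so this holds near boundary points too: the
  relative interior of a simplex is dense in it and meets the image of every nonempty open
  set.\<close>

lemma open_parametrization:
  assumes O: "openin (top_of_set M) O'" and ne: "O' \<noteq> {}"
  shows "\<exists>G \<theta>. openin (top_of_set (Eu d)) G \<and> continuous_on G \<theta> \<and> inj_on \<theta> G \<and> \<theta> ` G \<noteq> {} \<and> \<theta> ` G \<subseteq> O'"
proof -
  obtain x where x: "x \<in> O'" using ne by blast
  have xM: "x \<in> M" using O x openin_imp_subset by blast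
  obtain N S h where pl: "pl_ball_nbhd d M x N S h" using chart_exists[OF xM] by blast
  obtain U h' where U: "N \<subseteq> M" "openin (top_of_set M) U" "x \<in> U" "U \<subseteq> N" and S: "int d simplex S"
    and h: "homeomorphism N S h h'"
    using pl by (rule pl_ball_nbhdE)
  let ?W = "O' \<inter> U \<inter> h -` rel_interior S"
  have W: "openin (top_of_set M) ?W" by (rule rel_interior_part_open[OF h U(1,4,2) O])
  have "?W \<noteq> {}"
  proof -
    have OU: "openin (top_of_set M) (O' \<inter> U)" using O U(2) by (rule openin_Int)
    have "openin (top_of_set N) (O' \<inter> U)"
      by (rule openin_subset_trans[OF OU _ U(1)]) (use U(4) in blast)
    then have "openin (top_of_set S) (h ` (O' \<inter> U))" by (rule homeomorphism_imp_open_map[OF h])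
    then obtain T where T: "open T" "h ` (O' \<inter> U) = S \<inter> T" by (auto simp: openin_open)
    have "h x \<in> T \<inter> closure S" using T(2) x U(3) closure_subset by blast
    then have "T \<inter> closure (rel_interior S) \<noteq> {}"
      using convex_closure_rel_interior[OF convex_simplex[OF S]] by auto
    then have "T \<inter> rel_interior S \<noteq> {}" using open_Int_closure_eq_empty[OF T(1)] by blast
    then obtain y where "y \<in> T" "y \<in> rel_interior S" by blast
    moreover have "y \<in> h ` (O' \<inter> U)" using T(2) calculation rel_interior_subset by blast
    ultimately show ?thesis by blast
  qed
  moreover obtain G \<theta> where "openin (top_of_set (Eu d)) G" "continuous_on G \<theta>" "inj_on \<theta> G" "\<theta> ` G = ?W"
    using chart_parametrization[OF h S U(1,4) W] by blast
  ultimately show ?thesis by (intro exI[of _ G] exI[of _ \<theta>]) auto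
qed

lemma closedin_bd: "closedin (top_of_set M) bd"
proof -
  have "openin (top_of_set M) (M - bd)"
  proof (subst openin_subopen, rule ballI)
    fix x assume x: "x \<in> M - bd"
    obtain G \<theta> where "openin (top_of_set (Eu d)) G" "continuous_on G \<theta>" "inj_on \<theta> G" "x \<in> \<theta> ` G" "\<theta> ` G \<subseteq> M"
      "openin (top_of_set M) (\<theta> ` G)"
      using interior_parametrization[of M x] x by auto
    then show "\<exists>T. openin (top_of_set M) T \<and> x \<in> T \<and> T \<subseteq> M - bd"
      using embedded_open(2)[of G \<theta>] by blast
  qed
  then show ?thesis using bd_subset by (simp add: closedin_def)
qed

end


section \<open>Cofaces of cells of codimension one\<close>

locale quad_manifold = quad d M Q + pl_manifold d M
  for d :: nat and M :: "'a::euclidean_space set" and Q :: "'a cell_system"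
begin

definition cofaces :: "'a set \<Rightarrow> 'a set set" where
  "cofaces \<tau> = {\<sigma> \<in> cells Q. cdim Q \<sigma> = d \<and> \<tau> \<subseteq> \<sigma>}"

lemma cell_subset: "\<sigma> \<in> cells Q \<Longrightarrow> \<sigma> \<subseteq> M"
  using cover by blast

lemma top_cell_interior:
  assumes "\<sigma> \<in> cells Q" "cdim Q \<sigma> = d"
  shows "rel_interior_cell Q \<sigma> \<inter> bd = {}"
proof -
  have "continuous_on (open_cube d) (chart Q \<sigma>)" "inj_on (chart Q \<sigma>) (open_cube d)"
    using continuous_on_subset[OF continuous_chart[OF assms(1)], of "open_cube d"]
      inj_on_subset[OF chart_inj[OF assms(1)], of "open_cube d"] assms(2) open_cube_subset by auto
  moreover have "chart Q \<sigma> ` open_cube d \<subseteq> M"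
    using rel_interior_subset[OF assms(1)] cell_subset[OF assms(1)] assms(2) by (auto simp: rel_interior_cell_def)
  ultimately show ?thesis
    using embedded_open(2)[OF openin_Eu_open_cube] assms(2) by (simp add: rel_interior_cell_def)
qed

lemma collar:
  assumes \<sigma>: "\<sigma> \<in> cells Q" and \<tau>: "\<tau> \<in> cells Q" and sub: "\<tau> \<subseteq> \<sigma>" and dim: "cdim Q \<sigma> = Suc (cdim Q \<tau>)"
  shows "\<exists>r. continuous_on (cube (cdim Q \<tau>) \<times> {0..1::real}) r \<and> inj_on r (cube (cdim Q \<tau>) \<times> {0..1}) \<and>
    (\<forall>u\<in>cube (cdim Q \<tau>). r (u, 0) = chart Q \<tau> u) \<and>
    (\<forall>u\<in>open_cube (cdim Q \<tau>). \<forall>t. 0 < t \<and> t < 1 \<longrightarrow> r (u, t) \<in> rel_interior_cell Q \<sigma>) \<and>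
    r ` (cube (cdim Q \<tau>) \<times> {0..1}) \<subseteq> \<sigma>"
proof -
  let ?k = "cdim Q \<tau>" and ?l = "cdim Q \<sigma>" and ?T = "coord \<sigma> \<circ> chart Q \<tau>"
  obtain I e where I: "I \<subseteq> {..<?l}" "face_map ?k ?l ?T I e"
    using subcell_is_face[OF \<sigma> \<tau> sub] by metis
  interpret face_map ?k ?l ?T I e by (rule I(2))
  have "card I = 1" using dim_eq dim by simp
  then obtain j where j: "I = {j}" by (auto simp: card_1_singleton_iff)
  have jl: "j < ?l" using I(1) j by auto
  have ej: "e j = 0 \<or> e j = 1" using I j by auto
  define c where "c t = (if e j = 0 then t else 1 - t)" for t :: real
  have c: "0 \<le> t \<Longrightarrow> t \<le> 1 \<Longrightarrow> 0 \<le> c t \<and> c t \<le> 1" "0 < t \<Longrightarrow> t < 1 \<Longrightarrow> 0 < c t \<and> c t < 1" "c 0 = e j" for t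
    using ej by (auto simp: c_def)
  have cinj: "c s = c t \<Longrightarrow> s = t" for s t by (auto simp: c_def split: if_splits)
  define \<xi> where "\<xi> p = (?T (fst p))(j := c (snd p))" for p :: "(nat \<Rightarrow> real) \<times> real"
  have Tc: "continuous_on (cube ?k) ?T"
    using continuous_on_subset[OF continuous_coord[OF \<sigma>] sub]
    by (intro continuous_on_compose continuous_chart[OF \<tau>]) (simp add: chart_image[OF \<tau>])
  have \<xi>c: "continuous_on (cube ?k \<times> {0..1}) \<xi>"
  proof (rule continuous_on_coordinatewise_then_product)
    fix i
    show "continuous_on (cube ?k \<times> {0..1}) (\<lambda>p. \<xi> p i)"
    proof (cases "i = j")
      case True
      have "continuous_on (cube ?k \<times> {0..1}) (\<lambda>p. c (snd p))"
        unfolding c_def by (cases "e j = 0") (auto intro!: continuous_intros)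
      then show ?thesis by (simp add: \<xi>_def True)
    next
      case False
      have "continuous_on (cube ?k \<times> {0..1::real}) (\<lambda>p. ?T (fst p))"
      proof (rule continuous_on_compose2[OF Tc])
        show "continuous_on (cube ?k \<times> {0..1::real}) fst" by (intro continuous_on_fst continuous_on_id)
      qed auto
      then show ?thesis
        using continuous_on_product_then_coordinatewise[of _ "\<lambda>p. ?T (fst p)" i] by (simp add: \<xi>_def False)
    qed
  qed
  have \<xi>in: "\<xi> p \<in> cube ?l" if "p \<in> cube ?k \<times> {0..1}" for p
    unfolding \<xi>_def by (rule cube_upd[OF T_cube jl]) (use that c(1)[of "snd p"] in auto)
  have \<xi>inj: "inj_on \<xi> (cube ?k \<times> {0..1})"
  proof (rule inj_onI)
    fix p q assume pq: "p \<in> cube ?k \<times> {0..1}" "q \<in> cube ?k \<times> {0..1}" and e: "\<xi> p = \<xi> q"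
    have "c (snd p) = c (snd q)" using fun_cong[OF e, of j] by (simp add: \<xi>_def)
    then have s: "snd p = snd q" by (rule cinj)
    have f: "fst p \<in> cube ?k" "fst q \<in> cube ?k" using pq by auto
    have "?T (fst p) i = ?T (fst q) i" for i
    proof (cases "i = j")
      case True then show ?thesis using T_fixed[OF f(1)] T_fixed[OF f(2)] j by (metis singletonI)
    next
      case False then show ?thesis using fun_cong[OF e, of i] by (simp add: \<xi>_def)
    qed
    then have "?T (fst p) = ?T (fst q)" by (rule ext)
    then have "fst p = fst q" by (rule inj_onD[OF inj _ f])
    then show "p = q" using s by (simp add: prod_eq_iff)
  qed
  have \<xi>0: "\<xi> (u, 0) = ?T u" if u: "u \<in> cube ?k" for u
    using T_fixed[OF u, of j] j by (auto simp: \<xi>_def c(3) fun_eq_iff)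
  have \<xi>open: "\<xi> (u, t) \<in> open_cube ?l" if u: "u \<in> open_cube ?k" and t: "0 < t" "t < 1" for u t
  proof -
    have uc: "u \<in> cube ?k" using u open_cube_subset by blast
    have "0 < \<xi> (u, t) i \<and> \<xi> (u, t) i < 1" if i: "i < ?l" for i
    proof (cases "i = j")
      case True then show ?thesis using c(2)[OF t] by (simp add: \<xi>_def)
    next
      case False then show ?thesis using interior_iff[OF uc] u i j by (auto simp: \<xi>_def)
    qed
    moreover have "\<xi> (u, t) i = 0" if "i \<ge> ?l" for i
      using \<xi>in[of "(u, t)"] uc t that by (auto simp: cube_def)
    ultimately show ?thesis by (simp add: open_cube_def)
  qed
  have im: "\<xi> ` (cube ?k \<times> {0..1}) \<subseteq> cube ?l" using \<xi>in by blast
  show ?thesis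
  proof (intro exI conjI ballI allI impI)
    show "continuous_on (cube ?k \<times> {0..1}) (chart Q \<sigma> \<circ> \<xi>)"
      by (rule continuous_on_compose[OF \<xi>c continuous_on_subset[OF continuous_chart[OF \<sigma>] im]])
    show "inj_on (chart Q \<sigma> \<circ> \<xi>) (cube ?k \<times> {0..1})"
      by (rule comp_inj_on[OF \<xi>inj inj_on_subset[OF chart_inj[OF \<sigma>] im]])
    show "(chart Q \<sigma> \<circ> \<xi>) (u, 0) = chart Q \<tau> u" if u: "u \<in> cube ?k" for u
      using chart_coord[OF \<sigma>, of "chart Q \<tau> u"] chart_in[OF \<tau> u] sub by (simp add: \<xi>0[OF u] subset_iff)
    show "(chart Q \<sigma> \<circ> \<xi>) (u, t) \<in> rel_interior_cell Q \<sigma>" if "u \<in> open_cube ?k" "0 < t \<and> t < 1" for u t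
      unfolding rel_interior_cell_def using \<xi>open[of u t] that by auto
    show "(chart Q \<sigma> \<circ> \<xi>) ` (cube ?k \<times> {0..1}) \<subseteq> \<sigma>"
      using im chart_image[OF \<sigma>] by (auto simp: image_comp[symmetric])
  qed
qed

text \<open>Two collars of \<open>\<tau>\<close>, glued along \<open>\<tau>\<close>, parametrize a neighbourhood of the interior of \<open>\<tau>\<close> by an
  open subset of \<open>\<real>\<^sup>d\<close>.\<close>

lemma glue_cofaces:
  assumes n: "d = Suc n" and \<tau>: "\<tau> \<in> cells Q" "cdim Q \<tau> = n"
    and s1: "\<sigma>1 \<in> cofaces \<tau>" and s2: "\<sigma>2 \<in> cofaces \<tau>" and ne: "\<sigma>1 \<noteq> \<sigma>2"
  shows "\<exists>W. openin (top_of_set M) W \<and> rel_interior_cell Q \<tau> \<subseteq> W \<and> W \<inter> bd = {} \<and>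
    W \<subseteq> rel_interior_cell Q \<tau> \<union> rel_interior_cell Q \<sigma>1 \<union> rel_interior_cell Q \<sigma>2"
proof -
  have c1: "\<sigma>1 \<in> cells Q" "cdim Q \<sigma>1 = Suc n" "\<tau> \<subseteq> \<sigma>1" and c2: "\<sigma>2 \<in> cells Q" "cdim Q \<sigma>2 = Suc n" "\<tau> \<subseteq> \<sigma>2"
    using s1 s2 n unfolding cofaces_def by simp_all
  let ?B = "cube n \<times> {0..1::real}"
  obtain r1 where r1: "continuous_on ?B r1" "inj_on r1 ?B" "\<forall>u\<in>cube n. r1 (u, 0) = chart Q \<tau> u"
    "\<forall>u\<in>open_cube n. \<forall>t. 0 < t \<and> t < 1 \<longrightarrow> r1 (u, t) \<in> rel_interior_cell Q \<sigma>1"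
    using collar[OF c1(1) \<tau>(1) c1(3)] c1(2) \<tau>(2) by auto
  obtain r2 where r2: "continuous_on ?B r2" "inj_on r2 ?B" "\<forall>u\<in>cube n. r2 (u, 0) = chart Q \<tau> u"
    "\<forall>u\<in>open_cube n. \<forall>t. 0 < t \<and> t < 1 \<longrightarrow> r2 (u, t) \<in> rel_interior_cell Q \<sigma>2"
    using collar[OF c2(1) \<tau>(1) c2(3)] c2(2) \<tau>(2) by auto
  define G where "G = {w \<in> Eu d. (\<forall>i<n. 0 < w i \<and> w i < 1) \<and> -1 < w n \<and> w n < 1}"
  \<comment> \<open>The sign of the last coordinate selects the collar. At 0 both collars restrict
    to the chart of \<open>\<tau>\<close>, so the pieces fit together.\<close>
  define \<theta> where "\<theta> w = (if w n \<le> 0 then r2 (w(n := 0), - w n) else r1 (w(n := 0), w n))" for w :: "nat \<Rightarrow> real"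
  have Gopen: "openin (top_of_set (Eu d)) G"
  proof -
    let ?O = "(\<Inter>i<n. {x::nat \<Rightarrow> real. 0 < x i} \<inter> {x. x i < 1}) \<inter> ({x. -1 < x n} \<inter> {x. x n < 1})"
    have "open ?O" by (intro open_INT ballI open_Int open_coord_less) auto
    moreover have "G = Eu d \<inter> ?O" by (auto simp: G_def)
    ultimately show ?thesis using openin_open_Int[of ?O "Eu d"] by simp
  qed
  have Gu: "w(n := 0) \<in> open_cube n" if "w \<in> G" for w
    using that n by (auto simp: G_def open_cube_def)
  have Guc: "w(n := 0) \<in> cube n" if "w \<in> G" for w
    using Gu[OF that] open_cube_subset by blast
  have Gn: "-1 < w n" "w n < 1" if "w \<in> G" for w using that by (auto simp: G_def)
  have loc: "(w n = 0 \<longrightarrow> \<theta> w \<in> rel_interior_cell Q \<tau>) \<and> (w n < 0 \<longrightarrow> \<theta> w \<in> rel_interior_cell Q \<sigma>2) \<and>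
     (0 < w n \<longrightarrow> \<theta> w \<in> rel_interior_cell Q \<sigma>1)" if w: "w \<in> G" for w
  proof (intro conjI impI)
    assume "w n = 0"
    then have "\<theta> w = chart Q \<tau> (w(n := 0))" using r2(3) Guc[OF w] by (simp add: \<theta>_def)
    then show "\<theta> w \<in> rel_interior_cell Q \<tau>" using Gu[OF w] \<tau>(2) by (simp add: rel_interior_cell_def)
  next
    assume "w n < 0"
    then show "\<theta> w \<in> rel_interior_cell Q \<sigma>2" using r2(4) Gu[OF w] Gn[OF w] by (simp add: \<theta>_def)
  next
    assume "0 < w n"
    then show "\<theta> w \<in> rel_interior_cell Q \<sigma>1" using r1(4) Gu[OF w] Gn[OF w] by (simp add: \<theta>_def)
  qed
  have upd: "continuous_on A (\<lambda>w::nat \<Rightarrow> real. w(n := 0))" for A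
  proof (rule continuous_on_coordinatewise_then_product)
    fix i show "continuous_on A (\<lambda>w::nat \<Rightarrow> real. (w(n := 0)) i)"
      by (cases "i = n") (auto intro!: continuous_on_proj)
  qed
  have \<theta>c: "continuous_on G \<theta>"
    unfolding \<theta>_def
  proof (rule continuous_on_cases_le)
    show "continuous_on {w \<in> G. w n \<le> 0} (\<lambda>w. r2 (w(n := 0), - w n))"
    proof (rule continuous_on_compose2[OF r2(1)])
      show "continuous_on {w \<in> G. w n \<le> 0} (\<lambda>w. (w(n := 0), - w n))"
        by (intro continuous_on_Pair upd continuous_on_minus continuous_on_proj)
      show "(\<lambda>w. (w(n := 0), - w n)) ` {w \<in> G. w n \<le> 0} \<subseteq> ?B"
      proof (rule image_subsetI)
        fix w assume "w \<in> {w \<in> G. w n \<le> 0}"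
        then show "(w(n := 0), - w n) \<in> ?B" using Guc[of w] Gn[of w] by simp
      qed
    qed
    show "continuous_on {w \<in> G. 0 \<le> w n} (\<lambda>w. r1 (w(n := 0), w n))"
    proof (rule continuous_on_compose2[OF r1(1)])
      show "continuous_on {w \<in> G. 0 \<le> w n} (\<lambda>w. (w(n := 0), w n))"
        by (intro continuous_on_Pair upd continuous_on_proj)
      show "(\<lambda>w. (w(n := 0), w n)) ` {w \<in> G. 0 \<le> w n} \<subseteq> ?B"
      proof (rule image_subsetI)
        fix w assume "w \<in> {w \<in> G. 0 \<le> w n}"
        then show "(w(n := 0), w n) \<in> ?B" using Guc[of w] Gn[of w] by simp
      qed
    qed
    show "r2 (w(n := 0), - w n) = r1 (w(n := 0), w n)" if "w \<in> G" "w n = 0" for w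
      using r1(3) r2(3) Guc[OF that(1)] that(2) by simp
  qed (rule continuous_on_proj)
  have ri: "\<tau> \<noteq> \<sigma>1" "\<tau> \<noteq> \<sigma>2" using \<tau>(2) c1(2) c2(2) by auto
  have disj: "rel_interior_cell Q \<tau> \<inter> rel_interior_cell Q \<sigma>1 = {}" "rel_interior_cell Q \<tau> \<inter> rel_interior_cell Q \<sigma>2 = {}"
     "rel_interior_cell Q \<sigma>1 \<inter> rel_interior_cell Q \<sigma>2 = {}"
    using rel_interior_unique[OF \<tau>(1) c1(1)] rel_interior_unique[OF \<tau>(1) c2(1)] rel_interior_unique[OF c1(1) c2(1)] ri ne
    by blast+
  have eq_if: "w = w'" if "w(n := 0) = w'(n := 0)" "w n = w' n" for w w' :: "nat \<Rightarrow> real"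
    using that by (metis fun_upd_triv fun_upd_upd)
  have \<theta>inj: "inj_on \<theta> G"
  proof (rule inj_onI)
    fix w w' assume w: "w \<in> G" "w' \<in> G" and e: "\<theta> w = \<theta> w'"
    \<comment> \<open>The two sides cannot collide because distinct cells have disjoint relative
      interiors.\<close>
    have s: "w n \<le> 0 \<longleftrightarrow> w' n \<le> 0"
    proof -
      have "\<not> (w n \<le> 0 \<and> 0 < w' n)" if "w \<in> G" "w' \<in> G" "\<theta> w = \<theta> w'" for w w'
        using loc[OF that(1)] loc[OF that(2)] that(3) disj by (auto simp: le_less)
      from this[OF w e] this[OF w(2,1) e[symmetric]] show ?thesis by auto
    qed
    show "w = w'"
    proof (cases "w n \<le> 0")
      case True
      then have eq: "r2 (w(n := 0), - w n) = r2 (w'(n := 0), - w' n)" using e s by (simp add: \<theta>_def)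
      have "(w(n := 0), - w n) = (w'(n := 0), - w' n)"
        by (rule inj_onD[OF r2(2) eq]) (use True s Guc Gn[OF w(1)] Gn[OF w(2)] w in auto)
      then show ?thesis using eq_if[of w w'] by simp
    next
      case False
      then have eq: "r1 (w(n := 0), w n) = r1 (w'(n := 0), w' n)" using e s by (simp add: \<theta>_def)
      have "(w(n := 0), w n) = (w'(n := 0), w' n)"
        by (rule inj_onD[OF r1(2) eq]) (use False s Guc Gn[OF w(1)] Gn[OF w(2)] w in auto)
      then show ?thesis using eq_if[of w w'] by simp
    qed
  qed
  have sub: "\<theta> ` G \<subseteq> rel_interior_cell Q \<tau> \<union> rel_interior_cell Q \<sigma>1 \<union> rel_interior_cell Q \<sigma>2"
  proof
    fix x assume "x \<in> \<theta> ` G"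
    then obtain w where w: "w \<in> G" "x = \<theta> w" by blast
    have "w n = 0 \<or> w n < 0 \<or> 0 < w n" by auto
    then show "x \<in> rel_interior_cell Q \<tau> \<union> rel_interior_cell Q \<sigma>1 \<union> rel_interior_cell Q \<sigma>2"
      using loc[OF w(1)] w(2) by auto
  qed
  have "rel_interior_cell Q \<tau> \<union> rel_interior_cell Q \<sigma>1 \<union> rel_interior_cell Q \<sigma>2 \<subseteq> M"
    using rel_interior_subset[OF \<tau>(1)] rel_interior_subset[OF c1(1)] rel_interior_subset[OF c2(1)]
      cell_subset[OF \<tau>(1)] cell_subset[OF c1(1)] cell_subset[OF c2(1)] by auto
  then have sM: "\<theta> ` G \<subseteq> M" using sub by (rule subset_trans[rotated])
  have "rel_interior_cell Q \<tau> \<subseteq> \<theta> ` G"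
  proof
    fix x assume "x \<in> rel_interior_cell Q \<tau>"
    then obtain u where u: "u \<in> open_cube n" "x = chart Q \<tau> u" using \<tau>(2) by (auto simp: rel_interior_cell_def)
    have un: "u n = 0" using u(1) by (simp add: open_cube_def)
    then have uu: "u(n := 0) = u" by (simp add: fun_upd_idem)
    have "u \<in> G" using u(1) n by (auto simp: G_def open_cube_def)
    moreover have "\<theta> u = x"
      using r2(3) u open_cube_subset[of n] by (auto simp: \<theta>_def un uu)
    ultimately show "x \<in> \<theta> ` G" by blast
  qed
  then show ?thesis
    using embedded_open[OF Gopen \<theta>c \<theta>inj sM] sub by blast
qed

text \<open>The glued collars already fill a neighbourhood of the interior of \<open>\<tau>\<close>.
  The collar of a third coface would have to enter this neighbourhood, whose points lie in the
  interiors of \<open>\<tau>\<close>, \<open>\<sigma>1\<close> and \<open>\<sigma>2\<close>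
  only.\<close>

lemma two_cofaces:
  assumes n: "d = Suc n" and \<tau>: "\<tau> \<in> cells Q" "cdim Q \<tau> = n"
    and s: "\<sigma>1 \<in> cofaces \<tau>" "\<sigma>2 \<in> cofaces \<tau>" "\<sigma>1 \<noteq> \<sigma>2"
  shows "cofaces \<tau> = {\<sigma>1, \<sigma>2} \<and> rel_interior_cell Q \<tau> \<inter> bd = {}"
proof -
  obtain W where W: "openin (top_of_set M) W" "rel_interior_cell Q \<tau> \<subseteq> W" "W \<inter> bd = {}"
    "W \<subseteq> rel_interior_cell Q \<tau> \<union> rel_interior_cell Q \<sigma>1 \<union> rel_interior_cell Q \<sigma>2"
    using glue_cofaces[OF n \<tau> s] by blast
  have "\<sigma>3 \<in> {\<sigma>1, \<sigma>2}" if s3: "\<sigma>3 \<in> cofaces \<tau>" for \<sigma>3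
  proof (rule ccontr)
    assume no: "\<sigma>3 \<notin> {\<sigma>1, \<sigma>2}"
    have c3: "\<sigma>3 \<in> cells Q" "cdim Q \<sigma>3 = Suc n" "\<tau> \<subseteq> \<sigma>3" using s3 n unfolding cofaces_def by simp_all
    let ?B = "cube n \<times> {0..1::real}"
    obtain r where r: "continuous_on ?B r" "\<forall>u\<in>cube n. r (u, 0) = chart Q \<tau> u"
      "\<forall>u\<in>open_cube n. \<forall>t. 0 < t \<and> t < 1 \<longrightarrow> r (u, t) \<in> rel_interior_cell Q \<sigma>3" "r ` ?B \<subseteq> \<sigma>3"
      using collar[OF c3(1) \<tau>(1) c3(3)] c3(2) \<tau>(2) by auto
    define u :: "nat \<Rightarrow> real" where "u = (\<lambda>i. if i < n then 1/2 else 0)"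
    have u: "u \<in> open_cube n" by (auto simp: u_def open_cube_def)
    have uc: "u \<in> cube n" using u open_cube_subset by blast
    have cr: "continuous_on {0..1} (\<lambda>t. r (u, t))"
      by (rule continuous_on_compose2[OF r(1)]) (use uc in \<open>auto intro!: continuous_intros\<close>)
    have "openin (top_of_set {0..1}) ({0..1} \<inter> (\<lambda>t. r (u, t)) -` W)"
      by (rule continuous_openin_preimage[OF cr _ W(1)]) (use r(4) uc cell_subset[OF c3(1)] in auto)
    moreover have "0 \<in> {0..1::real} \<inter> (\<lambda>t. r (u, t)) -` W"
      using r(2) uc u W(2) \<tau>(2) by (auto simp: rel_interior_cell_def)
    ultimately obtain e where e: "e > 0" "\<And>t. t \<in> {0..1} \<Longrightarrow> dist t 0 < e \<Longrightarrow> r (u, t) \<in> W"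
      unfolding openin_euclidean_subtopology_iff by blast
    define t where "t = min (e/2) (1/2)"
    have t: "0 < t" "t < 1" "t < e" using e(1) by (auto simp: t_def min_def)
    then have "r (u, t) \<in> W" using e(2)[of t] by (simp add: dist_real_def)
    moreover have "r (u, t) \<in> rel_interior_cell Q \<sigma>3" using r(3) u t by blast
    moreover have "\<sigma>1 \<in> cells Q" "\<sigma>2 \<in> cells Q" using s unfolding cofaces_def by simp_all
    ultimately have "\<sigma>3 = \<tau> \<or> \<sigma>3 = \<sigma>1 \<or> \<sigma>3 = \<sigma>2"
      using W(4) rel_interior_unique[OF c3(1)] \<tau>(1) by blast
    then show False using no \<tau>(2) c3(2) by auto
  qed
  then show ?thesis using s W(2,3) by blast
qed

text \<open>The open star of \<open>x\<close>: it is open because finitely many closed cells are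
  removed, and every cell that meets it contains \<open>x\<close>.\<close>

definition star :: "'a \<Rightarrow> 'a set" where
  "star x = M - \<Union>{\<sigma> \<in> cells Q. x \<notin> \<sigma>}"

lemma openin_star: "openin (top_of_set M) (star x)"
proof -
  have "closed (\<Union>{\<sigma> \<in> cells Q. x \<notin> \<sigma>})"
    using finite_cells cell_closed by (intro closed_Union) auto
  then show ?thesis unfolding star_def
    by (metis Diff_Int_distrib2 Diff_eq inf.idem openin_open_Int open_Compl)
qed

lemma star_cell:
  assumes n: "d = Suc n" and \<tau>: "\<tau> \<in> cells Q" "cdim Q \<tau> = n" and x: "x \<in> rel_interior_cell Q \<tau>"
    and y: "y \<in> star x" "y \<in> \<rho>" "\<rho> \<in> cells Q"
  shows "\<rho> = \<tau> \<or> \<rho> \<in> cofaces \<tau>"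
proof -
  have "x \<in> \<rho>" using y by (auto simp: star_def)
  then have sub: "\<tau> \<subseteq> \<rho>" by (rule rel_interior_minimal[OF \<tau>(1) y(3) x])
  show ?thesis
  proof (cases "cdim Q \<rho> \<le> n")
    case True
    then show ?thesis using subcell_same_dim[OF y(3) \<tau>(1) sub] \<tau>(2) by simp
  next
    case False
    then have "cdim Q \<rho> = d" using cdim_le[OF y(3)] n by simp
    then show ?thesis using sub y(3) by (simp add: cofaces_def)
  qed
qed

lemma in_star: "x \<in> M \<Longrightarrow> x \<in> star x"
  by (auto simp: star_def)

text \<open>In the coordinates of the cell the image is open in Euclidean \<open>d\<close>-space by
  invariance of domain, and an open subset of the cube misses its boundary. For a cell of dimension
  \<open>d - 1\<close> the whole cube lies in that boundary, so no such nonempty \<open>G\<close>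
  exists.\<close>

lemma embedded_in_cell:
  assumes \<sigma>: "\<sigma> \<in> cells Q" "cdim Q \<sigma> \<le> d"
    and G: "openin (top_of_set (Eu d)) G" "continuous_on G \<theta>" "inj_on \<theta> G" "\<theta> ` G \<subseteq> \<sigma>"
  shows "(coord \<sigma> \<circ> \<theta>) ` G \<inter> cube_boundary d = {}"
proof (rule openin_Eu_subset_cube)
  have "cube (cdim Q \<sigma>) \<subseteq> cube d" using \<sigma>(2) by (auto simp: cube_def) (metis leI zero_le_one order_refl)+
  moreover have "(coord \<sigma> \<circ> \<theta>) ` G \<subseteq> cube (cdim Q \<sigma>)" using coord_in[OF \<sigma>(1)] G(4) by auto
  ultimately show im: "(coord \<sigma> \<circ> \<theta>) ` G \<subseteq> cube d" by (rule subset_trans[rotated])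
  show "openin (top_of_set (Eu d)) ((coord \<sigma> \<circ> \<theta>) ` G)"
  proof (rule Eu_invariance_of_domain[OF G(1)])
    show "continuous_on G (coord \<sigma> \<circ> \<theta>)"
      by (rule continuous_on_compose[OF G(2) continuous_on_subset[OF continuous_coord[OF \<sigma>(1)] G(4)]])
    show "(coord \<sigma> \<circ> \<theta>) ` G \<subseteq> Eu d" using im cube_subset_Eu by (rule subset_trans)
    have "inj_on (coord \<sigma>) \<sigma>" by (rule inj_on_inverseI[of _ "chart Q \<sigma>"]) (rule chart_coord[OF \<sigma>(1)])
    then show "inj_on (coord \<sigma> \<circ> \<theta>) G" by (intro comp_inj_on[OF G(3)]) (rule inj_on_subset[OF _ G(4)])
  qed
qed

lemma rel_interior_nonempty: "rel_interior_cell Q \<tau> \<noteq> {}"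
proof -
  have "(\<lambda>i. if i < cdim Q \<tau> then 1/2 else 0) \<in> open_cube (cdim Q \<tau>)" by (auto simp: open_cube_def)
  then show ?thesis unfolding rel_interior_cell_def by blast
qed

text \<open>Without a coface, \<open>M\<close> would be contained in \<open>\<tau>\<close> near an
  interior point of \<open>\<tau>\<close>, and an open subset of Euclidean \<open>d\<close>-space
  would embed into a cube of dimension \<open>n\<close>.\<close>

lemma cofaces_nonempty:
  assumes n: "d = Suc n" and \<tau>: "\<tau> \<in> cells Q" "cdim Q \<tau> = n"
  shows "cofaces \<tau> \<noteq> {}"
proof
  assume no: "cofaces \<tau> = {}"
  obtain x where x: "x \<in> rel_interior_cell Q \<tau>" using rel_interior_nonempty by blast
  then have xM: "x \<in> M" using rel_interior_subset[OF \<tau>(1)] cell_subset[OF \<tau>(1)] by blast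
  have sub: "star x \<subseteq> \<tau>"
  proof
    fix y assume y: "y \<in> star x"
    then obtain \<rho> where "\<rho> \<in> cells Q" "y \<in> \<rho>" using cover by (auto simp: star_def)
    then show "y \<in> \<tau>" using star_cell[OF n \<tau> x y] no by auto
  qed
  obtain G \<theta> where G: "openin (top_of_set (Eu d)) G" "continuous_on G \<theta>" "inj_on \<theta> G" "\<theta> ` G \<noteq> {}" "\<theta> ` G \<subseteq> star x"
    using open_parametrization[OF openin_star[of x]] in_star[OF xM] by blast
  have "\<theta> ` G \<subseteq> \<tau>" using G(5) sub by (rule subset_trans)
  then have "(coord \<tau> \<circ> \<theta>) ` G \<inter> cube_boundary d = {}"
    using embedded_in_cell[OF \<tau>(1) _ G(1-3)] \<tau>(2) n by simp
  moreover have "(coord \<tau> \<circ> \<theta>) ` G \<subseteq> cube n" using coord_in[OF \<tau>(1)] \<open>\<theta> ` G \<subseteq> \<tau>\<close> \<tau>(2) by auto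
  moreover have "cube n \<subseteq> cube_boundary d"
    unfolding cube_eq_cube_facet[of n] n by (rule cube_facet_subset_boundary) auto
  ultimately show False using G(4) by blast
qed

text \<open>Near an interior point \<open>x\<close> of \<open>\<tau>\<close>, \<open>M\<close> is
  contained in the single coface \<open>\<sigma>\<close>. Were \<open>x\<close> not in the boundary
  of \<open>M\<close>, invariance of domain would move its coordinates in \<open>\<sigma>\<close>
  off the boundary of the cube. Openness holds because the star of \<open>x\<close> meets only
  \<open>\<tau>\<close> and \<open>\<sigma>\<close>, and the interior of \<open>\<sigma>\<close>
  contains no boundary points of \<open>M\<close>.\<close>

lemma one_coface:
  assumes n: "d = Suc n" and \<tau>: "\<tau> \<in> cells Q" "cdim Q \<tau> = n" and one: "cofaces \<tau> = {\<sigma>}"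
  shows "rel_interior_cell Q \<tau> \<subseteq> bd" "openin (top_of_set bd) (rel_interior_cell Q \<tau>)"
proof -
  have \<sigma>: "\<sigma> \<in> cells Q" "cdim Q \<sigma> = d" "\<tau> \<subseteq> \<sigma>" using one by (auto simp: cofaces_def)
  have ne: "\<tau> \<noteq> \<sigma>" using \<sigma>(2) \<tau>(2) n by auto
  have star: "\<rho> = \<tau> \<or> \<rho> = \<sigma>" if "x \<in> rel_interior_cell Q \<tau>" "y \<in> star x" "y \<in> \<rho>" "\<rho> \<in> cells Q" for x y \<rho>
    using star_cell[OF n \<tau> that] one by blast
  have inM: "x \<in> M" if "x \<in> rel_interior_cell Q \<tau>" for x
    using that rel_interior_subset[OF \<tau>(1)] cell_subset[OF \<tau>(1)] by blast
  show sub: "rel_interior_cell Q \<tau> \<subseteq> bd"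
  proof (rule subsetI, rule ccontr)
    fix x assume x: "x \<in> rel_interior_cell Q \<tau>" and nb: "x \<notin> bd"
    obtain G \<theta> where G: "openin (top_of_set (Eu d)) G" "continuous_on G \<theta>" "inj_on \<theta> G" "x \<in> \<theta> ` G" "\<theta> ` G \<subseteq> star x"
      using interior_parametrization[OF openin_star[of x] in_star[OF inM[OF x]] nb] by blast
    have "star x \<subseteq> \<sigma>"
    proof
      fix y assume y: "y \<in> star x"
      then obtain \<rho> where "\<rho> \<in> cells Q" "y \<in> \<rho>" using cover by (auto simp: star_def)
      then show "y \<in> \<sigma>" using star[OF x y] \<sigma>(3) by auto
    qed
    with G(5) have "\<theta> ` G \<subseteq> \<sigma>" by (rule subset_trans)
    then have "(coord \<sigma> \<circ> \<theta>) ` G \<inter> cube_boundary d = {}"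
      using embedded_in_cell[OF \<sigma>(1) _ G(1-3)] \<sigma>(2) by simp
    then have "coord \<sigma> x \<notin> cube_boundary d" using G(4) by auto
    moreover have xs: "x \<in> \<sigma>" using x rel_interior_subset[OF \<tau>(1)] \<sigma>(3) by blast
    ultimately have "coord \<sigma> x \<in> open_cube (cdim Q \<sigma>)"
      using coord_in[OF \<sigma>(1) xs] \<sigma>(2) by (simp add: open_cube_eq)
    then have "x \<in> rel_interior_cell Q \<sigma>" using coord_rel_interior[OF \<sigma>(1)] xs by blast
    then show False using rel_interior_unique[OF \<tau>(1) \<sigma>(1) x] ne by blast
  qed
  show "openin (top_of_set bd) (rel_interior_cell Q \<tau>)"
  proof (subst openin_subopen, rule ballI)
    fix x assume x: "x \<in> rel_interior_cell Q \<tau>"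
    have "star x \<inter> bd \<subseteq> rel_interior_cell Q \<tau>"
    proof
      fix y assume y: "y \<in> star x \<inter> bd"
      then obtain \<rho>0 where "\<rho>0 \<in> cells Q" "y \<in> \<rho>0" using cover bd_subset by blast
      then obtain \<rho> where \<rho>: "\<rho> \<in> cells Q" "y \<in> rel_interior_cell Q \<rho>"
        using in_some_rel_interior by metis
      then have "y \<in> \<rho>" using rel_interior_subset by blast
      then have "\<rho> = \<tau> \<or> \<rho> = \<sigma>" using star[OF x _ _ \<rho>(1)] y by blast
      moreover have "\<rho> \<noteq> \<sigma>" using top_cell_interior[OF \<sigma>(1,2)] \<rho>(2) y by blast
      ultimately show "y \<in> rel_interior_cell Q \<tau>" using \<rho>(2) by blast
    qed
    moreover have "openin (top_of_set bd) (star x \<inter> bd)"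
      using openin_star[of x] bd_subset by (metis Int_commute openin_subtopology_Int subtopology_subtopology inf.absorb2)
    ultimately show "\<exists>T. openin (top_of_set bd) T \<and> x \<in> T \<and> T \<subseteq> rel_interior_cell Q \<tau>"
      using in_star[OF inM[OF x]] x sub by (intro exI[of _ "star x \<inter> bd"]) auto
  qed
qed

text \<open>Openness in the boundary is included so that local homeomorphisms of the boundary
  restrict to local homeomorphisms on the cell.\<close>

lemma coface_cases:
  assumes n: "d = Suc n" and \<tau>: "\<tau> \<in> cells Q" "cdim Q \<tau> = n"
  shows "(card (cofaces \<tau>) = 2 \<and> rel_interior_cell Q \<tau> \<inter> bd = {}) \<or>
    (card (cofaces \<tau>) = 1 \<and> rel_interior_cell Q \<tau> \<subseteq> bd \<and> openin (top_of_set bd) (rel_interior_cell Q \<tau>))"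
proof -
  obtain \<sigma>1 where s1: "\<sigma>1 \<in> cofaces \<tau>" using cofaces_nonempty[OF assms] by blast
  show ?thesis
  proof (cases "\<exists>\<sigma>2. \<sigma>2 \<in> cofaces \<tau> \<and> \<sigma>1 \<noteq> \<sigma>2")
    case True
    then obtain \<sigma>2 where s2: "\<sigma>2 \<in> cofaces \<tau>" "\<sigma>1 \<noteq> \<sigma>2" by blast
    then show ?thesis using two_cofaces[OF assms s1 s2] by simp
  next
    case False
    then have "cofaces \<tau> = {\<sigma>1}" using s1 by blast
    then show ?thesis using one_coface[OF assms] by simp
  qed
qed

end


section \<open>Generic values\<close>

text \<open>Around the finitely many preimages there are disjoint neighbourhoods mapped
  homeomorphically onto open sets; the rest of \<open>X\<close> is compact, so its image is closed
  and misses \<open>y\<close>. Values in the intersection of the open images and off this closed set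
  have exactly one preimage in each neighbourhood.\<close>

lemma generic_value_nearby:
  fixes f :: "'a::metric_space \<Rightarrow> 'b::t2_space"
  assumes X: "compact X" and f: "continuous_on X f" "f ` X \<subseteq> Y"
    and y: "generic_value f X Y y" and fin: "finite {x \<in> X. f x = y}"
  shows "\<exists>V. openin (top_of_set Y) V \<and> y \<in> V \<and>
     (\<forall>y'\<in>V. generic_value f X Y y' \<and> card {x \<in> X. f x = y'} = card {x \<in> X. f x = y})"
proof -
  define P where "P = {x \<in> X. f x = y}"
  have yY: "y \<in> Y" using y by (simp add: generic_value_def)
  have fP: "finite P" using fin by (simp add: P_def)
  have "\<forall>x\<in>P. \<exists>U V g. openin (top_of_set X) U \<and> x \<in> U \<and> openin (top_of_set Y) V \<and> homeomorphism U V f g"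
    using y by (simp add: generic_value_def P_def)
  then obtain U V g where UVg: "\<And>x. x \<in> P \<Longrightarrow> openin (top_of_set X) (U x) \<and> x \<in> U x \<and>
      openin (top_of_set Y) (V x) \<and> homeomorphism (U x) (V x) f (g x)"
    by metis
  obtain \<delta> where \<delta>: "\<delta> > 0" "\<And>x x'. x \<in> P \<Longrightarrow> x' \<in> P \<Longrightarrow> x \<noteq> x' \<Longrightarrow> \<delta> \<le> dist x x'"
  proof -
    \<comment> \<open>The extra 1 gives the minimum a meaning when there are fewer than two
      preimages.\<close>
    let ?D = "insert 1 ((\<lambda>(x, x'). dist x x') ` {(x, x'). x \<in> P \<and> x' \<in> P \<and> x \<noteq> x'})"
    have fD: "finite ?D"
      using finite_subset[of "{(x, x'). x \<in> P \<and> x' \<in> P \<and> x \<noteq> x'}" "P \<times> P"] fP by auto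
    have "Min ?D > 0" using fD by (subst Min_gr_iff) auto
    moreover have "Min ?D \<le> dist x x'" if "x \<in> P" "x' \<in> P" "x \<noteq> x'" for x x'
      by (rule Min_le[OF fD]) (use that in auto)
    ultimately show thesis by (rule that)
  qed
  define U' where "U' x = U x \<inter> ball x (\<delta>/2)" for x
  have U'o: "openin (top_of_set X) (U' x)" if x: "x \<in> P" for x
    unfolding U'_def using UVg[OF x] by (simp add: openin_Int_open)
  have xU': "x \<in> U' x" if "x \<in> P" for x using UVg[OF that] \<delta>(1) by (simp add: U'_def)
  have disj: "x = x'" if "x \<in> P" "x' \<in> P" "z \<in> U' x" "z \<in> U' x'" for x x' z
  proof (rule ccontr)
    assume "x \<noteq> x'"
    then have "\<delta> \<le> dist x x'" using \<delta>(2) that by blast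
    moreover have "dist x z < \<delta>/2" "dist x' z < \<delta>/2" using that by (auto simp: U'_def)
    ultimately show False using dist_triangle2[of x x' z] by linarith
  qed
  have V'o: "openin (top_of_set Y) (f ` U' x)" if x: "x \<in> P" for x
  proof -
    have "openin (top_of_set (U x)) (U' x)"
      using UVg[OF x] unfolding U'_def by (simp add: openin_open_Int)
    then have "openin (top_of_set (V x)) (f ` U' x)"
      using UVg[OF x] homeomorphism_imp_open_map by blast
    then show ?thesis using UVg[OF x] openin_trans by blast
  qed
  define R where "R = X - \<Union>(U' ` P)"
  have "openin (top_of_set X) (\<Union>(U' ` P))" using U'o by blast
  then have "closedin (top_of_set X) R" unfolding R_def by (simp add: closedin_diff)
  then have "compact R" using X closedin_compact by blast
  then have "compact (f ` R)"
    by (intro compact_continuous_image continuous_on_subset[OF f(1)]) (auto simp: R_def)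
  then have cR: "closed (f ` R)" by (rule compact_imp_closed)
  define W where "W = (Y - f ` R) \<inter> (\<Inter>x\<in>P. f ` U' x)"
  have Ro: "openin (top_of_set Y) (Y - f ` R)"
    using cR by (simp add: Diff_eq openin_open_Int open_Compl)
  have Wo: "openin (top_of_set Y) W"
  proof (cases "P = {}")
    case True then show ?thesis using Ro by (simp add: W_def)
  next
    case False
    have "openin (top_of_set Y) (\<Inter>x\<in>P. f ` U' x)"
      using False fP V'o by (intro openin_INT2) auto
    then show ?thesis unfolding W_def using Ro by (rule openin_Int[rotated])
  qed
  have yW: "y \<in> W"
  proof -
    have "y \<notin> f ` R"
    proof
      assume "y \<in> f ` R"
      then obtain x where "x \<in> R" "f x = y" by blast
      then show False using xU' by (auto simp: R_def P_def)
    qed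
    moreover have "y \<in> f ` U' x" if x: "x \<in> P" for x
      using xU'[OF x] x by (auto simp: P_def intro!: image_eqI)
    ultimately show ?thesis using yY by (simp add: W_def)
  qed
  have "generic_value f X Y y' \<and> card {x \<in> X. f x = y'} = card P" if y': "y' \<in> W" for y'
  proof
    have y'Y: "y' \<in> Y" using openin_imp_subset[OF Wo] y' by blast
    have loc: "\<exists>p\<in>P. x \<in> U' p" if x: "x \<in> X" "f x = y'" for x
      using x y' by (auto simp: W_def R_def)
    show "generic_value f X Y y'"
      unfolding generic_value_def
    proof (intro conjI ballI impI y'Y)
      fix x assume x: "x \<in> X" "f x = y'"
      obtain p where p: "p \<in> P" "x \<in> U' p" using loc[OF x] by blast
      then show "\<exists>U V g. openin (top_of_set X) U \<and> x \<in> U \<and> openin (top_of_set Y) V \<and> homeomorphism U V f g"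
        using UVg[OF p(1)] by (intro exI[of _ "U p"] exI[of _ "V p"] exI[of _ "g p"]) (auto simp: U'_def)
    qed
    have "\<forall>p\<in>P. \<exists>x. x \<in> U' p \<and> f x = y'"
      using y' by (auto simp: W_def image_iff)
    then obtain q where q: "\<And>p. p \<in> P \<Longrightarrow> q p \<in> U' p \<and> f (q p) = y'" by metis
    have U'X: "U' p \<subseteq> X" if "p \<in> P" for p using openin_imp_subset[OF U'o[OF that]] .
    have finj: "x = x'" if "p \<in> P" "x \<in> U' p" "x' \<in> U' p" "f x = f x'" for p x x'
      using UVg[OF that(1)] that(2-4) homeomorphism_apply1[of "U p" "V p" f "g p"] by (metis IntD1 U'_def)
    have "bij_betw q P {x \<in> X. f x = y'}"
      unfolding bij_betw_def
    proof
      show "inj_on q P"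
        using q disj by (metis inj_onI)
      show "q ` P = {x \<in> X. f x = y'}"
      proof
        show "q ` P \<subseteq> {x \<in> X. f x = y'}" using q U'X by blast
        show "{x \<in> X. f x = y'} \<subseteq> q ` P"
        proof
          fix x assume x: "x \<in> {x \<in> X. f x = y'}"
          obtain p where p: "p \<in> P" "x \<in> U' p" using loc x by blast
          have "x = q p" using finj[OF p(1,2)] q[OF p(1)] x by auto
          then show "x \<in> q ` P" using p(1) by blast
        qed
      qed
    qed
    then show "card {x \<in> X. f x = y'} = card P" using bij_betw_same_card by metis
  qed
  then show ?thesis using Wo yW unfolding P_def by blast
qed

section \<open>Null sets and images of low-dimensional cells\<close>

lemma differentiable_prod_inner:
  fixes b :: "nat \<Rightarrow> 'a::euclidean_space"
  shows "(\<lambda>x. \<Prod>j\<in>S. x \<bullet> b j) differentiable (at y within Y)"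
proof (induction S rule: infinite_finite_induct)
  case (insert j S)
  have "(\<lambda>x. x \<bullet> b j) differentiable (at y within Y)"
    by (intro bounded_linear_imp_differentiable bounded_linear_inner_left)
  then show ?case using insert by (simp add: differentiable_mult)
qed auto

lemma differentiable_mono_sum:
  fixes b :: "nat \<Rightarrow> 'a::euclidean_space"
  shows "(\<lambda>x. mono_sum k a (\<lambda>j. x \<bullet> b j)) differentiable (at y within Y)"
  unfolding mono_sum_def
  by (intro differentiable_sum ballI differentiable_mult differentiable_const differentiable_prod_inner) auto

text \<open>The cone from the centre over a multilinear image of a cube of dimension at most \<open>n - 1\<close> is
  the image of a set of dimension \<open>n\<close>, hence negligible in dimension \<open>n + 1\<close>. The remaining
  coordinates of the ambient space \<open>'a\<close> are left alone.\<close>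

lemma avoid_low_dimensional_images:
  fixes V :: "(nat \<Rightarrow> real) set" and \<phi> :: "'i \<Rightarrow> (nat \<Rightarrow> real) \<Rightarrow> nat \<Rightarrow> real"
  assumes dim: "Suc n \<le> DIM('a::euclidean_space)"
    and J: "finite J" "\<And>r. r \<in> J \<Longrightarrow> k r < n" "\<And>r. r \<in> J \<Longrightarrow> multilinear (k r) (Suc n) (\<phi> r)"
    and pos: "\<And>r u. r \<in> J \<Longrightarrow> u \<in> cube (k r) \<Longrightarrow> 0 < cube_radius (Suc n) (\<phi> r u)"
    and V: "openin (top_of_set (cube_boundary (Suc n))) V" "V \<noteq> {}"
  shows "\<exists>y\<in>V. \<forall>r\<in>J. \<forall>u\<in>cube (k r). radial (Suc n) (\<phi> r u) \<noteq> y"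
proof -
  let ?d = "Suc n" and ?N = "DIM('a)"
  \<comment> \<open>The sequences are moved to the type \<open>'a\<close>, where Lebesgue null sets
    are available; \<open>b\<close> numbers its coordinates.\<close>
  obtain b :: "nat \<Rightarrow> 'a" where b: "bij_betw b {..<?N} Basis"
    using ex_bij_betw_nat_finite[OF finite_Basis] by (auto simp: atLeast0LessThan)
  have bB: "b i \<in> Basis" if "i < ?N" for i using b that by (auto simp: bij_betw_def)
  have bb: "b i \<bullet> b j = (if i = j then 1 else 0)" if "i < ?N" "j < ?N" for i j
    using bB that b inner_Basis[of "b i" "b j"] by (auto simp: bij_betw_def inj_on_def)
  have inner: "(\<Sum>i<?N. c i *\<^sub>R b i) \<bullet> b j = c j" if j: "j < ?N" for c j
  proof -
    have "(\<Sum>i<?N. c i *\<^sub>R b i) \<bullet> b j = (\<Sum>i<?N. if i = j then c i else 0)"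
      unfolding inner_sum_left by (intro sum.cong) (auto simp: bb j)
    then show ?thesis using j by simp
  qed
  have expand: "(\<Sum>i<?N. (x \<bullet> b i) *\<^sub>R b i) = x" for x :: 'a
    using sum.reindex_bij_betw[OF b, of "\<lambda>v. (x \<bullet> v) *\<^sub>R v"] euclidean_representation[of x] by simp
  define A where "A r i = (SOME a. \<forall>u\<in>cube (k r). \<phi> r u i = mono_sum (k r) a u)" for r i
  have A: "\<phi> r u i = mono_sum (k r) (A r i) u" if ri: "r \<in> J" "i < ?d" and u: "u \<in> cube (k r)" for r i u
  proof -
    have "\<exists>a. \<forall>u\<in>cube (k r). \<phi> r u i = mono_sum (k r) a u"
      using J(3)[OF ri(1)] ri(2) unfolding multilinear_iff by blast
    then have "\<forall>u\<in>cube (k r). \<phi> r u i = mono_sum (k r) (A r i) u"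
      unfolding A_def by (rule someI_ex)
    then show ?thesis using u by blast
  qed
  define Psi where "Psi r x = (\<Sum>i<?N. (if i < ?d then (x \<bullet> b (k r)) * (mono_sum (k r) (A r i) (\<lambda>j. x \<bullet> b j) - 1/2)
     else x \<bullet> b i) *\<^sub>R b i)" for r and x :: 'a
  define Z where "Z = {x::'a. b n \<bullet> x = 0}"
  have Z: "negligible Z"
    unfolding Z_def using bB[of n] dim by (intro negligible_hyperplane) (auto simp: nonzero_Basis)
  have lin: "(\<lambda>x::'a. x \<bullet> v) differentiable (at y within Y)" for v y Y
    by (intro bounded_linear_imp_differentiable bounded_linear_inner_left)
  have neg: "negligible (\<Union>r\<in>J. Psi r ` Z)"
  proof (rule negligible_Union)
    show "finite ((\<lambda>r. Psi r ` Z) ` J)" using J(1) by simp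
    fix t assume "t \<in> (\<lambda>r. Psi r ` Z) ` J"
    then obtain r where r: "r \<in> J" "t = Psi r ` Z" by blast
    have "Psi r differentiable (at y within Y)" for y Y
      unfolding Psi_def
    proof (intro differentiable_sum ballI differentiable_scaleR differentiable_const)
      show "(\<lambda>x. if i < ?d then (x \<bullet> b (k r)) * (mono_sum (k r) (A r i) (\<lambda>j. x \<bullet> b j) - 1/2) else x \<bullet> b i) differentiable (at y within Y)" for i
        by (cases "i < ?d") (auto intro!: differentiable_mult differentiable_diff differentiable_mono_sum differentiable_const lin)
    qed simp
    then have "Psi r differentiable_on Z" by (simp add: differentiable_on_def)
    then show "negligible t" unfolding r(2)
      by (intro negligible_differentiable_image_negligible Z) auto
  qed
  \<comment> \<open>Turns a vector into a point of the space of the cube, with the origin going to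
    the centre, so that cones from the centre become linear cones.\<close>
  define p where "p x = (\<lambda>i. if i < ?d then 1/2 + x \<bullet> b i else 0)" for x :: 'a
  have pc: "continuous_on B (\<lambda>x. p x i)" for B i
    unfolding p_def by (cases "i < ?d") (auto intro!: continuous_intros)
  obtain T where T: "open T" "V = cube_boundary ?d \<inter> T" using V(1) by (auto simp: openin_open)
  define R where "R = {x. 0 < cube_radius ?d (p x)}"
  have Ro: "open R"
    unfolding R_def by (intro open_Collect_less continuous_on_const continuous_on_cube_radius pc)
  have "continuous_on R (\<lambda>x. radial ?d (p x))"
    by (intro continuous_on_radial pc) (simp add: R_def)
  then have "open (R \<inter> (\<lambda>x. radial ?d (p x)) -` T)"
    by (rule continuous_open_preimage[OF _ Ro T(1)])
  moreover have "R \<inter> (\<lambda>x. radial ?d (p x)) -` T \<noteq> {}"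
  proof -
    obtain v where v: "v \<in> V" using V(2) by blast
    define x where "x = (\<Sum>i<?N. (v i - 1/2) *\<^sub>R b i)"
    have "p x = v"
    proof
      fix i show "p x i = v i"
        using v T(2) dim inner[of i "\<lambda>i. v i - 1/2"] by (auto simp: p_def x_def cube_boundary_def cube_def)
    qed
    moreover have "v \<in> cube_boundary ?d" "v \<in> T" using v T(2) by auto
    ultimately have "x \<in> R \<inter> (\<lambda>x. radial ?d (p x)) -` T"
      by (simp add: R_def cube_boundary_iff radial_id)
    then show ?thesis by blast
  qed
  ultimately have "\<not> negligible (R \<inter> (\<lambda>x. radial ?d (p x)) -` T)"
    using open_not_negligible by blast
  then have "\<not> R \<inter> (\<lambda>x. radial ?d (p x)) -` T \<subseteq> (\<Union>r\<in>J. Psi r ` Z)"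
    using neg negligible_subset by blast
  then obtain x where x: "0 < cube_radius ?d (p x)" "radial ?d (p x) \<in> T" "x \<notin> (\<Union>r\<in>J. Psi r ` Z)"
    unfolding R_def by blast
  have "radial ?d (p x) \<in> V" using x radial_in_boundary[OF x(1)] T(2) by blast
  moreover have "radial ?d (\<phi> r u) \<noteq> radial ?d (p x)" if r: "r \<in> J" and u: "u \<in> cube (k r)" for r u
  proof
    assume e: "radial ?d (\<phi> r u) = radial ?d (p x)"
    note kr = J(2)[OF r]
    \<comment> \<open>Equal radial projections mean proportional offsets from the centre; the factor
      is the ratio of the radii.\<close>
    define s where "s = cube_radius ?d (p x) / cube_radius ?d (\<phi> r u)"
    have xi: "x \<bullet> b i = s * (\<phi> r u i - 1/2)" if i: "i < ?d" for i
      using fun_cong[OF e, of i] x(1) pos[OF r u] i by (simp add: radial_def p_def s_def field_simps)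
    \<comment> \<open>The point of \<open>Z\<close> over \<open>x\<close>: the cube point
      \<open>u\<close>, the factor \<open>s\<close>, zeros up to index \<open>n\<close>, and the
      unchanged extra coordinates of \<open>x\<close>.\<close>
    define x0 where "x0 = (\<Sum>i<?N. (if i < k r then u i else if i = k r then s else if i < ?d then 0 else x \<bullet> b i) *\<^sub>R b i)"
    have x0: "x0 \<bullet> b i = (if i < k r then u i else if i = k r then s else if i < ?d then 0 else x \<bullet> b i)" if "i < ?N" for i
      unfolding x0_def by (rule inner[OF that])
    have "x0 \<in> Z" using x0[of n] kr dim by (simp add: Z_def inner_commute)
    moreover have "Psi r x0 = x"
    proof -
      have "Psi r x0 = (\<Sum>i<?N. (x \<bullet> b i) *\<^sub>R b i)"
        unfolding Psi_def
      proof (rule sum.cong)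
        fix i assume i: "i \<in> {..<?N}"
        have "mono_sum (k r) (A r i) (\<lambda>j. x0 \<bullet> b j) = mono_sum (k r) (A r i) u"
          by (rule mono_sum_cong) (use x0 kr dim in auto)
        then show "(if i < ?d then (x0 \<bullet> b (k r)) * (mono_sum (k r) (A r i) (\<lambda>j. x0 \<bullet> b j) - 1/2) else x0 \<bullet> b i) *\<^sub>R b i
           = (x \<bullet> b i) *\<^sub>R b i"
          using A[OF r _ u, of i] xi[of i] x0[of "k r"] x0[of i] kr dim i by auto
      qed simp
      then show ?thesis using expand by simp
    qed
    ultimately show False using x(3) r by blast
  qed
  ultimately show ?thesis by blast
qed


section \<open>Counting preimages modulo 2\<close>

lemma odd_degree_cong:
  assumes "\<And>u. u \<in> cube n \<Longrightarrow> g u = g' u"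
  shows "odd_degree n \<epsilon> y g = odd_degree n \<epsilon> y g'"
proof -
  have "HI (int n) (cube n) B C D g = HI (int n) (cube n) B C D g'" for B C D
    by (rule hom_induced_eq) (use assms in simp)
  then show ?thesis unfolding odd_degree_def by simp
qed

text \<open>The largest radius on \<open>K\<close> is attained and is below \<open>1/2\<close>; the
  gap serves as the margin.\<close>

lemma compact_in_open_cube:
  assumes "compact K" "K \<subseteq> open_cube n"
  shows "\<exists>\<epsilon>>0. \<epsilon> \<le> 1/2 \<and> K \<subseteq> mid_cube n \<epsilon>"
proof (cases "K = {}")
  case True
  then show ?thesis by (intro exI[of _ "1/2"]) auto
next
  case False
  have "continuous_on K (cube_radius n)"
    by (rule continuous_on_cube_radius) (rule continuous_on_proj)
  then obtain w where w: "w \<in> K" "\<And>u. u \<in> K \<Longrightarrow> cube_radius n u \<le> cube_radius n w"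
    using continuous_attains_sup[OF assms(1) False] by blast
  have lt: "cube_radius n w < 1/2"
  proof (cases "n = 0")
    case False
    then obtain i where i: "i < n" "cube_radius n w = \<bar>w i - 1/2\<bar>" using cube_radius_attained by blast
    then have "0 < w i" "w i < 1" using w(1) assms(2) by (auto simp: open_cube_def)
    then show ?thesis using i(2) by linarith
  qed simp
  have "u \<in> mid_cube n (1/2 - cube_radius n w)" if u: "u \<in> K" for u
  proof -
    have "u i - 1/2 \<le> cube_radius n w \<and> 1/2 - u i \<le> cube_radius n w" if "i < n" for i
      using cube_radius_ge[OF that, of u] w(2)[OF u] by linarith
    moreover have "u i = 0" if "i \<ge> n" for i using u assms(2) that by (auto simp: open_cube_def)
    ultimately show ?thesis by (force simp: mid_cube_def)
  qed
  then show ?thesis using lt cube_radius_nonneg[of n w] by (intro exI[of _ "1/2 - cube_radius n w"]) auto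
qed

lemma cube_radius_center: 
  assumes "x \<in> cube n" "cube_radius n x = 0"
  shows "x = cube_center n"
proof
  fix i show "x i = cube_center n i"
    using cube_radius_eq_0[OF assms(2), of i] assms(1) by (cases "i < n") (auto simp: cube_center_def cube_def)
qed

section \<open>The facets of a top-dimensional cell as cells\<close>

context quad
begin

lemma facet_cell:
  assumes n: "d = Suc n" and \<sigma>: "\<sigma> \<in> cells Q" "cdim Q \<sigma> = d" and je: "j < d" "e = 0 \<or> e = 1"
  shows "chart Q \<sigma> ` cube_facet d j e \<in> cells Q" "cdim Q (chart Q \<sigma> ` cube_facet d j e) = n"
    "face_map n d (coord \<sigma> \<circ> chart Q (chart Q \<sigma> ` cube_facet d j e)) {j} (\<lambda>_. e)"
    "chart Q \<sigma> ` cube_facet d j e \<subseteq> \<sigma>"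
proof -
  let ?t = "chart Q \<sigma> ` cube_facet d j e"
  have F: "cube_facet d j e = face_set (cdim Q \<sigma>) {j} (\<lambda>_. e)"
    by (simp add: cube_facet_def face_set_def \<sigma>)
  have I: "{j} \<subseteq> {..<cdim Q \<sigma>}" using je \<sigma> by simp
  show t: "?t \<in> cells Q" unfolding F by (rule face_is_cell[OF \<sigma>(1) I]) (use je in auto)
  have fm: "face_map (cdim Q ?t) (cdim Q \<sigma>) (coord \<sigma> \<circ> chart Q ?t) {j} (\<lambda>_. e)"
    by (rule face_map_transition[OF \<sigma>(1) t I]) (use je F in auto)
  show dim: "cdim Q ?t = n" using face_map.dim_eq[OF fm] \<sigma>(2) n by simp
  show "face_map n d (coord \<sigma> \<circ> chart Q ?t) {j} (\<lambda>_. e)" using fm unfolding dim \<sigma>(2) .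
  have "cube_facet d j e \<subseteq> cube (cdim Q \<sigma>)" using \<sigma>(2) by (auto simp: cube_facet_def)
  then show "?t \<subseteq> \<sigma>" using chart_image[OF \<sigma>(1)] by blast
qed

lemma facet_cell_surj:
  assumes n: "d = Suc n" and \<sigma>: "\<sigma> \<in> cells Q" "cdim Q \<sigma> = d" and \<tau>: "\<tau> \<in> cells Q" "cdim Q \<tau> = n" "\<tau> \<subseteq> \<sigma>"
  shows "\<exists>j e. j < d \<and> (e = 0 \<or> e = 1) \<and> \<tau> = chart Q \<sigma> ` cube_facet d j e"
proof -
  obtain I e where I: "I \<subseteq> {..<cdim Q \<sigma>}" "\<And>i. i \<in> I \<Longrightarrow> e i = 0 \<or> e i = 1"
    "\<tau> = chart Q \<sigma> ` face_set (cdim Q \<sigma>) I e" "face_map (cdim Q \<tau>) (cdim Q \<sigma>) (coord \<sigma> \<circ> chart Q \<tau>) I e"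
    by (rule subcell_is_face[OF \<sigma>(1) \<tau>(1,3)]) (rule that)
  have "card I = 1" using face_map.dim_eq[OF I(4)] \<sigma> \<tau> n by simp
  then obtain j where j: "I = {j}" by (auto simp: card_1_singleton_iff)
  have "face_set (cdim Q \<sigma>) I e = cube_facet d j (e j)"
    using j \<sigma>(2) by (simp add: face_set_def cube_facet_def)
  then show ?thesis using I(1,2,3) j \<sigma>(2) by (intro exI[of _ j] exI[of _ "e j"]) auto
qed

lemma facet_cell_inj:
  assumes \<sigma>: "\<sigma> \<in> cells Q" "cdim Q \<sigma> = d" and je: "j < d" "e = 0 \<or> e = 1" "j' < d" "e' = 0 \<or> e' = 1"
    and eq: "chart Q \<sigma> ` cube_facet d j e = chart Q \<sigma> ` cube_facet d j' e'"
  shows "j = j' \<and> e = e'"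
proof -
  have "cube_facet d j e \<subseteq> cube (cdim Q \<sigma>)" "cube_facet d j' e' \<subseteq> cube (cdim Q \<sigma>)"
    using \<sigma>(2) by (auto simp: cube_facet_def)
  then have F: "cube_facet d j e = cube_facet d j' e'"
    using inj_on_image_eq_iff[OF chart_inj[OF \<sigma>(1)]] eq by blast
  \<comment> \<open>The centre of a facet lies on no other facet and therefore determines
    it.\<close>
  let ?c = "\<lambda>i. if i = j then e else if i < d then 1/2 else 0"
  have "?c \<in> cube_facet d j e" using je by (auto simp: cube_facet_def cube_def)
  then have "?c j' = e'" unfolding F by (simp add: cube_facet_def)
  then show ?thesis using je by (auto split: if_splits)
qed

end

section \<open>Labelled manifolds without centrally labelled cells\<close>

locale labelled_manifold = quad_manifold d M Q
  for d :: nat and M :: "'a::euclidean_space set" and Q :: "'a cell_system" +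
  fixes L :: "'a \<Rightarrow> nat \<Rightarrow> real" and n :: nat
  assumes L: "\<forall>v\<in>vertices Q. L v \<in> cube_vertices d"
    and dn: "d = Suc n"
    and bd_im: "f_L d Q L ` bd \<subseteq> cube_boundary d"
    and no_central: "\<forall>\<sigma>\<in>cells Q. \<not> centrally_labelled d Q L \<sigma>"
begin

abbreviation "S \<equiv> cube_boundary d"
abbreviation "f \<equiv> f_L d Q L"

definition F :: "'a \<Rightarrow> nat \<Rightarrow> real" where
  "F x = radial d (f x)"

text \<open>Central labelling speaks of relative interiors only, but every point of \<open>M\<close>
  is in the relative interior of some cell, so the centre is missed on all of
  \<open>M\<close>.\<close>

lemma f_radius_pos:
  assumes x: "x \<in> M"
  shows "0 < cube_radius d (f x)"
proof (rule ccontr)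
  assume "\<not> ?thesis"
  then have "f x = cube_center d"
    using cube_radius_nonneg[of d "f x"] cube_radius_center[OF f_L_in_cube[OF L x]] by linarith
  moreover obtain \<sigma> where "\<sigma> \<in> cells Q" "x \<in> \<sigma>" using x cover by blast
  then obtain \<tau> where "\<tau> \<in> cells Q" "x \<in> rel_interior_cell Q \<tau>" using in_some_rel_interior by metis
  ultimately show False using no_central unfolding centrally_labelled_def by blast
qed

lemma F_in: "x \<in> M \<Longrightarrow> F x \<in> S"
  unfolding F_def by (rule radial_in_boundary[OF f_radius_pos])

lemma continuous_F: "continuous_on M F"
  unfolding F_def using continuous_on_product_then_coordinatewise[OF continuous_f_L[OF L]] f_radius_pos
  by (intro continuous_on_radial) auto

lemma F_bd: "x \<in> bd \<Longrightarrow> F x = f x"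
  unfolding F_def using bd_im by (intro radial_id) auto

lemma cell_F_continuous:
  assumes "\<tau> \<in> cells Q"
  shows "continuous_on (cube (cdim Q \<tau>)) (F \<circ> chart Q \<tau>)" "(F \<circ> chart Q \<tau>) ` cube (cdim Q \<tau>) \<subseteq> S"
proof -
  have sub: "chart Q \<tau> ` cube (cdim Q \<tau>) \<subseteq> M" using chart_image[OF assms] cell_subset[OF assms] by simp
  then show "continuous_on (cube (cdim Q \<tau>)) (F \<circ> chart Q \<tau>)"
    by (intro continuous_on_compose continuous_chart[OF assms] continuous_on_subset[OF continuous_F])
  show "(F \<circ> chart Q \<tau>) ` cube (cdim Q \<tau>) \<subseteq> S" using sub F_in by auto
qed

definition avoids :: "(nat \<Rightarrow> real) \<Rightarrow> bool" where
  "avoids y \<longleftrightarrow> (\<forall>\<rho>\<in>cells Q. cdim Q \<rho> < n \<longrightarrow> y \<notin> F ` \<rho>)"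

lemma exists_avoiding:
  assumes "openin (top_of_set S) V" "V \<noteq> {}" "M \<noteq> {}"
  shows "\<exists>y\<in>V. avoids y"
proof -
  let ?J = "{\<rho> \<in> cells Q. cdim Q \<rho> < n}"
  \<comment> \<open>A point of \<open>M\<close> has a chart onto a \<open>d\<close>-simplex, and
    this simplex lives in the same ambient space.\<close>
  have dimd: "Suc n \<le> DIM('a)"
  proof -
    obtain x where "x \<in> M" using assms(3) by blast
    then obtain N T h where "pl_ball_nbhd d M x N T h" using chart_exists by blast
    then have "int d simplex T" unfolding pl_ball_nbhd_def by blast
    then have "aff_dim T = int d" by (rule aff_dim_simplex)
    then show ?thesis using aff_dim_le_DIM[of T] dn by simp
  qed
  have "\<exists>y\<in>V. \<forall>\<rho>\<in>?J. \<forall>u\<in>cube (cdim Q \<rho>). radial (Suc n) ((f \<circ> chart Q \<rho>) u) \<noteq> y"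
  proof (rule avoid_low_dimensional_images[OF dimd])
    show "finite ?J" using finite_cells by simp
    show "multilinear (cdim Q \<rho>) (Suc n) (f \<circ> chart Q \<rho>)" if "\<rho> \<in> ?J" for \<rho>
      using f_L_multilinear[OF L, of \<rho>] that dn by simp
    show "0 < cube_radius (Suc n) ((f \<circ> chart Q \<rho>) u)" if "\<rho> \<in> ?J" "u \<in> cube (cdim Q \<rho>)" for \<rho> u
      using f_radius_pos[of "chart Q \<rho> u"] chart_in[of \<rho> u] cell_subset[of \<rho>] that dn by auto
  qed (use assms dn in auto)
  then obtain y where y: "y \<in> V" "\<forall>\<rho>\<in>?J. \<forall>u\<in>cube (cdim Q \<rho>). radial (Suc n) ((f \<circ> chart Q \<rho>) u) \<noteq> y"
    by blast
  have "y \<notin> F ` \<rho>" if \<rho>: "\<rho> \<in> cells Q" "cdim Q \<rho> < n" for \<rho>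
  proof
    assume "y \<in> F ` \<rho>"
    then obtain x where x: "x \<in> \<rho>" "y = F x" by blast
    define u where "u = coord \<rho> x"
    have u: "u \<in> cube (cdim Q \<rho>)" "y = F (chart Q \<rho> u)"
      using coord_in[OF \<rho>(1) x(1)] chart_coord[OF \<rho>(1) x(1)] x(2) by (simp_all add: u_def)
    have "F (chart Q \<rho> u) = radial (Suc n) ((f \<circ> chart Q \<rho>) u)" unfolding F_def by (simp add: dn)
    moreover have "radial (Suc n) ((f \<circ> chart Q \<rho>) u) \<noteq> y"
      using bspec[OF bspec[OF y(2)] u(1)] \<rho> by blast
    ultimately show False using u(2) by simp
  qed
  then show ?thesis using y(1) unfolding avoids_def by blast
qed

lemma avoids_rel_interior:
  assumes y: "avoids y" and x: "\<sigma> \<in> cells Q" "x \<in> \<sigma>" "F x = y"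
  obtains \<rho> where "\<rho> \<in> cells Q" "\<rho> \<subseteq> \<sigma>" "x \<in> rel_interior_cell Q \<rho>" "n \<le> cdim Q \<rho>"
    "coord \<sigma> x \<notin> open_cube (cdim Q \<sigma>) \<Longrightarrow> cdim Q \<rho> < cdim Q \<sigma>"
proof -
  obtain \<rho> where \<rho>: "\<rho> \<in> cells Q" "\<rho> \<subseteq> \<sigma>" "x \<in> rel_interior_cell Q \<rho>"
     "coord \<sigma> x \<notin> open_cube (cdim Q \<sigma>) \<Longrightarrow> cdim Q \<rho> < cdim Q \<sigma>"
    by (rule in_some_rel_interior[OF x(1,2)]) (rule that)
  have "x \<in> \<rho>" using \<rho>(1,3) rel_interior_subset by blast
  then have "n \<le> cdim Q \<rho>" using y \<rho>(1) x(3) unfolding avoids_def by force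
  then show ?thesis using that \<rho> by blast
qed

definition K :: "(nat \<Rightarrow> real) \<Rightarrow> 'a set \<Rightarrow> (nat \<Rightarrow> real) set" where
  "K y \<tau> = {u \<in> cube n. F (chart Q \<tau> u) = y}"

text \<open>A preimage on the boundary of the cube would lie in a cell of dimension below
  \<open>n\<close>, which \<open>y\<close> avoids.\<close>

lemma K_open: 
  assumes y: "avoids y" and \<tau>: "\<tau> \<in> cells Q" "cdim Q \<tau> = n"
  shows "K y \<tau> \<subseteq> open_cube n"
proof (rule subsetI, rule ccontr)
  fix u assume u: "u \<in> K y \<tau>" and no: "u \<notin> open_cube n"
  have uc: "u \<in> cube (cdim Q \<tau>)" "F (chart Q \<tau> u) = y" using u \<tau> by (auto simp: K_def)
  obtain \<rho> where "\<rho> \<in> cells Q" "n \<le> cdim Q \<rho>" "coord \<tau> (chart Q \<tau> u) \<notin> open_cube (cdim Q \<tau>) \<Longrightarrow> cdim Q \<rho> < cdim Q \<tau>"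
    by (rule avoids_rel_interior[OF y \<tau>(1) chart_in[OF \<tau>(1) uc(1)] uc(2)]) (rule that)
  then show False using coord_chart[OF \<tau>(1) uc(1)] no \<tau>(2) by simp
qed

lemma K_compact:
  assumes \<tau>: "\<tau> \<in> cells Q" "cdim Q \<tau> = n"
  shows "compact (K y \<tau>)"
proof -
  have "closedin (top_of_set (cube n)) (cube n \<inter> (F \<circ> chart Q \<tau>) -` {y})"
    using continuous_closedin_preimage[of "cube n" "F \<circ> chart Q \<tau>" "{y}"] cell_F_continuous(1)[OF \<tau>(1)] \<tau>(2) by simp
  moreover have "cube n \<inter> (F \<circ> chart Q \<tau>) -` {y} = K y \<tau>" by (auto simp: K_def)
  ultimately show ?thesis using compact_cube closedin_compact by metis
qed

text \<open>There are finitely many cells. One margin for all of them is required because the parity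
  of a cell must be the same number in each of its cofaces.\<close>

lemma uniform_margin:
  assumes y: "avoids y"
  shows "\<exists>\<epsilon>>0. \<epsilon> \<le> 1/2 \<and> (\<forall>\<tau>\<in>cells Q. cdim Q \<tau> = n \<longrightarrow> K y \<tau> \<subseteq> mid_cube n \<epsilon>)"
proof -
  let ?C = "{\<tau> \<in> cells Q. cdim Q \<tau> = n}"
  have "compact (\<Union>\<tau>\<in>?C. K y \<tau>)"
    using finite_cells K_compact by (intro compact_UN) auto
  moreover have "(\<Union>\<tau>\<in>?C. K y \<tau>) \<subseteq> open_cube n" using K_open[OF y] by blast
  ultimately obtain \<epsilon> where e: "\<epsilon> > 0" "\<epsilon> \<le> 1/2" "(\<Union>\<tau>\<in>?C. K y \<tau>) \<subseteq> mid_cube n \<epsilon>"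
    using compact_in_open_cube by blast
  show ?thesis
    by (intro exI[of _ \<epsilon>] conjI e(1,2)) (use e(3) in blast)
qed

text \<open>Only the chart of \<open>\<tau>\<close> itself enters, not a coface; this is what allows
  counting incidences in two ways.\<close>

definition odd_cell :: "real \<Rightarrow> (nat \<Rightarrow> real) \<Rightarrow> 'a set \<Rightarrow> bool" where
  "odd_cell \<epsilon> y \<tau> \<longleftrightarrow> odd_degree n \<epsilon> y (F \<circ> chart Q \<tau>)"

text \<open>The facets of the cube are parametrized by the charts of the corresponding cells, read
  in the coordinates of \<open>\<sigma>\<close>. Composing with \<open>F\<close> on
  \<open>\<sigma>\<close> then gives back \<open>F\<close> on the facet cell, so the parity of a
  facet of \<open>\<sigma>\<close> is its intrinsic parity as a cell.\<close>

lemma even_odd_facets: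
  assumes y: "y \<in> S" "avoids y" and eps: "0 < \<epsilon>" "\<epsilon> \<le> 1/2" "\<And>\<tau>. \<tau> \<in> cells Q \<Longrightarrow> cdim Q \<tau> = n \<Longrightarrow> K y \<tau> \<subseteq> mid_cube n \<epsilon>"
    and \<sigma>: "\<sigma> \<in> cells Q" "cdim Q \<sigma> = d"
  shows "even (card {\<tau> \<in> cells Q. cdim Q \<tau> = n \<and> \<tau> \<subseteq> \<sigma> \<and> odd_cell \<epsilon> y \<tau>})"
proof -
  let ?t = "\<lambda>j e. chart Q \<sigma> ` cube_facet d j e"
  let ?\<alpha> = "\<lambda>j e. coord \<sigma> \<circ> chart Q (?t j e)"
  note fc = facet_cell[OF dn \<sigma>]
  have ev: "even (card {(j, e). j < Suc n \<and> (e = 0 \<or> e = 1) \<and> odd_degree n \<epsilon> y ((F \<circ> chart Q \<sigma>) \<circ> ?\<alpha> j e)})"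
  proof (rule even_odd_degree_facets)
    show "continuous_on (cube (Suc n)) (F \<circ> chart Q \<sigma>)" "(F \<circ> chart Q \<sigma>) ` cube (Suc n) \<subseteq> cube_boundary (Suc n)"
      using cell_F_continuous[OF \<sigma>(1)] \<sigma>(2) dn by simp_all
    show "y \<in> cube_boundary (Suc n)" "0 < \<epsilon>" "\<epsilon> \<le> 1/2" using y eps dn by auto
  next
    fix j and e :: real assume je: "j < Suc n" "e = 0 \<or> e = 1"
    then have jd: "j < d" using dn by simp
    interpret face_map n d "?\<alpha> j e" "{j}" "\<lambda>_. e" by (rule fc(3)[OF jd je(2)])
    have im: "?\<alpha> j e ` cube n = cube_facet (Suc n) j e"
      unfolding img by (simp add: cube_facet_def dn)
    have "cdim Q (?t j e) = n" by (rule fc(2)[OF jd je(2)])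
    then have c: "continuous_on (cube n) (?\<alpha> j e)"
      using continuous_chart[OF fc(1)[OF jd je(2)]] chart_image[OF fc(1)[OF jd je(2)]]
        continuous_on_subset[OF continuous_coord[OF \<sigma>(1)] fc(4)[OF jd je(2)]]
      by (intro continuous_on_compose) simp_all
    show "\<exists>\<beta>. homeomorphism (cube n) (cube_facet (Suc n) j e) (?\<alpha> j e) \<beta>"
      using homeomorphism_compact[OF compact_cube c im inj] by blast
    show "?\<alpha> j e ` mid_cube n \<epsilon> = mid_facet (Suc n) \<epsilon> j e"
    proof
      show "?\<alpha> j e ` mid_cube n \<epsilon> \<subseteq> mid_facet (Suc n) \<epsilon> j e"
      proof (rule image_subsetI)
        fix u assume u: "u \<in> mid_cube n \<epsilon>"
        have uc: "u \<in> cube n"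
          using u mid_facet_subset_open_facet[of n "Suc n" 0 \<epsilon>] open_facet_subset eps(1,2)
          unfolding mid_cube_eq_mid_facet cube_eq_cube_facet[of n] by blast
        have "?\<alpha> j e u j = e" using T_fixed[OF uc] by simp
        moreover have "\<forall>i\<in>{..<d} - {j}. \<epsilon> \<le> ?\<alpha> j e u i \<and> ?\<alpha> j e u i \<le> 1 - \<epsilon>"
          using mid_iff[OF uc] u by blast
        moreover have "\<forall>i\<ge>d. ?\<alpha> j e u i = 0" using T_cube[OF uc] by (simp add: cube_def)
        ultimately show "?\<alpha> j e u \<in> mid_facet (Suc n) \<epsilon> j e"
          unfolding mid_facet_def dn by simp
      qed
      show "mid_facet (Suc n) \<epsilon> j e \<subseteq> ?\<alpha> j e ` mid_cube n \<epsilon>"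
      proof
        fix x assume x: "x \<in> mid_facet (Suc n) \<epsilon> j e"
        then have "x \<in> cube_facet (Suc n) j e"
          using mid_facet_subset_open_facet[OF je eps(1,2)] open_facet_subset by blast
        then obtain u where u: "u \<in> cube n" "x = ?\<alpha> j e u" unfolding im[symmetric] by blast
        have "u \<in> mid_cube n \<epsilon>"
          using mid_iff[OF u(1), of \<epsilon>] x unfolding u(2) mid_facet_def dn by simp
        then show "x \<in> ?\<alpha> j e ` mid_cube n \<epsilon>" using u(2) by blast
      qed
    qed
  next
    \<comment> \<open>A preimage on the boundary of \<open>\<sigma>\<close> lies in the interior of
      a proper face. Avoidance leaves only dimension \<open>n\<close> for it, and the uniform margin
      then places the point in the core of that facet.\<close>
    fix x assume x: "x \<in> cube_boundary (Suc n)" "(F \<circ> chart Q \<sigma>) x = y"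
    have xc: "x \<in> cube (cdim Q \<sigma>)" using x(1) cube_boundary_subset \<sigma>(2) dn by auto
    let ?z = "chart Q \<sigma> x"
    have zs: "?z \<in> \<sigma>" by (rule chart_in[OF \<sigma>(1) xc])
    have xz: "coord \<sigma> ?z = x" by (rule coord_chart[OF \<sigma>(1) xc])
    have "x \<notin> open_cube (cdim Q \<sigma>)" using x(1) \<sigma>(2) dn by (simp add: open_cube_eq)
    then have nz: "coord \<sigma> ?z \<notin> open_cube (cdim Q \<sigma>)" unfolding xz .
    have Fz: "F ?z = y" using x(2) by simp
    obtain \<rho> where \<rho>: "\<rho> \<in> cells Q" "\<rho> \<subseteq> \<sigma>" "?z \<in> rel_interior_cell Q \<rho>" "n \<le> cdim Q \<rho>"
       "coord \<sigma> ?z \<notin> open_cube (cdim Q \<sigma>) \<Longrightarrow> cdim Q \<rho> < cdim Q \<sigma>"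
      by (rule avoids_rel_interior[OF y(2) \<sigma>(1) zs Fz]) (rule that)
    have dim: "cdim Q \<rho> = n" using \<rho>(4) \<rho>(5)[OF nz] \<sigma>(2) dn by simp
    obtain j e where je: "j < d" "e = 0 \<or> e = 1" "\<rho> = ?t j e"
      using facet_cell_surj[OF dn \<sigma> \<rho>(1) dim \<rho>(2)] by blast
    interpret face_map n d "?\<alpha> j e" "{j}" "\<lambda>_. e" by (rule fc(3)[OF je(1,2)])
    have zr: "?z \<in> \<rho>" using \<rho>(1,3) rel_interior_subset by blast
    let ?w = "coord \<rho> ?z"
    have w: "?w \<in> cube n" using coord_in[OF \<rho>(1) zr] dim by simp
    have cw: "chart Q \<rho> ?w = ?z" by (rule chart_coord[OF \<rho>(1) zr])
    then have "?w \<in> K y \<rho>" using w Fz by (simp add: K_def)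
    then have wm: "?w \<in> mid_cube n \<epsilon>" using eps(3)[OF \<rho>(1) dim] by blast
    have Tw: "?\<alpha> j e ?w = x" using cw xz je(3) by simp
    have "x j = e" using T_fixed[OF w, of j] Tw by simp
    moreover have "\<forall>i\<in>{..<d} - {j}. \<epsilon> \<le> x i \<and> x i \<le> 1 - \<epsilon>"
      using mid_iff[OF w, of \<epsilon>] wm unfolding Tw by blast
    moreover have "\<forall>i\<ge>d. x i = 0" using xc \<sigma>(2) by (simp add: cube_def)
    ultimately have "x \<in> mid_facet (Suc n) \<epsilon> j e" unfolding mid_facet_def dn by simp
    then show "\<exists>j<Suc n. \<exists>e. (e = 0 \<or> e = 1) \<and> x \<in> mid_facet (Suc n) \<epsilon> j e"
      using je(1,2) dn by blast
  qed
  have "odd_degree n \<epsilon> y ((F \<circ> chart Q \<sigma>) \<circ> ?\<alpha> j e) = odd_cell \<epsilon> y (?t j e)"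
    if je: "j < d" "e = 0 \<or> e = 1" for j e
    unfolding odd_cell_def
  proof (rule odd_degree_cong)
    fix u assume "u \<in> cube n"
    then have "chart Q (?t j e) u \<in> \<sigma>"
      using chart_in[OF fc(1)[OF je], of u] fc(2,4)[OF je] by auto
    then show "((F \<circ> chart Q \<sigma>) \<circ> ?\<alpha> j e) u = (F \<circ> chart Q (?t j e)) u"
      using chart_coord[OF \<sigma>(1)] by simp
  qed
  then have eqs: "{(j, e). j < Suc n \<and> (e = 0 \<or> e = 1) \<and> odd_degree n \<epsilon> y ((F \<circ> chart Q \<sigma>) \<circ> ?\<alpha> j e)} =
     {(j, e). j < d \<and> (e = 0 \<or> e = 1) \<and> odd_cell \<epsilon> y (?t j e)}"
    using dn by auto
  have bij: "bij_betw (\<lambda>(j, e). ?t j e) {(j, e). j < d \<and> (e = 0 \<or> e = 1) \<and> odd_cell \<epsilon> y (?t j e)}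
     {\<tau> \<in> cells Q. cdim Q \<tau> = n \<and> \<tau> \<subseteq> \<sigma> \<and> odd_cell \<epsilon> y \<tau>}" (is "bij_betw ?h ?A ?B")
    unfolding bij_betw_def
  proof
    show "inj_on ?h ?A"
    proof (rule inj_onI)
      fix p q assume pq: "p \<in> ?A" "q \<in> ?A" "?h p = ?h q"
      obtain j e j' e' where "p = (j, e)" "q = (j', e')" by (cases p, cases q)
      then show "p = q" using facet_cell_inj[OF \<sigma>, of j e j' e'] pq by simp
    qed
    show "?h ` ?A = ?B"
    proof
      show "?h ` ?A \<subseteq> ?B"
      proof (rule image_subsetI)
        fix p assume "p \<in> ?A"
        then obtain j e where p: "p = (j, e)" "j < d" "e = 0 \<or> e = 1" "odd_cell \<epsilon> y (?t j e)" by blast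
        then show "?h p \<in> ?B" using fc[OF p(2,3)] by simp
      qed
      show "?B \<subseteq> ?h ` ?A"
      proof
        fix \<tau> assume t: "\<tau> \<in> ?B"
        then obtain j e where "j < d" "e = 0 \<or> e = 1" "\<tau> = ?t j e"
          using facet_cell_surj[OF dn \<sigma>, of \<tau>] by blast
        then show "\<tau> \<in> ?h ` ?A" using t by (intro image_eqI[of _ _ "(j, e)"]) auto
      qed
    qed
  qed
  show ?thesis using ev unfolding eqs bij_betw_same_card[OF bij] .
qed

lemma even_odd_cells_single:
  assumes y: "y \<in> S" "avoids y" and eps: "0 < \<epsilon>" "\<epsilon> \<le> 1/2" "\<And>\<tau>. \<tau> \<in> cells Q \<Longrightarrow> cdim Q \<tau> = n \<Longrightarrow> K y \<tau> \<subseteq> mid_cube n \<epsilon>"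
  shows "even (card {\<tau> \<in> cells Q. cdim Q \<tau> = n \<and> card (cofaces \<tau>) = 1 \<and> odd_cell \<epsilon> y \<tau>})"
proof -
  let ?A = "{\<tau> \<in> cells Q. cdim Q \<tau> = n \<and> odd_cell \<epsilon> y \<tau>}" and ?T = "{\<sigma> \<in> cells Q. cdim Q \<sigma> = d}"
  have fin: "finite ?A" "finite ?T" using finite_cells by auto
  have "(\<Sum>\<tau>\<in>?A. card (cofaces \<tau>)) = (\<Sum>\<tau>\<in>?A. \<Sum>\<sigma>\<in>?T. if \<tau> \<subseteq> \<sigma> then 1 else 0)"
  proof (intro sum.cong refl)
    fix \<tau>
    have "cofaces \<tau> = {\<sigma> \<in> ?T. \<tau> \<subseteq> \<sigma>}" by (auto simp: cofaces_def)
    then show "card (cofaces \<tau>) = (\<Sum>\<sigma>\<in>?T. if \<tau> \<subseteq> \<sigma> then 1 else 0)"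
      using fin(2) by (simp add: sum.If_cases Int_def)
  qed
  also have "\<dots> = (\<Sum>\<sigma>\<in>?T. \<Sum>\<tau>\<in>?A. if \<tau> \<subseteq> \<sigma> then 1 else 0)" by (rule sum.swap)
  also have "\<dots> = (\<Sum>\<sigma>\<in>?T. card {\<tau> \<in> cells Q. cdim Q \<tau> = n \<and> \<tau> \<subseteq> \<sigma> \<and> odd_cell \<epsilon> y \<tau>})"
  proof (intro sum.cong refl)
    fix \<sigma>
    have "{\<tau> \<in> cells Q. cdim Q \<tau> = n \<and> \<tau> \<subseteq> \<sigma> \<and> odd_cell \<epsilon> y \<tau>} = {\<tau> \<in> ?A. \<tau> \<subseteq> \<sigma>}" by auto
    then show "(\<Sum>\<tau>\<in>?A. if \<tau> \<subseteq> \<sigma> then 1 else 0) = card {\<tau> \<in> cells Q. cdim Q \<tau> = n \<and> \<tau> \<subseteq> \<sigma> \<and> odd_cell \<epsilon> y \<tau>}"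
      using fin(1) by (simp add: sum.If_cases Int_def)
  qed
  also have "even \<dots>"
    by (rule dvd_sum) (use even_odd_facets[OF y eps] in auto)
  finally have "even (card {\<tau> \<in> ?A. odd (card (cofaces \<tau>))})"
    unfolding even_sum_iff[OF fin(1)] .
  moreover have "odd (card (cofaces \<tau>)) \<longleftrightarrow> card (cofaces \<tau>) = 1" if "\<tau> \<in> ?A" for \<tau>
    using coface_cases[OF dn, of \<tau>] that by auto
  then have "{\<tau> \<in> ?A. odd (card (cofaces \<tau>))} = {\<tau> \<in> cells Q. cdim Q \<tau> = n \<and> card (cofaces \<tau>) = 1 \<and> odd_cell \<epsilon> y \<tau>}"
    by blast
  ultimately show ?thesis by simp
qed

text \<open>Such a cell lies in the boundary of \<open>M\<close>, where \<open>F\<close> equals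
  \<open>f\<close>, and its interior is open there. Hence the local homeomorphisms supplied by
  genericity restrict to the cell and pull back along its chart.\<close>

lemma odd_cell_single_coface:
  assumes y: "avoids y" "generic_value f bd S y" "finite {x \<in> bd. f x = y}"
    and eps: "0 < \<epsilon>" "\<epsilon> \<le> 1/2" "K y \<tau> \<subseteq> mid_cube n \<epsilon>"
    and \<tau>: "\<tau> \<in> cells Q" "cdim Q \<tau> = n" "card (cofaces \<tau>) = 1"
  shows "odd_cell \<epsilon> y \<tau> \<longleftrightarrow> odd (card {x \<in> rel_interior_cell Q \<tau>. f x = y})"
proof -
  let ?R = "rel_interior_cell Q \<tau>"
  have R: "?R \<subseteq> bd" "openin (top_of_set bd) ?R" using coface_cases[OF dn \<tau>(1,2)] \<tau>(3) by auto
  have img: "chart Q \<tau> ` open_cube n = ?R" using \<tau>(2) by (simp add: rel_interior_cell_def)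
  have Ko: "K y \<tau> \<subseteq> open_cube n" by (rule K_open[OF y(1) \<tau>(1,2)])
  have Keq: "K y \<tau> = {u \<in> cube n. (F \<circ> chart Q \<tau>) u = y}" by (simp add: K_def)
  have inj: "inj_on (chart Q \<tau>) (cube n)" using chart_inj[OF \<tau>(1)] \<tau>(2) by simp
  have bij: "bij_betw (chart Q \<tau>) (K y \<tau>) {x \<in> ?R. f x = y}"
    unfolding bij_betw_def
  proof
    show "inj_on (chart Q \<tau>) (K y \<tau>)" by (rule inj_on_subset[OF inj]) (auto simp: K_def)
    show "chart Q \<tau> ` K y \<tau> = {x \<in> ?R. f x = y}"
    proof
      show "chart Q \<tau> ` K y \<tau> \<subseteq> {x \<in> ?R. f x = y}"
      proof (rule image_subsetI)
        fix u assume u: "u \<in> K y \<tau>"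
        then have "chart Q \<tau> u \<in> ?R" using Ko img by blast
        then show "chart Q \<tau> u \<in> {x \<in> ?R. f x = y}" using u R(1) F_bd by (auto simp: K_def)
      qed
      show "{x \<in> ?R. f x = y} \<subseteq> chart Q \<tau> ` K y \<tau>"
      proof
        fix x assume x: "x \<in> {x \<in> ?R. f x = y}"
        then obtain u where u: "u \<in> open_cube n" "x = chart Q \<tau> u" using img by blast
        then have "u \<in> K y \<tau>" using x R(1) F_bd open_cube_subset[of n] by (auto simp: K_def)
        then show "x \<in> chart Q \<tau> ` K y \<tau>" using u(2) by blast
      qed
    qed
  qed
  have "finite {x \<in> ?R. f x = y}" by (rule finite_subset[OF _ y(3)]) (use R(1) in blast)
  then have fin: "finite (K y \<tau>)" using bij bij_betw_finite by blast
  have "odd_cell \<epsilon> y \<tau> \<longleftrightarrow> odd (card (K y \<tau>))"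
    unfolding odd_cell_def
  proof (rule odd_degree_iff_odd_card[OF _ _ _ eps(1,2) Keq fin eps(3)])
    show "continuous_on (cube n) (F \<circ> chart Q \<tau>)" "(F \<circ> chart Q \<tau>) ` cube n \<subseteq> cube_boundary (Suc n)"
      using cell_F_continuous[OF \<tau>(1)] \<tau>(2) dn by simp_all
    show "y \<in> cube_boundary (Suc n)" using y(2) dn by (simp add: generic_value_def)
    fix u assume u: "u \<in> K y \<tau>"
    let ?x = "chart Q \<tau> u"
    have xR: "?x \<in> ?R" using u Ko img by blast
    have xb: "?x \<in> bd" "f ?x = y" using xR R(1) F_bd u by (auto simp: K_def)
    obtain U V g where U: "openin (top_of_set bd) U" "?x \<in> U" "openin (top_of_set S) V" "homeomorphism U V f g"
      using y(2) xb unfolding generic_value_def by blast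
    have UR: "openin (top_of_set U) (U \<inter> ?R)"
      by (rule openin_subset_trans[OF openin_Int[OF U(1) R(2)]]) (use openin_imp_subset[OF U(1)] in auto)
    define V2 where "V2 = f ` (U \<inter> ?R)"
    have V2o: "openin (top_of_set S) V2"
      unfolding V2_def using homeomorphism_imp_open_map[OF U(4) UR] U(3) openin_trans by blast
    have h2: "homeomorphism (U \<inter> ?R) V2 f g"
    proof (rule homeomorphism_of_subsets[OF U(4)])
      show "V2 \<subseteq> V" unfolding V2_def using homeomorphism_image1[OF U(4)] by blast
    qed (auto simp: V2_def)
    \<comment> \<open>Restricting to the open cube makes \<open>U2\<close> open in the cube and
      gives its image the form \<open>U \<inter> ?R\<close>.\<close>
    define U2 where "U2 = open_cube n \<inter> chart Q \<tau> -` U"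
    have U2im: "chart Q \<tau> ` U2 = U \<inter> ?R" unfolding U2_def img[symmetric] by blast
    have U2c: "U2 \<subseteq> cube n" using open_cube_subset by (auto simp: U2_def)
    have cc: "continuous_on (open_cube n) (chart Q \<tau>)"
      using continuous_on_subset[OF continuous_chart[OF \<tau>(1)]] \<tau>(2) open_cube_subset by metis
    have "openin (top_of_set (open_cube n)) U2"
      unfolding U2_def by (rule continuous_openin_preimage[OF cc _ U(1)]) (use img R(1) in blast)
    then have U2o: "openin (top_of_set (cube n)) U2"
      using openin_open_cube openin_trans by blast
    have h1: "homeomorphism U2 (U \<inter> ?R) (chart Q \<tau>) (coord \<tau>)"
    proof (rule homeomorphism_of_subsets[OF chart_homeomorphism[OF \<tau>(1)]])
      show "U \<inter> ?R \<subseteq> \<tau>" using rel_interior_subset[OF \<tau>(1)] by blast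
    qed (use U2c U2im \<tau>(2) in auto)
    have "homeomorphism U2 V2 (F \<circ> chart Q \<tau>) (coord \<tau> \<circ> g)"
    proof (rule homeomorphism_cong[OF homeomorphism_compose[OF h1 h2]])
      show "(F \<circ> chart Q \<tau>) v = (f \<circ> chart Q \<tau>) v" if "v \<in> U2" for v
        using U2im R(1) F_bd that by auto
    qed auto
    then show "\<exists>U V h. openin (top_of_set (cube n)) U \<and> u \<in> U \<and>
        openin (top_of_set (cube_boundary (Suc n))) V \<and> homeomorphism U V (F \<circ> chart Q \<tau>) h"
      using U2o V2o U(2) u Ko dn by (intro exI[of _ U2] exI[of _ V2] exI[of _ "coord \<tau> \<circ> g"]) (auto simp: U2_def)
  qed
  then show ?thesis using bij_betw_same_card[OF bij] by simp
qed

lemma even_generic_preimages: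
  assumes y: "avoids y" "generic_value f bd S y" "finite {x \<in> bd. f x = y}"
  shows "even (card {x \<in> bd. f x = y})"
proof -
  have yS: "y \<in> S" using y(2) by (simp add: generic_value_def)
  obtain \<epsilon> where eps: "0 < \<epsilon>" "\<epsilon> \<le> 1/2" "\<And>\<tau>. \<tau> \<in> cells Q \<Longrightarrow> cdim Q \<tau> = n \<Longrightarrow> K y \<tau> \<subseteq> mid_cube n \<epsilon>"
    using uniform_margin[OF y(1)] by blast
  let ?C = "{\<tau> \<in> cells Q. cdim Q \<tau> = n \<and> card (cofaces \<tau>) = 1}"
  let ?P = "\<lambda>\<tau>. {x \<in> rel_interior_cell Q \<tau>. f x = y}"
  have finC: "finite ?C" using finite_cells by simp
  have Rb: "rel_interior_cell Q \<tau> \<subseteq> bd" if "\<tau> \<in> ?C" for \<tau>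
    using coface_cases[OF dn, of \<tau>] that by auto
  have un: "{x \<in> bd. f x = y} = (\<Union>\<tau>\<in>?C. ?P \<tau>)"
  proof
    show "(\<Union>\<tau>\<in>?C. ?P \<tau>) \<subseteq> {x \<in> bd. f x = y}" using Rb by blast
    show "{x \<in> bd. f x = y} \<subseteq> (\<Union>\<tau>\<in>?C. ?P \<tau>)"
    proof
      fix x assume x: "x \<in> {x \<in> bd. f x = y}"
      then have xM: "x \<in> M" using bd_subset by blast
      then obtain \<sigma> where \<sigma>: "\<sigma> \<in> cells Q" "x \<in> \<sigma>" using cover by blast
      have Fx: "F x = y" using x F_bd by simp
      obtain \<rho> where \<rho>: "\<rho> \<in> cells Q" "x \<in> rel_interior_cell Q \<rho>" "n \<le> cdim Q \<rho>"
        by (rule avoids_rel_interior[OF y(1) \<sigma> Fx]) (rule that)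
      \<comment> \<open>The interior of a \<open>d\<close>-cell contains no boundary point, so
        avoidance leaves dimension \<open>n\<close>; a cell with two cofaces is ruled out for the
        same reason.\<close>
      have "cdim Q \<rho> \<noteq> d" using top_cell_interior[OF \<rho>(1)] \<rho>(2) x by blast
      then have dim: "cdim Q \<rho> = n" using cdim_le[OF \<rho>(1)] \<rho>(3) dn by simp
      then have "card (cofaces \<rho>) = 1" using coface_cases[OF dn \<rho>(1)] \<rho>(2) x by blast
      then show "x \<in> (\<Union>\<tau>\<in>?C. ?P \<tau>)" using \<rho> dim x by blast
    qed
  qed
  have finP: "finite (?P \<tau>)" if "\<tau> \<in> ?C" for \<tau>
    by (rule finite_subset[OF _ y(3)]) (use Rb[OF that] in blast)
  have "card (\<Union>\<tau>\<in>?C. ?P \<tau>) = (\<Sum>\<tau>\<in>?C. card (?P \<tau>))"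
  proof (rule card_UN_disjoint[OF finC])
    show "\<forall>\<tau>\<in>?C. finite (?P \<tau>)" using finP by blast
    show "\<forall>\<tau>\<in>?C. \<forall>\<tau>'\<in>?C. \<tau> \<noteq> \<tau>' \<longrightarrow> ?P \<tau> \<inter> ?P \<tau>' = {}"
      using rel_interior_unique by blast
  qed
  moreover have "even (\<Sum>\<tau>\<in>?C. card (?P \<tau>))"
    unfolding even_sum_iff[OF finC]
  proof -
    have "odd (card (?P \<tau>)) \<longleftrightarrow> odd_cell \<epsilon> y \<tau>" if "\<tau> \<in> ?C" for \<tau>
      using odd_cell_single_coface[OF y eps(1,2) eps(3), of \<tau>] that by simp
    then have "{\<tau> \<in> ?C. odd (card (?P \<tau>))} = {\<tau> \<in> cells Q. cdim Q \<tau> = n \<and> card (cofaces \<tau>) = 1 \<and> odd_cell \<epsilon> y \<tau>}"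
      by blast
    then show "even (card {\<tau> \<in> ?C. odd (card (?P \<tau>))})"
      using even_odd_cells_single[OF yS y(1) eps] by simp
  qed
  ultimately show ?thesis unfolding un by simp
qed

lemma deg2_zero: "deg2 f bd S = 0"
proof (rule ccontr)
  assume ne: "deg2 f bd S \<noteq> 0"
  have "\<exists>y. generic_value f bd S y \<and> odd (card {x \<in> bd. f x = y})"
  proof (rule ccontr)
    assume "\<not> ?thesis"
    then have "deg2 f bd S = 0" unfolding deg2_def by (rule if_not_P)
    then show False using ne by contradiction
  qed
  then obtain y where y: "generic_value f bd S y" "odd (card {x \<in> bd. f x = y})"
    by (elim exE conjE)
  \<comment> \<open>An infinite set has cardinality 0, which is even.\<close>
  have fin: "finite {x \<in> bd. f x = y}" by (rule card_ge_0_finite[OF odd_pos[OF y(2)]])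
  have cb: "compact bd" using closedin_bd compact_M closedin_compact by blast
  have cf: "continuous_on bd f" by (rule continuous_on_subset[OF continuous_f_L[OF L] bd_subset])
  obtain V where V: "openin (top_of_set S) V" "y \<in> V"
    "\<And>y'. y' \<in> V \<Longrightarrow> generic_value f bd S y' \<and> card {x \<in> bd. f x = y'} = card {x \<in> bd. f x = y}"
    using generic_value_nearby[OF cb cf bd_im y(1) fin] by blast
  have "{x \<in> bd. f x = y} \<noteq> {}" using y(2) by (metis card.empty even_zero)
  then have "M \<noteq> {}" using bd_subset by blast
  \<comment> \<open>The generic value given by the degree may lie on small cells; its neighbours
    have the same number of preimages, and one of them avoids these cells.\<close>
  then obtain y' where y': "y' \<in> V" "avoids y'" using exists_avoiding[OF V(1)] V(2) by blast
  have odd: "odd (card {x \<in> bd. f x = y'})" using V(3)[OF y'(1)] y(2) by simp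
  have "finite {x \<in> bd. f x = y'}" by (rule card_ge_0_finite[OF odd_pos[OF odd]])
  then show False using even_generic_preimages[OF y'(2)] V(3)[OF y'(1)] odd by blast
qed

end

theorem theorem2:
  fixes d :: nat
    and M :: "'a::euclidean_space set"
    and Q :: "'a cell_system"
    and L :: "'a \<Rightarrow> nat \<Rightarrow> real"
  assumes "compact_pl_manifold d M"
    and "quadrangulation d M Q"
    and "\<forall>v\<in>vertices Q. L v \<in> cube_vertices d"
    and "f_L d Q L ` manifold_boundary d M \<subseteq> cube_boundary d"
    and "deg2 (f_L d Q L) (manifold_boundary d M) (cube_boundary d) \<noteq> 0"
  shows "\<exists>\<sigma>\<in>cells Q. centrally_labelled d Q L \<sigma>"
proof (rule ccontr)
  assume no: "\<not> ?thesis"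
  show False
  proof (cases d)
    case 0
    \<comment> \<open>The boundary of the 0-cube is empty, so no value is generic and the degree is
      0 by definition.\<close>
    have "\<not> generic_value (f_L d Q L) (manifold_boundary d M) (cube_boundary d) y" for y
      by (simp add: generic_value_def cube_boundary_def 0)
    then show False using assms(5) by (simp add: deg2_def)
  next
    case (Suc n)
    interpret labelled_manifold d M Q L n
      using assms no Suc by unfold_locales auto
    show False using deg2_zero assms(5) by blast
  qed
qed

end
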